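(* Let $a\in\mathbb{R}$. For all $t\in[0,1)$, $x\in\mathbb{R}$ and $\pi\in[0,1]$, the value function $$V(t,x,\pi)=\sup_{0\le\tau\le 1-t}\mathbb{E}_\pi\bigl[X^{t,x}_{t+\tau}\bigr]$$ satisfies $$V(t,x,\pi)\ge\bigl(1-\Pi(t,x,\pi)\bigr)\,\mathbb{E}_0\bigl[X^{t,x}_{(t+\tau_b)\wedge 1}\bigr]+\Pi(t,x,\pi)\,V_1^a(t,x),$$ where $\tau_b=\inf\{s\ge0 : X^{t,x}_{t+s}\ge b(t+s)\}$ with $b(u)=a+\alpha\sqrt{1-u}$.
   Context: Setting. The process $X$ is either a Brownian motion with known drift $a$ ($\theta=0$) or a Brownian bridge pinning to $a$ at time $1$ ($\theta=1$), and $\theta$ is not observed. Learning starts at time $0$ with $X_0=0$ and prior belief $\pi\in[0,1]$ that $\theta=1$. If the process is at $x$ at time $t\in[0,1)$, the updated belief that $\theta=1$ is $$\Pi(t,x,\pi):=\frac{\frac{\pi}{1-\pi}L^a(t,x)}{1+\frac{\pi}{1-\pi}L^a(t,x)}=\frac{\pi L^a(t,x)}{1-\pi+\pi L^a(t,x)},\qquad L^a(t,x):=\frac{1}{\sqrt{1-t}}\exp\Bigl(-\frac{(x-at)^2}{2(1-t)}\Bigr)$$ (the last expression for $\Pi$ is used for $\pi=1$, giving $\Pi(t,x,1)=1$). Embedded problem. Given $(t,x,\pi)$, under $\mathbb{P}_\pi$ the process $X=X^{t,x}$ starts at $X_t=x$, the hidden variable $\theta$ takes the value $1$ with probability $\Pi(t,x,\pi)$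 and $0$ with probability $1-\Pi(t,x,\pi)$, and $$dX_{t+s}=\Bigl[(1-\theta)a+\theta\,\frac{a-X_{t+s}}{1-t-s}\Bigr]ds+dB_{t+s},\qquad 0\le s<1-t,$$ where $B$ is a standard Brownian motion independent of $\theta$; $X_1$ is the limit of $X_{t+s}$ as $s\uparrow 1-t$. (Equivalently, in the observation filtration, $dX_{t+s}=(a+\Pi_{t+s}\rho(t+s,X_{t+s}))\,ds+d\bar B_{t+s}$ and $d\Pi_{t+s}=\rho(t+s,X_{t+s})\Pi_{t+s}(1-\Pi_{t+s})\,d\bar B_{t+s}$ with $\Pi_t=\Pi(t,x,\pi)$, $\rho(u,y)=\frac{a-y}{1-u}-a$, and $\bar B$ the innovation Brownian motion.) The supremum defining $V$ is over stopping times $\tau$ of the observed process $(X_{t+s})_{s\ge0}$ with $0\le\tau\le1-t$. $\mathbb{E}_0$ denotes expectation under $\mathbb{P}_0$, under which $X^{t,x}$ is a Brownian motion with drift $a$ started from $x$ at time $t$. By convention $\inf\emptyset=\infty$. Known-pinning value function. Let $\pi_\circ=3.14159\ldots$ be the circle constant, $\Phi$ the standard normal distribution function, $\alpha\approx 0.839924$ the unique positive solution of $\sqrt{2\pi_\circ}(1-\alpha^2)e^{\alpha^2/2}\Phi(\alpha)=\alpha$, and $b(t):=a+\alpha\sqrt{1-t}$. For $t<1$, $$V_1^a(t,x):=\begin{cases}a+\sqrt{2\pi_\circ(1-t)}\,(1-\alpha^2)\exp\bigl(\frac{(x-a)^2}{2(1-t)}\bigr)\Phi\bigl(\frac{x-a}{\sqrt{1-t}}\bigr),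 & x<b(t),\\ x, & x\ge b(t).\end{cases}$$ This is the known value function of optimally stopping a Brownian bridge started from $x$ at time $t$ and pinning to $a$ at time $1$, and $\tau_b$ is the known optimal stopping time for that problem. *)

theory Defs
  imports "HOL-Probability.Probability"
begin

locale standard_brownian_motion = prob_space M
  for M :: "'w measure" and B :: "real \<Rightarrow> 'w \<Rightarrow> real" +
  assumes BM_measurable: "\<And>s. 0 \<le> s \<Longrightarrow> B s \<in> borel_measurable M"
    and BM_start: "AE \<omega> in M. B 0 \<omega> = 0"
    and BM_normal: "\<And>r s. 0 \<le> r \<Longrightarrow> r < s \<Longrightarrow>
      distributed M lborel (\<lambda>\<omega>. B s \<omega> - B r \<omega>) (normal_density 0 (sqrt (s - r)))"
    and BM_indep: "\<And>(u :: nat \<Rightarrow> real) n. 0 \<le> u 0 \<Longrightarrow> (\<And>i. i < n \<Longrightarrow> u i \<le> u (Suc i)) \<Longrightarrow>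
      indep_vars (\<lambda>_. borel) (\<lambda>i \<omega>. B (u (Suc i)) \<omega> - B (u i) \<omega>) {..<n}"
    and BM_continuous: "AE \<omega> in M. continuous_on {0..} (\<lambda>s. B s \<omega>)"

definition likelihood :: "real \<Rightarrow> real \<Rightarrow> real \<Rightarrow> real" where
  "likelihood a t x = 1 / sqrt (1 - t) * exp (- ((x - a * t)\<^sup>2 / (2 * (1 - t))))"

definition belief :: "real \<Rightarrow> real \<Rightarrow> real \<Rightarrow> real \<Rightarrow> real" where
  "belief a t x p = p * likelihood a t x / (1 - p + p * likelihood a t x)"

text \<open>
  The process \<open>X\<close> started from \<open>x\<close> at time \<open>t\<close>, with prior belief \<open>p\<close> at time \<open>0\<close>.
  \<open>X\<close> is indexed by absolute time in \<open>[t, 1]\<close>, while \<open>B s\<close> is the increment of the driving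
  Brownian motion over \<open>[t, t + s]\<close>.  The noise is additive, so the stochastic
  differential equation is the pathwise integral equation \<open>dynamics\<close>, whose case \<open>s = 0\<close>
  contains the initial condition.  Regularity of the paths of \<open>X\<close> is required surely, so that
  hitting times of closed sets are stopping times of the raw filtration of \<open>X\<close>.
\<close>

locale embedded_problem = standard_brownian_motion M B
  for M :: "'w measure" and a t x p :: real
    and \<theta> :: "'w \<Rightarrow> real" and B X :: "real \<Rightarrow> 'w \<Rightarrow> real" +
  assumes theta_measurable: "\<theta> \<in> borel_measurable M"
    and theta_1: "prob {\<omega> \<in> space M. \<theta> \<omega> = 1} = belief a t x p"
    and theta_0: "prob {\<omega> \<in> space M. \<theta> \<omega> = 0} = 1 - belief a t x p"
    and theta_indep: "indep_set
      (sigma_sets (space M) {\<theta> -` A \<inter> space M | A. A \<in> sets borel})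
      (sigma_sets (space M) {B s -` A \<inter> space M | s A. 0 \<le> s \<and> A \<in> sets borel})"
    and X_measurable: "\<And>u. t \<le> u \<Longrightarrow> u \<le> 1 \<Longrightarrow> X u \<in> borel_measurable M"
    and X_continuous: "\<And>\<omega>. \<omega> \<in> space M \<Longrightarrow> continuous_on {t..<1} (\<lambda>u. X u \<omega>)"
    and X_terminal: "\<And>\<omega>. \<omega> \<in> space M \<Longrightarrow> ((\<lambda>u. X u \<omega>) \<longlongrightarrow> X 1 \<omega>) (at_left 1)"
    and dynamics: "AE \<omega> in M. \<forall>s. 0 \<le> s \<and> s < 1 - t \<longrightarrow>
      X (t + s) \<omega> = x + integral {0..s}
        (\<lambda>r. (1 - \<theta> \<omega>) * a + \<theta> \<omega> * ((a - X (t + r) \<omega>) / (1 - t - r))) + B s \<omega>"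

text \<open>
  Stopping times run on the shifted clock \<open>s\<close>, with \<open>s = 0\<close> corresponding to time \<open>t\<close>.
  The filtration is constant from \<open>s = 1 - t\<close> on and trivial for \<open>s < 0\<close>.
\<close>

definition observed_filtration ::
    "'w measure \<Rightarrow> real \<Rightarrow> (real \<Rightarrow> 'w \<Rightarrow> real) \<Rightarrow> real \<Rightarrow> 'w measure" where
  "observed_filtration M t X s = sigma (space M)
    {X (t + r) -` A \<inter> space M | r A. 0 \<le> r \<and> r \<le> s \<and> r \<le> 1 - t \<and> A \<in> sets borel}"

definition admissible_times ::
    "'w measure \<Rightarrow> real \<Rightarrow> (real \<Rightarrow> 'w \<Rightarrow> real) \<Rightarrow> ('w \<Rightarrow> real) set" where
  "admissible_times M t X = {\<tau>. stopping_time (observed_filtration M t X) \<tau> \<and>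
    (\<forall>\<omega>\<in>space M. 0 \<le> \<tau> \<omega> \<and> \<tau> \<omega> \<le> 1 - t)}"

text \<open>The supremum is taken in \<^typ>\<open>ereal\<close>, where it exists without a boundedness side condition.\<close>

definition stopping_value ::
    "'w measure \<Rightarrow> real \<Rightarrow> (real \<Rightarrow> 'w \<Rightarrow> real) \<Rightarrow> ereal" where
  "stopping_value M t X =
    (SUP \<tau>\<in>admissible_times M t X. ereal (\<integral>\<omega>. X (t + \<tau> \<omega>) \<omega> \<partial>M))"

abbreviation std_normal_cdf :: "real \<Rightarrow> real" where
  "std_normal_cdf \<equiv> cdf std_normal_distribution"

definition alpha :: real where
  "alpha = (THE z. 0 < z \<and>
    sqrt (2 * pi) * (1 - z\<^sup>2) * exp (z\<^sup>2 / 2) * std_normal_cdf z = z)"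

definition bridge_boundary :: "real \<Rightarrow> real \<Rightarrow> real" where
  "bridge_boundary a u = a + alpha * sqrt (1 - u)"

definition bridge_value :: "real \<Rightarrow> real \<Rightarrow> real \<Rightarrow> real" where
  "bridge_value a t x =
    (if x < bridge_boundary a t
     then a + sqrt (2 * pi * (1 - t)) * (1 - alpha\<^sup>2) * exp ((x - a)\<^sup>2 / (2 * (1 - t)))
            * std_normal_cdf ((x - a) / sqrt (1 - t))
     else x)"

definition boundary_hitting_time ::
    "real \<Rightarrow> real \<Rightarrow> (real \<Rightarrow> 'w \<Rightarrow> real) \<Rightarrow> 'w \<Rightarrow> ereal" where
  "boundary_hitting_time a t X \<omega> =
    Inf (ereal ` {s. 0 \<le> s \<and> s \<le> 1 - t \<and> X (t + s) \<omega> \<ge> bridge_boundary a (t + s)})"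

end

(*
  Stop at the first time X reaches the bridge boundary b. Given theta = 0, X is a Brownian motion with
  drift a and the payoff depends only on the law of the driving path at countably many times, so it
  has the same mean as under P_0. Given theta = 1, put c = 1 - t. Then Z = (X - a) / (c - s) is a
  Brownian motion run with the clock T = 1 / (c - s), so exp (m Z - m^2 T / 2) is a martingale for
  every m, and the boundary becomes Z = alpha sqrt T. Stopping at the minimum of the hitting time
  and some S < c, and bounding Z by alpha sqrt T, gives

    P (theta = 1) exp (m Z_0 - m^2 T_0 / 2)
      <= E [exp (m alpha sqrt T - m^2 T / 2); theta = 1]       for all m >= 0.

  Integrated over m, both sides become Gaussian integrals; the equation that defines alpha turns the
  right one into a multiple of E [sqrt (c - s)] at the stopping time s, and the left one is
  V_1 - a up to the same factor. Let S tend to c.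

  No stochastic integral is needed: Z is the limit of Riemann sums of dB / (c - s) along the path, and
  optional stopping is applied to the products of independent exponentials that these sums generate.
*)

theory Submission
  imports Defs
begin

section \<open>Gaussian integrals and the constant alpha\<close>

text \<open>On the boundary the exponent m alpha sqrt T - m^2 T / 2 depends on m sqrt T alone, so
  its integral over m >= 0 is a constant times 1 / sqrt T = sqrt (c - s). The payoff there is a +
  alpha sqrt (c - s), so a bound on the mean of sqrt (c - s) is a bound on the mean payoff. Taking m
  >= 0 lets Z <= alpha sqrt T be used at a capped time that may precede the hit. The cap S < c keeps
  the clock bounded; this gives the second moment bound behind the passage from products to the
  limit. The obstacle is that the hitting time belongs to X, which also depends on \<theta>, while
  optional stopping runs on increments of B. The event of not having hit is therefore rebuilt from B
  by the bridge formula. It is the right event only where \<theta> = 1, which suffices: the products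
  carry that indicator, and its independence of B supplies the factor P (\<theta> = 1). Path
  functionals read countably many dyadic times. This gives measurability, adaptedness to the raw
  filtration, and transfer to the space of P_0.\<close>

lemma nn_integral_exp_quadratic:
  fixes y T :: real
  assumes T: "0 < T"
  shows "(\<integral>\<^sup>+m. ennreal (exp (m * y - m\<^sup>2 * T / 2)) * indicator {0..} m \<partial>lborel)
    = ennreal (sqrt (2 * pi / T) * exp (y\<^sup>2 / (2 * T)) * std_normal_cdf (y / sqrt T))"
proof -
  define z where "z = y / sqrt T"
  define C where "C = exp (- z\<^sup>2 / 2) / sqrt (2 * pi)"
  have C: "0 < C" by (simp add: C_def)
  let ?I = "\<integral>\<^sup>+m. ennreal (exp (m * y - m\<^sup>2 * T / 2)) * indicator {0..} m \<partial>lborel"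
  interpret N: prob_space std_normal_distribution
    by (rule prob_space_normal_density) simp
  \<comment> \<open>The substitution u = z - m sqrt T completes the square and carries m >= 0 to u
    <= z, so the half-line integral becomes a value of the normal cdf.\<close>
  have pt: "ennreal (std_normal_density (z + (- sqrt T) * m)) * indicator {..z} (z + (- sqrt T) * m)
      = ennreal C * (ennreal (exp (m * y - m\<^sup>2 * T / 2)) * indicator {0..} m)" for m
  proof -
    have "z * sqrt T = y" using T by (simp add: z_def)
    then have "(z + (- sqrt T) * m)\<^sup>2 = z\<^sup>2 - 2 * (m * y) + m\<^sup>2 * T"
      using T by (auto simp: power2_eq_square algebra_simps)
    then have "std_normal_density (z + (- sqrt T) * m) = C * exp (m * y - m\<^sup>2 * T / 2)"
      by (simp add: std_normal_density_def C_def exp_add[symmetric] algebra_simps add_divide_distrib diff_divide_distrib)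
    moreover have "z + (- sqrt T) * m \<le> z \<longleftrightarrow> 0 \<le> m"
      using T by (simp add: zero_le_mult_iff)
    ultimately show ?thesis
      using C by (simp add: indicator_def ennreal_mult)
  qed
  have "ennreal (std_normal_cdf z) = emeasure std_normal_distribution {..z}"
    unfolding cdf_def by (simp add: N.emeasure_eq_measure)
  also have "\<dots> = (\<integral>\<^sup>+x. ennreal (std_normal_density x) * indicator {..z} x \<partial>lborel)"
    by (subst emeasure_density) auto
  also have "\<dots> = ennreal (sqrt T) * (\<integral>\<^sup>+m. ennreal (std_normal_density (z + (- sqrt T) * m))
      * indicator {..z} (z + (- sqrt T) * m) \<partial>lborel)"
    using T by (subst nn_integral_real_affine[where c="- sqrt T" and t=z]) auto
  also have "\<dots> = ennreal (sqrt T) * (ennreal C * ?I)"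
    unfolding pt by (subst nn_integral_cmult) auto
  finally have eq: "ennreal (std_normal_cdf z) = ennreal (sqrt T * C) * ?I"
    using T C by (simp add: ennreal_mult mult.assoc)
  have pos: "0 < sqrt T * C" using T C by simp
  have "?I = ennreal (1 / (sqrt T * C)) * (ennreal (sqrt T * C) * ?I)"
    using T C by (subst mult.assoc[symmetric], subst ennreal_mult[symmetric]) auto
  also have "\<dots> = ennreal (1 / (sqrt T * C) * std_normal_cdf z)"
    unfolding eq[symmetric] using pos by (intro ennreal_mult[symmetric]) (auto simp: cdf_def)
  also have "1 / (sqrt T * C) * std_normal_cdf z
      = sqrt (2 * pi / T) * exp (y\<^sup>2 / (2 * T)) * std_normal_cdf (y / sqrt T)"
  proof -
    have "z\<^sup>2 = y\<^sup>2 / T" using T by (simp add: z_def power_divide)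
    then have "1 / (sqrt T * C) = sqrt (2 * pi / T) * exp (y\<^sup>2 / (2 * T))"
      by (simp add: C_def exp_minus real_sqrt_divide field_simps)
    then show ?thesis by (simp add: z_def)
  qed
  finally show ?thesis .
qed

text \<open>On a window around \<open>z\<close> the cdf is a constant plus a Riemann integral of the
  density over a compact interval, so the fundamental theorem of calculus applies.\<close>

lemma std_normal_cdf_has_real_derivative:
  "(std_normal_cdf has_real_derivative std_normal_density z) (at z)"
proof -
  interpret N: real_distribution std_normal_distribution
    by (rule real_dist_normal_dist)
  have cont: "continuous_on S std_normal_density" for S
    unfolding std_normal_density_def[abs_def] by (intro continuous_intros) auto
  have F: "std_normal_cdf u = std_normal_cdf (z - 1) + integral {z - 1..u} std_normal_density"
    if u: "u \<in> {z - 1<..<z + 1}" for u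
  proof -
    have "std_normal_cdf u - std_normal_cdf (z - 1) = measure std_normal_distribution {z - 1<..u}"
      using u by (subst N.cdf_diff_eq) auto
    also have "\<dots> = (\<integral>x. indicator {z - 1<..u} x \<partial>std_normal_distribution)"
      by simp
    also have "\<dots> = (\<integral>x. std_normal_density x * indicator {z - 1<..u} x \<partial>lborel)"
      by (subst integral_density) auto
    also have "\<dots> = (\<integral>x. indicator {z - 1..u} x *\<^sub>R std_normal_density x \<partial>lborel)"
      using AE_lborel_singleton[of "z - 1"]
      by (intro integral_cong_AE) (auto simp: indicator_def)
    also have "\<dots> = integral {z - 1..u} std_normal_density"
      unfolding set_lebesgue_integral_def[symmetric]
      by (intro set_borel_integral_eq_integral borel_integrable_atLeastAtMost' cont)
    finally show ?thesis by simp
  qed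
  have "((\<lambda>u. integral {z - 1..u} std_normal_density) has_real_derivative std_normal_density z)
      (at z within {z - 1..z + 1})"
    by (rule integral_has_real_derivative[OF cont]) auto
  then have "((\<lambda>u. integral {z - 1..u} std_normal_density) has_real_derivative std_normal_density z) (at z)"
    by (subst (asm) at_within_Icc_at) auto
  then have "((\<lambda>u. std_normal_cdf (z - 1) + integral {z - 1..u} std_normal_density)
      has_real_derivative std_normal_density z) (at z)"
    by (auto intro!: derivative_eq_intros)
  then show ?thesis
    by (rule DERIV_cong_ev[THEN iffD1, rotated 3])
       (auto intro!: eventually_mono[OF eventually_nhds_in_open[of "{z - 1<..<z + 1}"]] dest: F)
qed

text \<open>A zero of the cdf would, by the integral formula with T = 1, force a strictly positive
  integrand to vanish almost everywhere on the half-line.\<close>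

lemma std_normal_cdf_pos: "0 < std_normal_cdf z"
proof (rule ccontr)
  assume "\<not> 0 < std_normal_cdf z"
  then have "std_normal_cdf z = 0" by (simp add: cdf_def zero_less_measure_iff)
  then have "(\<integral>\<^sup>+m. ennreal (exp (m * z - m\<^sup>2 * 1 / 2)) * indicator {0..} m \<partial>lborel) = 0"
    by (subst nn_integral_exp_quadratic) auto
  then have "AE m in lborel. ennreal (exp (m * z - m\<^sup>2 * 1 / 2)) * indicator {0..} m = 0"
    by (subst (asm) nn_integral_0_iff_AE) auto
  then have "AE m in lborel. m \<notin> {0..1::real}"
    by eventually_elim (auto simp: indicator_def split: if_splits)
  then have "{0..1::real} \<in> null_sets lborel"
    by (simp add: AE_iff_null_sets)
  then show False by (simp add: null_sets_def)
qed

text \<open>A positive solution lies below 1, since from 1 on the left side of the equation is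
  nonpositive. Existence is the intermediate value theorem on [0, 1]; uniqueness is the strict
  monotonicity of \<open>k\<close> on (0, 1).\<close>

lemma alpha_properties:
  "0 < alpha" "alpha < 1"
  "sqrt (2 * pi) * (1 - alpha\<^sup>2) * exp (alpha\<^sup>2 / 2) * std_normal_cdf alpha = alpha"
proof -
  let ?P = "\<lambda>z. 0 < z \<and> sqrt (2 * pi) * (1 - z\<^sup>2) * exp (z\<^sup>2 / 2) * std_normal_cdf z = z"
  \<comment> \<open>The equation divided by (1 - z^2) exp (z^2 / 2). In this form the density terms
    cancel in the derivative, which is exp (- z^2 / 2) * 2 z^2 / (1 - z^2)^2 and hence
    positive.\<close>
  define k where "k z = z * exp (- z\<^sup>2 / 2) / (1 - z\<^sup>2) - sqrt (2 * pi) * std_normal_cdf z" for z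
  have less1: "z < 1" if "?P z" for z
  proof (rule ccontr)
    assume "\<not> z < 1"
    then have "1 - z\<^sup>2 \<le> 0" using one_le_power[of z 2] by simp
    then have "sqrt (2 * pi) * (1 - z\<^sup>2) * exp (z\<^sup>2 / 2) * std_normal_cdf z \<le> 0"
      using std_normal_cdf_pos[of z] by (intro mult_nonpos_nonneg mult_nonneg_nonpos) auto
    then show False using that by simp
  qed
  have sq: "z\<^sup>2 < 1" if "0 < z" "z < 1" for z :: real
    using that by (simp add: power_less_one_iff)
  have k0: "k z = 0 \<longleftrightarrow> ?P z" if "0 < z" "z < 1" for z
    using sq[OF that] that by (simp add: k_def exp_minus field_simps) (auto simp: algebra_simps)
  have deriv: "\<exists>d>0. (k has_real_derivative d) (at z)" if z: "0 < z" "z < 1" for z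
  proof -
    let ?e = "exp (- z\<^sup>2 / 2)"
    have dens: "sqrt (2 * pi) * std_normal_density z = ?e"
      by (simp add: std_normal_density_def)
    have "((\<lambda>z. z * exp (- z\<^sup>2 / 2) / (1 - z\<^sup>2)) has_real_derivative
        ((?e - z\<^sup>2 * ?e) * (1 - z\<^sup>2) + 2 * z\<^sup>2 * ?e) / (1 - z\<^sup>2)\<^sup>2) (at z)"
      using sq[OF z] by (auto intro!: derivative_eq_intros simp: power2_eq_square algebra_simps)
    from DERIV_diff[OF this DERIV_cmult[OF std_normal_cdf_has_real_derivative, of "sqrt (2 * pi)"]]
    have "(k has_real_derivative
        ((?e - z\<^sup>2 * ?e) * (1 - z\<^sup>2) + 2 * z\<^sup>2 * ?e) / (1 - z\<^sup>2)\<^sup>2 - ?e) (at z)"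
      unfolding k_def[abs_def] dens .
    moreover have "((?e - z\<^sup>2 * ?e) * (1 - z\<^sup>2) + 2 * z\<^sup>2 * ?e) / (1 - z\<^sup>2)\<^sup>2 - ?e
        = ?e * (2 * z\<^sup>2) / (1 - z\<^sup>2)\<^sup>2"
      using sq[OF z] by (simp add: field_simps) (simp add: power2_eq_square power4_eq_xxxx algebra_simps)
    moreover have "0 < ?e * (2 * z\<^sup>2) / (1 - z\<^sup>2)\<^sup>2"
      using sq[OF z] z by (intro divide_pos_pos mult_pos_pos) auto
    ultimately show ?thesis by metis
  qed
  have mono: "k u < k v" if "0 < u" "u < v" "v < 1" for u v
  proof (rule DERIV_pos_imp_increasing[OF that(2)])
    fix w assume "u \<le> w" "w \<le> v"
    then show "\<exists>d. (k has_real_derivative d) (at w) \<and> 0 < d"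
      using deriv[of w] that by auto
  qed
  have contF: "continuous_on {0..1} (\<lambda>z. sqrt (2 * pi) * (1 - z\<^sup>2) * exp (z\<^sup>2 / 2) * std_normal_cdf z - z)"
    using std_normal_cdf_has_real_derivative
    by (intro continuous_intros continuous_at_imp_continuous_on ballI DERIV_isCont) auto
  have "\<exists>z\<ge>0. z \<le> 1 \<and> sqrt (2 * pi) * (1 - z\<^sup>2) * exp (z\<^sup>2 / 2) * std_normal_cdf z - z = 0"
    by (rule IVT2'[OF _ _ _ contF]) (auto simp: cdf_def)
  then obtain z where z: "0 \<le> z" "z \<le> 1" "sqrt (2 * pi) * (1 - z\<^sup>2) * exp (z\<^sup>2 / 2) * std_normal_cdf z = z"
    by auto
  have "z \<noteq> 0" using z std_normal_cdf_pos[of 0] by auto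
  with z have Pz: "?P z" by simp
  have uniq: "u = z" if "?P u" for u
  proof -
    have "k u = 0" "k z = 0" using k0 Pz that less1 by blast+
    then show ?thesis
      using mono[of u z] mono[of z u] Pz[THEN conjunct1] that[THEN conjunct1] less1[OF Pz] less1[OF that]
      by linarith
  qed
  have al: "alpha = z"
    unfolding alpha_def using Pz uniq by (rule the_equality)
  show "0 < alpha" "alpha < 1"
    "sqrt (2 * pi) * (1 - alpha\<^sup>2) * exp (alpha\<^sup>2 / 2) * std_normal_cdf alpha = alpha"
    unfolding al using Pz less1[OF Pz] by blast+
qed

section \<open>Independence, optional stopping and Brownian increments\<close>

text \<open>Independence enters as a product formula for events of \<open>F\<close>, the form in
  which it is available both for Brownian increments and for \<theta>. Preimages of Borel sets form
  a pi-system, so this already gives independence of the two variables.\<close>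

lemma (in prob_space) integral_mult_indep:
  fixes X Y :: "'a \<Rightarrow> real"
  assumes F: "subalgebra M F" and X: "X \<in> borel_measurable F" "integrable M X"
    and Y: "integrable M Y"
    and ind: "\<And>a E. a \<in> sets F \<Longrightarrow> E \<in> sets borel \<Longrightarrow>
      prob (a \<inter> (Y -` E \<inter> space M)) = prob a * prob (Y -` E \<inter> space M)"
  shows "integrable M (\<lambda>\<omega>. X \<omega> * Y \<omega>)" "expectation (\<lambda>\<omega>. X \<omega> * Y \<omega>) = expectation X * expectation Y"
proof -
  have XM[measurable]: "X \<in> borel_measurable M"
    using F X(1) by (rule measurable_from_subalg)
  have YM[measurable]: "Y \<in> borel_measurable M" using Y by auto
  have sp: "space F = space M" using F by (simp add: subalgebra_def)
  have set: "X -` A \<inter> space M \<in> sets F" if "A \<in> sets borel" for A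
    using measurable_sets[OF X(1) that] by (simp add: sp)
  have "indep_set {X -` A \<inter> space M |A. A \<in> sets borel} {Y -` A \<inter> space M |A. A \<in> sets borel}"
  proof (rule indep_setI, goal_cases)
    case 1 then show ?case by auto
  next
    case 2 then show ?case by auto
  next
    case (3 a b) then show ?case using ind set by auto
  qed
  moreover have "Int_stable {Z -` A \<inter> space M |A. A \<in> sets borel}" for Z :: "'a \<Rightarrow> real"
  proof (rule Int_stableI, clarify)
    fix A B :: "real set" assume "A \<in> sets borel" "B \<in> sets borel"
    then show "\<exists>C. Z -` A \<inter> space M \<inter> (Z -` B \<inter> space M) = Z -` C \<inter> space M \<and> C \<in> sets borel"
      by (intro exI[of _ "A \<inter> B"]) auto
  qed
  ultimately have "indep_var borel X borel Y"
    unfolding indep_var_eq using XM YM by (auto intro!: indep_set_sigma_sets)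
  then show "integrable M (\<lambda>\<omega>. X \<omega> * Y \<omega>)" "expectation (\<lambda>\<omega>. X \<omega> * Y \<omega>) = expectation X * expectation Y"
    using X(2) Y by (auto intro!: indep_var_integrable indep_var_lebesgue_integral)
qed

text \<open>Discrete optional stopping: the switch \<open>A k\<close> is decided by
  \<open>F k\<close>, of which the mean-one factor \<open>\<xi> k\<close> is independent, so no
  factor changes the expectation. Read \<open>A k\<close> as the event of not having stopped by step
  k.\<close>

lemma (in prob_space) expectation_stopped_prod:
  fixes \<xi> :: "nat \<Rightarrow> 'a \<Rightarrow> real"
  assumes F: "\<And>k. k \<le> N \<Longrightarrow> subalgebra M (F k)"
    and mono: "\<And>k. k < N \<Longrightarrow> subalgebra (F (Suc k)) (F k)"
    and A: "\<And>k. k < N \<Longrightarrow> A k \<in> sets (F k)"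
    and \<xi>: "\<And>k. k < N \<Longrightarrow> \<xi> k \<in> borel_measurable (F (Suc k))"
      "\<And>k. k < N \<Longrightarrow> integrable M (\<xi> k)" "\<And>k. k < N \<Longrightarrow> expectation (\<xi> k) = 1"
    and ind: "\<And>k a E. k < N \<Longrightarrow> a \<in> sets (F k) \<Longrightarrow> E \<in> sets borel \<Longrightarrow>
      prob (a \<inter> (\<xi> k -` E \<inter> space M)) = prob a * prob (\<xi> k -` E \<inter> space M)"
    and "n \<le> N"
  defines "Q \<equiv> \<lambda>n \<omega>. \<Prod>k<n. if \<omega> \<in> A k then \<xi> k \<omega> else 1"
  shows "Q n \<in> borel_measurable (F n) \<and> integrable M (Q n) \<and> expectation (Q n) = 1"
  using \<open>n \<le> N\<close>
proof (induction n)
  case 0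
  then show ?case by (simp add: Q_def prob_space)
next
  case (Suc n)
  then have n: "n < N" and Qm: "Q n \<in> borel_measurable (F n)" and Qi: "integrable M (Q n)"
    and Q1: "expectation (Q n) = 1" by auto
  have A'[measurable]: "A n \<in> sets (F n)" using A n by auto
  then have AM: "A n \<in> sets M" using F[of n] n by (auto simp: subalgebra_def)
  note Qm[measurable]
  have m1: "(\<lambda>\<omega>. Q n \<omega> * indicator (A n) \<omega>) \<in> borel_measurable (F n)"
    by measurable
  have i1: "integrable M (\<lambda>\<omega>. Q n \<omega> * indicator (A n) \<omega>)"
    using Qi AM by (rule integrable_real_mult_indicator[rotated])
  have prod: "integrable M (\<lambda>\<omega>. Q n \<omega> * indicator (A n) \<omega> * \<xi> n \<omega>)"
    "expectation (\<lambda>\<omega>. Q n \<omega> * indicator (A n) \<omega> * \<xi> n \<omega>)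
      = expectation (\<lambda>\<omega>. Q n \<omega> * indicator (A n) \<omega>) * expectation (\<xi> n)"
    by (rule integral_mult_indep[OF F[OF less_imp_le[OF n]] m1 i1 \<xi>(2)[OF n]], rule ind[OF n], assumption+)+
  \<comment> \<open>The stopped part keeps its value; only the part still running is multiplied by
    the new factor.\<close>
  have eq: "Q (Suc n) = (\<lambda>\<omega>. Q n \<omega> - Q n \<omega> * indicator (A n) \<omega> + Q n \<omega> * indicator (A n) \<omega> * \<xi> n \<omega>)"
    by (auto simp: Q_def fun_eq_iff indicator_def)
  have up: "f \<in> borel_measurable (F (Suc n))" if "f \<in> borel_measurable (F n)" for f :: "'a \<Rightarrow> real"
    using mono[OF n] that by (rule measurable_from_subalg)
  have "Q (Suc n) \<in> borel_measurable (F (Suc n))"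
    unfolding eq by (intro borel_measurable_add borel_measurable_diff borel_measurable_times[of "\<lambda>\<omega>. Q n \<omega> * indicator (A n) \<omega>"]
        \<xi>(1)[OF n] up[OF m1] up[OF Qm])
  moreover have "integrable M (Q (Suc n))"
    unfolding eq by (intro Bochner_Integration.integrable_add Bochner_Integration.integrable_diff prod Qi i1)
  moreover have "expectation (Q (Suc n)) = 1"
    unfolding eq using prod Qi i1 Q1 \<xi>(3)[OF n] by simp
  ultimately show ?case by auto
qed

text \<open>Exponential tilting: the centred normal density times this exponential is the normal
  density with mean \<open>l * d\<close>, which has total mass 1.\<close>

lemma (in prob_space) exponential_moment_normal:
  assumes D: "distributed M lborel Z (normal_density 0 (sqrt d))" and d: "0 < d"
  shows "integrable M (\<lambda>\<omega>. exp (l * Z \<omega> - l\<^sup>2 * d / 2))"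
    "expectation (\<lambda>\<omega>. exp (l * Z \<omega> - l\<^sup>2 * d / 2)) = 1"
proof -
  have "- ((z - l * d)\<^sup>2 / (2 * d)) = - (z\<^sup>2 / (2 * d)) + (l * z - l\<^sup>2 * d / 2)" for z
    using d by (simp add: field_simps power2_eq_square)
  then have eq: "normal_density 0 (sqrt d) z * exp (l * z - l\<^sup>2 * d / 2)
      = normal_density (l * d) (sqrt d) z" for z
    using d by (simp add: normal_density_def exp_add[symmetric])
  show "integrable M (\<lambda>\<omega>. exp (l * Z \<omega> - l\<^sup>2 * d / 2))"
    by (subst distributed_integrable[OF D, symmetric]) (auto simp: eq d)
  show "expectation (\<lambda>\<omega>. exp (l * Z \<omega> - l\<^sup>2 * d / 2)) = 1"
    by (subst distributed_integral[OF D, symmetric]) (auto simp: eq d)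
qed

text \<open>If \<open>f n\<close> is bounded in \<open>L\<^sup>2\<close>, then \<open>f n \<le> min (f n) K + (f n)\<^sup>2 / K\<close> replaces a dominating function.\<close>

lemma (in prob_space) expectation_ge_limit_L2:
  fixes f :: "nat \<Rightarrow> 'a \<Rightarrow> real" and g :: "'a \<Rightarrow> real"
  assumes f: "\<And>n. f n \<in> borel_measurable M" "\<And>n \<omega>. 0 \<le> f n \<omega>"
      "\<And>n. integrable M (\<lambda>\<omega>. (f n \<omega>)\<^sup>2)" "\<And>n. expectation (\<lambda>\<omega>. (f n \<omega>)\<^sup>2) \<le> C"
    and g: "integrable M g"
    and lim: "AE \<omega> in M. (\<lambda>n. f n \<omega>) \<longlonglongrightarrow> g \<omega>"
    and m: "\<And>n. m \<le> expectation (f n)"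
  shows "m \<le> expectation g"
proof -
  have C: "0 \<le> C" using f(4)[of 0] by (rule order_trans[rotated]) simp
  have g0: "AE \<omega> in M. 0 \<le> g \<omega>"
    using lim by eventually_elim (rule LIMSEQ_le_const, auto simp: f)
  \<comment> \<open>Truncation at \<open>K\<close> makes dominated convergence available. The price
    C / K vanishes when \<open>K\<close> runs through the positive integers.\<close>
  have main: "m \<le> expectation g + C / K" if K: "0 < K" for K
  proof -
    note f(1)[measurable]
    have gm[measurable]: "g \<in> borel_measurable M" using g by auto
    have minint: "integrable M (\<lambda>\<omega>. min (f n \<omega>) K)" for n
      by (rule integrable_const_bound[of _ K]) (use f K in auto)
    have fint: "integrable M (f n)" for n
      using square_integrable_imp_integrable[OF f(1,3)] .
    have "m \<le> expectation (\<lambda>\<omega>. min (f n \<omega>) K) + C / K" for n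
    proof -
      have "m \<le> expectation (\<lambda>\<omega>. min (f n \<omega>) K + (f n \<omega>)\<^sup>2 / K)"
      proof (rule order_trans[OF m integral_mono])
        show "f n \<omega> \<le> min (f n \<omega>) K + (f n \<omega>)\<^sup>2 / K" for \<omega>
        proof (cases "f n \<omega> \<le> K")
          case False
          then have "K * f n \<omega> \<le> (f n \<omega>)\<^sup>2"
            using f(2)[of n \<omega>] by (simp add: power2_eq_square mult_right_mono)
          then have "f n \<omega> \<le> (f n \<omega>)\<^sup>2 / K" using K by (simp add: field_simps)
          then show ?thesis using K False by simp
        qed (use K in simp)
      qed (use fint minint f(3) in auto)
      also have "\<dots> = expectation (\<lambda>\<omega>. min (f n \<omega>) K) + expectation (\<lambda>\<omega>. (f n \<omega>)\<^sup>2) / K"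
        using minint f(3) by simp
      also have "\<dots> \<le> expectation (\<lambda>\<omega>. min (f n \<omega>) K) + C / K"
        using f(4)[of n] K by (simp add: divide_right_mono)
      finally show ?thesis .
    qed
    moreover have "(\<lambda>n. expectation (\<lambda>\<omega>. min (f n \<omega>) K)) \<longlonglongrightarrow> expectation (\<lambda>\<omega>. min (g \<omega>) K)"
    proof (rule integral_dominated_convergence[of _ _ _ "\<lambda>_. K"])
      show "AE \<omega> in M. (\<lambda>n. min (f n \<omega>) K) \<longlonglongrightarrow> min (g \<omega>) K"
        using lim by eventually_elim (intro tendsto_intros)
      show "AE \<omega> in M. norm (min (f n \<omega>) K) \<le> K" for n using f(2) K by auto
    qed auto
    ultimately have "m \<le> expectation (\<lambda>\<omega>. min (g \<omega>) K) + C / K"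
      by (intro LIMSEQ_le_const[OF tendsto_add[OF _ tendsto_const]]) auto
    also have "expectation (\<lambda>\<omega>. min (g \<omega>) K) \<le> expectation g"
    proof (rule integral_mono_AE)
      show "integrable M (\<lambda>\<omega>. min (g \<omega>) K)"
        using g0 K by (intro integrable_const_bound[of _ K]) auto
    qed (use g in auto)
    finally show ?thesis by simp
  qed
  have "(\<lambda>n. expectation g + C / real (Suc n)) \<longlonglongrightarrow> expectation g + 0"
    by (intro tendsto_intros LIMSEQ_Suc[OF lim_const_over_n])
  then show ?thesis
    by (intro LIMSEQ_le_const[of "\<lambda>n. expectation g + C / real (Suc n)"] exI[of _ 0]) (auto intro!: main simp del: of_nat_Suc)
qed

section \<open>The dyadic grid and the Brownian past along it\<close>

definition dyadics :: "real \<Rightarrow> real set" where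
  "dyadics S = {S * real k / 2 ^ n | k n. k \<le> 2 ^ n}"

lemma dyadicsI: "k \<le> 2 ^ n \<Longrightarrow> S * real k / 2 ^ n \<in> dyadics S"
  unfolding dyadics_def by blast

lemma dyadics_bounds: "0 < S \<Longrightarrow> r \<in> dyadics S \<Longrightarrow> 0 \<le> r \<and> r \<le> S"
proof -
  assume S: "0 < S" and "r \<in> dyadics S"
  then obtain k n where r: "r = S * (real k / 2 ^ n)" "k \<le> 2 ^ n" by (auto simp: dyadics_def)
  then have "real k / 2 ^ n \<le> 1" by (simp flip: of_nat_le_iff)
  then have "S * (real k / 2 ^ n) \<le> S * 1" using S by (intro mult_left_mono) auto
  then show ?thesis using r S by simp
qed

lemma dyadics_refine:
  assumes "l \<le> (n::nat)"
  shows "S * real k / 2 ^ l = S * real (k * 2 ^ (n - l)) / 2 ^ n"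
proof -
  have "(2::real) ^ n = 2 ^ l * 2 ^ (n - l)" using assms by (simp add: power_add[symmetric])
  then show ?thesis by simp
qed

context standard_brownian_motion
begin

text \<open>Increments from time 0 take the place of the values of \<open>B\<close>, because the
  independence axiom speaks of increments. Dyadic times suffice for every event that is stopped on
  later, and they reduce the independence of the next increment to finite grids.\<close>

definition past :: "real \<Rightarrow> real \<Rightarrow> 'w measure" where
  "past S s = sigma (space M)
    {(\<lambda>\<omega>. B r \<omega> - B 0 \<omega>) -` A \<inter> space M | r A. r \<in> dyadics S \<and> r \<le> s \<and> A \<in> sets borel}"

lemma space_past[simp]: "space (past S s) = space M"
  unfolding past_def by (rule space_measure_of) auto

lemma sets_past: "sets (past S s) = sigma_sets (space M)
    {(\<lambda>\<omega>. B r \<omega> - B 0 \<omega>) -` A \<inter> space M | r A. r \<in> dyadics S \<and> r \<le> s \<and> A \<in> sets borel}"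
  unfolding past_def by (rule sets_measure_of) auto

lemma measurable_past: "r \<in> dyadics S \<Longrightarrow> r \<le> s \<Longrightarrow> (\<lambda>\<omega>. B r \<omega> - B 0 \<omega>) \<in> borel_measurable (past S s)"
  by (rule measurableI) (auto simp: sets_past intro!: sigma_sets.Basic)

lemma past_mono: "s \<le> s' \<Longrightarrow> subalgebra (past S s') (past S s)"
  unfolding subalgebra_def sets_past by (auto intro!: sigma_sets_mono'; force)

lemma past_subalgebra: "0 < S \<Longrightarrow> subalgebra M (past S s)"
proof -
  assume "0 < S"
  then have "(\<lambda>\<omega>. B r \<omega> - B 0 \<omega>) \<in> borel_measurable M" if "r \<in> dyadics S" for r
    using dyadics_bounds[OF _ that] by (intro borel_measurable_diff BM_measurable) auto
  from measurable_sets[OF this] show ?thesis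
    unfolding subalgebra_def sets_past by (auto intro!: sets.sigma_sets_subset)
qed

lemma increment_distributed:
  assumes "0 < S"
  shows "distributed M lborel (\<lambda>\<omega>. B (S * real (Suc k) / 2 ^ n) \<omega> - B (S * real k / 2 ^ n) \<omega>)
    (normal_density 0 (sqrt (S / 2 ^ n)))"
proof -
  have "S * real (Suc k) / 2 ^ n - S * real k / 2 ^ n = S / 2 ^ n"
    by (simp add: field_simps)
  moreover have "S * real k / 2 ^ n < S * real (Suc k) / 2 ^ n"
    using assms by (simp add: field_simps)
  ultimately show ?thesis
    using BM_normal[of "S * real k / 2 ^ n" "S * real (Suc k) / 2 ^ n"] assms by simp
qed

text \<open>The past contains dyadic times of every level, while the axiom handles one finite grid
  at a time. For each level m >= n the events of the level-m grid are independent of the increment;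
  the levels increase, so their union \<open>G\<close> is a pi-system, and it generates the
  past.\<close>

lemma past_indep_increment:
  fixes n k :: nat
  assumes S: "0 < S" and a: "a \<in> sets (past S (S * real k / 2 ^ n))" and E: "E \<in> sets borel"
  defines "D \<equiv> \<lambda>\<omega>. B (S * real (Suc k) / 2 ^ n) \<omega> - B (S * real k / 2 ^ n) \<omega>"
  shows "prob (a \<inter> (D -` E \<inter> space M)) = prob a * prob (D -` E \<inter> space M)"
proof -
  let ?s = "S * real k / 2 ^ n"
  have BM[measurable]: "B (S * real i / 2 ^ m) \<in> borel_measurable M" for i m
    using S by (intro BM_measurable) auto
  have B0[measurable]: "B 0 \<in> borel_measurable M" by (intro BM_measurable) auto
  have Dm[measurable]: "D \<in> borel_measurable M" unfolding D_def by measurable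
  define gen where "gen m = {(\<lambda>\<omega>. B (S * real i / 2 ^ m) \<omega> - B 0 \<omega>) -` A \<inter> space M | i A.
      i \<le> k * 2 ^ (m - n) \<and> A \<in> sets borel}" for m
  define G where "G = (\<Union>m\<in>{n..}. sigma_sets (space M) (gen m))"
  have ind: "prob (b \<inter> (D -` E \<inter> space M)) = prob b * prob (D -` E \<inter> space M)"
    if m: "n \<le> m" and b: "b \<in> sigma_sets (space M) (gen m)" and E: "E \<in> sets borel" for m b E
  proof -
    define K where "K = k * 2 ^ (m - n)"
    \<comment> \<open>\<open>K\<close> cells of level m reach the present time \<open>?s\<close>.
      One further step crosses the whole next cell of level n, which makes \<open>D\<close> one of
      finitely many consecutive increments.\<close>
    define u where "u i = (if i \<le> K then S * real i / 2 ^ m else S * real (Suc k) / 2 ^ n)" for i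
    define f where "f \<omega> = (\<lambda>i\<in>{..<K}. B (u (Suc i)) \<omega> - B (u i) \<omega>)" for \<omega>
    have uK: "u K = ?s" unfolding u_def K_def using dyadics_refine[OF m, of S k] by simp
    have u_mono: "u i \<le> u (Suc i)" if "i < Suc K" for i
    proof (cases "i = K")
      case True
      have "?s \<le> S * real (Suc k) / 2 ^ n" using S by (simp add: divide_right_mono)
      then show ?thesis using uK True by (simp add: u_def)
    next
      case False then show ?thesis using S that by (simp add: u_def divide_right_mono)
    qed
    have iv: "indep_vars (\<lambda>_. borel) (\<lambda>i \<omega>. B (u (Suc i)) \<omega> - B (u i) \<omega>) {..<Suc K}"
      by (rule BM_indep) (use u_mono in \<open>auto simp: u_def\<close>)
    have iv2: "indep_var (PiM {..<K} (\<lambda>_. borel)) f (PiM {K} (\<lambda>_. borel))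
        (\<lambda>\<omega>. \<lambda>i\<in>{K}. B (u (Suc i)) \<omega> - B (u i) \<omega>)"
      unfolding f_def by (rule indep_var_restrict[OF iv]) auto
    have fm: "f \<in> measurable M (PiM {..<K} (\<lambda>_. borel))"
      using iv2 by (rule indep_var_rv1)
    \<comment> \<open>By telescoping, every value on the level-m grid up to the present is a partial
      sum of \<open>f\<close>, so \<open>b\<close> is a preimage under the vector of
      increments.\<close>
    have "b \<in> sets (vimage_algebra (space M) f (PiM {..<K} (\<lambda>_. borel)))"
    proof -
      let ?V = "vimage_algebra (space M) f (PiM {..<K} (\<lambda>_. borel))"
      have fV: "f \<in> measurable ?V (PiM {..<K} (\<lambda>_. borel))"
        using fm by (intro measurable_vimage_algebra1) (auto dest: measurable_space)
      have "(\<lambda>\<omega>. B (S * real i / 2 ^ m) \<omega> - B 0 \<omega>) \<in> borel_measurable ?V" if "i \<le> K" for i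
      proof -
        have "(\<lambda>\<omega>. \<Sum>j<i. f \<omega> j) \<in> borel_measurable ?V"
          using that by (intro borel_measurable_sum measurable_compose[OF fV] measurable_component_singleton) auto
        also have "(\<lambda>\<omega>. \<Sum>j<i. f \<omega> j) = (\<lambda>\<omega>. \<Sum>j<i. B (u (Suc j)) \<omega> - B (u j) \<omega>)"
          using that by (intro ext sum.cong) (auto simp: f_def)
        also have "\<dots> = (\<lambda>\<omega>. B (S * real i / 2 ^ m) \<omega> - B 0 \<omega>)"
          using that by (subst sum_lessThan_telescope) (auto simp: u_def)
        finally show ?thesis .
      qed
      from measurable_sets[OF this] have "gen m \<subseteq> sets ?V"
        unfolding gen_def K_def space_vimage_algebra by blast
      then have "sigma_sets (space ?V) (gen m) \<subseteq> sets ?V"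
        by (rule sets.sigma_sets_subset)
      then show ?thesis using b by auto
    qed
    then obtain C where C: "C \<in> sets (PiM {..<K} (\<lambda>_. borel))" "b = f -` C \<inter> space M"
      by (subst (asm) sets_vimage_algebra2) (use fm in \<open>auto dest: measurable_space\<close>)
    let ?E = "{g \<in> space (PiM {K} (\<lambda>_. borel)). g K \<in> E}"
    let ?g = "\<lambda>\<omega>. \<lambda>i\<in>{K}. B (u (Suc i)) \<omega> - B (u i) \<omega>"
    have gD: "?g \<omega> \<in> ?E \<longleftrightarrow> D \<omega> \<in> E" for \<omega>
      using uK by (simp add: D_def u_def space_PiM)
    have "?E \<in> sets (PiM {K} (\<lambda>_. borel))" using E by measurable
    from indep_varD[OF iv2 C(1) this]
    have "prob ((\<lambda>\<omega>. (f \<omega>, ?g \<omega>)) -` (C \<times> ?E) \<inter> space M) = prob (f -` C \<inter> space M) * prob (?g -` ?E \<inter> space M)" .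
    moreover have "(\<lambda>\<omega>. (f \<omega>, ?g \<omega>)) -` (C \<times> ?E) \<inter> space M = b \<inter> (D -` E \<inter> space M)"
      using C gD by blast
    moreover have "?g -` ?E \<inter> space M = D -` E \<inter> space M"
      using gD by blast
    ultimately show ?thesis using C by simp
  qed
  have gen_sub: "gen m \<subseteq> events" for m by (auto simp: gen_def)
  have Gev: "G \<subseteq> events" unfolding G_def using sets.sigma_sets_subset[OF gen_sub] by auto
  have gen_mono: "gen m \<subseteq> gen m'" if "n \<le> m" "m \<le> m'" for m m'
  proof (clarsimp simp: gen_def)
    fix i and A :: "real set" assume i: "i \<le> k * 2 ^ (m - n)" "A \<in> sets borel"
    have "i * 2 ^ (m' - m) \<le> k * 2 ^ (m' - n)"
    proof -
      have "i * 2 ^ (m' - m) \<le> k * 2 ^ (m - n) * 2 ^ (m' - m)" using i by simp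
      also have "\<dots> = k * 2 ^ (m' - n)" using that by (simp add: power_add[symmetric] mult.assoc)
      finally show ?thesis .
    qed
    then show "\<exists>j A'. (\<lambda>\<omega>. B (S * real i / 2 ^ m) \<omega> - B 0 \<omega>) -` A \<inter> space M
        = (\<lambda>\<omega>. B (S * real j / 2 ^ m') \<omega> - B 0 \<omega>) -` A' \<inter> space M \<and> j \<le> k * 2 ^ (m' - n) \<and> A' \<in> sets borel"
      using i dyadics_refine[OF that(2), of S i] by (intro exI[of _ "i * 2 ^ (m' - m)"] exI[of _ A]) auto
  qed
  have "Int_stable G"
  proof (rule Int_stableI)
    fix b b' assume "b \<in> G" "b' \<in> G"
    then obtain m m' where m: "n \<le> m" "n \<le> m'" "b \<in> sigma_sets (space M) (gen m)"
      "b' \<in> sigma_sets (space M) (gen m')" by (auto simp: G_def)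
    let ?m = "max m m'"
    interpret sigma_algebra "space M" "sigma_sets (space M) (gen ?m)"
      using gen_sub[of ?m] sets.space_closed by (intro sigma_algebra_sigma_sets) auto
    have "b \<in> sigma_sets (space M) (gen ?m)" "b' \<in> sigma_sets (space M) (gen ?m)"
      using m sigma_sets_mono'[OF gen_mono[of m ?m]] sigma_sets_mono'[OF gen_mono[of m' ?m]] by auto
    then have "b \<inter> b' \<in> sigma_sets (space M) (gen ?m)" by (rule Int)
    then show "b \<inter> b' \<in> G" using m by (auto simp: G_def intro!: bexI[of _ ?m])
  qed
  moreover have "Int_stable {D -` E \<inter> space M |E. E \<in> sets borel}"
  proof (rule Int_stableI, clarify)
    fix A B :: "real set" assume "A \<in> sets borel" "B \<in> sets borel"
    then show "\<exists>C. D -` A \<inter> space M \<inter> (D -` B \<inter> space M) = D -` C \<inter> space M \<and> C \<in> sets borel"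
      by (intro exI[of _ "A \<inter> B"]) auto
  qed
  moreover have "indep_set G {D -` E \<inter> space M |E. E \<in> sets borel}"
    using Gev ind by (intro indep_setI) (auto simp: G_def)
  ultimately have "indep_set (sigma_sets (space M) G) (sigma_sets (space M) {D -` E \<inter> space M |E. E \<in> sets borel})"
    by (intro indep_set_sigma_sets)
  moreover have "a \<in> sigma_sets (space M) G"
  proof -
    have "sets (past S ?s) \<subseteq> sigma_sets (space M) G"
      unfolding sets_past
    proof (rule sigma_sets_mono, safe)
      fix r and A :: "real set"
      assume r: "r \<in> dyadics S" "r \<le> ?s" and A: "A \<in> sets borel"
      then obtain j l where j: "r = S * real j / 2 ^ l" by (auto simp: dyadics_def)
      let ?m = "max n l"
      have r': "r = S * real (j * 2 ^ (?m - l)) / 2 ^ ?m"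
        unfolding j by (rule dyadics_refine) simp
      have s': "?s = S * real (k * 2 ^ (?m - n)) / 2 ^ ?m"
        by (rule dyadics_refine) simp
      have "real (j * 2 ^ (?m - l)) \<le> real (k * 2 ^ (?m - n))"
        using r(2) S unfolding r' s' by (simp add: divide_le_cancel mult_le_cancel_left_pos)
      then have "j * 2 ^ (?m - l) \<le> k * 2 ^ (?m - n)" by (simp only: of_nat_le_iff)
      then have "(\<lambda>\<omega>. B r \<omega> - B 0 \<omega>) -` A \<inter> space M \<in> gen ?m"
        unfolding gen_def using r' A by blast
      then show "(\<lambda>\<omega>. B r \<omega> - B 0 \<omega>) -` A \<inter> space M \<in> sigma_sets (space M) G"
        by (auto simp: G_def intro!: sigma_sets.Basic bexI[of _ ?m])
    qed
    then show ?thesis using a by auto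
  qed
  moreover have "D -` E \<inter> space M \<in> sigma_sets (space M) {D -` E \<inter> space M |E. E \<in> sets borel}"
    using E by (auto intro!: sigma_sets.Basic)
  ultimately show ?thesis by (rule indep_setD)
qed

end

section \<open>Hitting times and bridge paths\<close>

lemma dyadic_floor:
  fixes S s :: real
  assumes "0 < S" "0 \<le> s" "s \<le> S"
  defines "k \<equiv> \<lambda>n. nat \<lfloor>s * 2 ^ n / S\<rfloor>"
  shows "k n \<le> 2 ^ n" "S * real (k n) / 2 ^ n \<le> s" "s < S * real (k n) / 2 ^ n + S / 2 ^ n"
proof -
  have nn: "0 \<le> s * 2 ^ n / S" using assms by simp
  then have k: "real (k n) \<le> s * 2 ^ n / S" "s * 2 ^ n / S < real (k n) + 1"
    unfolding k_def by linarith+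
  have "s * 2 ^ n / S \<le> 2 ^ n" using assms by (simp add: field_simps)
  with k(1) have "real (k n) \<le> 2 ^ n" by linarith
  then show "k n \<le> 2 ^ n" by simp
  show "S * real (k n) / 2 ^ n \<le> s" using k(1) assms(1-3) by (simp add: field_simps)
  have "s * 2 ^ n < S * real (k n) + S" using k(2) assms(1-3) by (simp add: field_simps)
  then show "s < S * real (k n) / 2 ^ n + S / 2 ^ n" by (simp add: field_simps)
qed

lemma mesh_tendsto_0: "(\<lambda>n. S / 2 ^ n) \<longlonglongrightarrow> (0::real)"
  using LIMSEQ_divide_realpow_zero[of 2 S] by simp

lemma dyadic_floor_tendsto:
  fixes S s :: real
  assumes "0 < S" "0 \<le> s" "s \<le> S"
  shows "(\<lambda>n. S * real (nat \<lfloor>s * 2 ^ n / S\<rfloor>) / 2 ^ n) \<longlonglongrightarrow> s"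
proof (rule tendsto_sandwich)
  show "(\<lambda>n. s - S / 2 ^ n) \<longlonglongrightarrow> s"
    using tendsto_diff[OF tendsto_const mesh_tendsto_0, of s S] by simp
  show "(\<lambda>n. s) \<longlonglongrightarrow> s" by simp
qed (use dyadic_floor[OF assms] in \<open>auto intro!: always_eventually simp: less_imp_le algebra_simps\<close>)

text \<open>A countable criterion for reaching zero from below. A path may touch zero only at a time
  off the grid, hence the tolerance 1 / (l + 1) in place of a sign condition.\<close>

definition dyadic_hit :: "real \<Rightarrow> (real \<Rightarrow> real) \<Rightarrow> real \<Rightarrow> bool" where
  "dyadic_hit S f q \<longleftrightarrow> (\<forall>l. \<exists>r\<in>dyadics S. r \<le> q \<and> - 1 / real (Suc l) < f r)"

text \<open>Forwards, the grid points just below \<open>s\<close> stay at most \<open>q\<close> and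
  approach \<open>s\<close>. Backwards, the maximum of \<open>f\<close> over the compact interval
  exceeds -1 / (l + 1) for every l, so it is nonnegative.\<close>

lemma exists_nonneg_iff_dyadic_hit:
  fixes f :: "real \<Rightarrow> real"
  assumes S: "0 < S" and f: "continuous_on {0..S} f" and q: "0 \<le> q" "q \<le> S"
  shows "(\<exists>s\<in>{0..q}. 0 \<le> f s) \<longleftrightarrow> dyadic_hit S f q"
  unfolding dyadic_hit_def
proof
  assume "\<exists>s\<in>{0..q}. 0 \<le> f s"
  then obtain s where s: "0 \<le> s" "s \<le> q" "0 \<le> f s" by auto
  show "\<forall>l. \<exists>r\<in>dyadics S. r \<le> q \<and> - 1 / real (Suc l) < f r"
  proof
    fix l
    let ?k = "\<lambda>n. nat \<lfloor>s * 2 ^ n / S\<rfloor>" and ?r = "\<lambda>n. S * real (nat \<lfloor>s * 2 ^ n / S\<rfloor>) / 2 ^ n"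
    have sS: "s \<le> S" using s q by simp
    note fl = dyadic_floor[OF S s(1) sS]
    have "(\<lambda>n. f (?r n)) \<longlonglongrightarrow> f s"
      using s sS fl S by (intro continuous_on_tendsto_compose[OF f dyadic_floor_tendsto[OF S s(1) sS]])
        (auto intro!: always_eventually intro: order_trans)
    moreover have "- 1 / real (Suc l) < f s" by (rule less_le_trans[OF _ s(3)]) simp
    ultimately have "eventually (\<lambda>n. - 1 / real (Suc l) < f (?r n)) sequentially"
      by (rule order_tendstoD)
    then obtain n where "- 1 / real (Suc l) < f (?r n)"
      by (auto simp: eventually_sequentially)
    then show "\<exists>r\<in>dyadics S. r \<le> q \<and> - 1 / real (Suc l) < f r"
      using fl(1,2)[of n] s(2) by (intro bexI[of _ "?r n"] dyadicsI) auto
  qed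
next
  assume R: "\<forall>l. \<exists>r\<in>dyadics S. r \<le> q \<and> - 1 / real (Suc l) < f r"
  obtain s where s: "s \<in> {0..q}" "\<And>r. r \<in> {0..q} \<Longrightarrow> f r \<le> f s"
    using continuous_attains_sup[of "{0..q}" f] continuous_on_subset[OF f, of "{0..q}"] q by auto
  have "0 \<le> f s"
  proof (rule ccontr)
    assume "\<not> 0 \<le> f s"
    then obtain l where l: "1 / real (Suc l) < - f s"
      using reals_Archimedean[of "- f s"] by (auto simp: inverse_eq_divide)
    obtain r where "r \<in> dyadics S" "r \<le> q" "- 1 / real (Suc l) < f r" using R by blast
    with s(2)[of r] dyadics_bounds[OF S, of r] l show False by auto
  qed
  then show "\<exists>s\<in>{0..q}. 0 \<le> f s" using s by auto
qed

text \<open>The default \<open>c\<close> is the cap at the horizon: a path without a hit is stopped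
  there.\<close>

definition first_nonneg :: "real \<Rightarrow> (real \<Rightarrow> real) \<Rightarrow> real" where
  "first_nonneg c f = (if \<exists>s\<in>{0..c}. 0 \<le> f s then Inf {s \<in> {0..c}. 0 \<le> f s} else c)"

lemma first_nonneg_bounds:
  assumes "0 \<le> c"
  shows "0 \<le> first_nonneg c f" "first_nonneg c f \<le> c"
proof -
  have bd: "bdd_below {s \<in> {0..c}. 0 \<le> f s}" by (rule bdd_belowI[of _ 0]) auto
  show "0 \<le> first_nonneg c f"
    using assms by (auto simp: first_nonneg_def intro!: cInf_greatest)
  show "first_nonneg c f \<le> c"
    using bd by (auto simp: first_nonneg_def intro: cInf_lower2)
qed

lemma first_nonneg_attained:
  assumes f: "continuous_on {0..c} f" and ex: "\<exists>s\<in>{0..c}. 0 \<le> f s"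
  shows "0 \<le> f (first_nonneg c f)"
proof -
  have cl: "closed {s \<in> {0..c}. 0 \<le> f s}"
    using continuous_closed_preimage[OF f closed_atLeastAtMost, of "{0..}"]
    by (simp add: vimage_def Int_def)
  have "Inf {s \<in> {0..c}. 0 \<le> f s} \<in> {s \<in> {0..c}. 0 \<le> f s}"
    using ex by (intro closed_contains_Inf[OF _ _ cl] bdd_belowI[of _ 0]) auto
  then show ?thesis using ex by (simp add: first_nonneg_def)
qed

lemma first_nonneg_lower: "s \<in> {0..c} \<Longrightarrow> 0 \<le> f s \<Longrightarrow> first_nonneg c f \<le> s"
  unfolding first_nonneg_def by (auto intro!: cInf_lower bdd_belowI[of _ 0])

text \<open>There is no overshoot: a positive value at the first hit would produce an earlier zero
  by the intermediate value theorem.\<close>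

lemma first_nonneg_zero:
  assumes f: "continuous_on {0..c} f" and ex: "\<exists>s\<in>{0..c}. 0 \<le> f s" and "f 0 < 0"
  shows "f (first_nonneg c f) = 0"
proof (rule ccontr)
  let ?s = "first_nonneg c f"
  have c: "0 \<le> c" using ex by auto
  assume "f ?s \<noteq> 0"
  then have pos: "0 < f ?s" using first_nonneg_attained[OF f ex] by simp
  have "\<exists>r\<ge>0. r \<le> ?s \<and> f r = 0"
    by (rule IVT') (use pos assms first_nonneg_bounds[OF c, of f] in \<open>auto intro: continuous_on_subset[OF f]\<close>)
  then obtain r where r: "0 \<le> r" "r \<le> ?s" "f r = 0" by auto
  then have "?s \<le> r" using first_nonneg_bounds[OF c, of f] by (intro first_nonneg_lower) auto
  then show False using r pos by simp
qed

text \<open>The strict bound \<open>q < c\<close> tells a genuine hit from the default value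
  \<open>c\<close>.\<close>

lemma first_nonneg_le_iff:
  assumes f: "continuous_on {0..c} f" and q: "0 \<le> q" "q < c"
  shows "first_nonneg c f \<le> q \<longleftrightarrow> (\<exists>s\<in>{0..q}. 0 \<le> f s)"
proof
  assume le: "first_nonneg c f \<le> q"
  then have ex: "\<exists>s\<in>{0..c}. 0 \<le> f s"
    using q unfolding first_nonneg_def by (auto split: if_splits)
  then show "\<exists>s\<in>{0..q}. 0 \<le> f s"
    using first_nonneg_attained[OF f ex] first_nonneg_bounds[of c f] le q
    by (intro bexI[of _ "first_nonneg c f"]) auto
next
  assume "\<exists>s\<in>{0..q}. 0 \<le> f s"
  then show "first_nonneg c f \<le> q"
    using q first_nonneg_lower[of _ c f] by fastforce
qed

lemma first_nonneg_zero_start: "0 \<le> c \<Longrightarrow> 0 \<le> f 0 \<Longrightarrow> first_nonneg c f = 0"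
  using first_nonneg_lower[of 0 c f] first_nonneg_bounds[of c f] by auto

text \<open>Comparing the integrand with \<open>w\<close> frozen at the right end of each mesh interval, the error is at
  most the oscillation of \<open>w\<close> times the total variation of \<open>1 / (c - s)\<close>.\<close>

lemma bridge_riemann_sum_tendsto:
  fixes w W :: "real \<Rightarrow> real" and k :: "nat \<Rightarrow> nat"
  assumes S: "0 < S" "S < c" and w: "continuous_on {0..S} w" "w 0 = 0"
    and W: "continuous_on {0..S} W"
      "\<And>s. 0 < s \<Longrightarrow> s < S \<Longrightarrow> (W has_real_derivative - (w s / (c - s)\<^sup>2)) (at s)"
    and k: "\<And>n. k n \<le> 2 ^ n" "(\<lambda>n. S * real (k n) / 2 ^ n) \<longlonglongrightarrow> \<sigma>"
  shows "(\<lambda>n. \<Sum>j<k n. (w (S * real (Suc j) / 2 ^ n) - w (S * real j / 2 ^ n)) / (c - S * real j / 2 ^ n))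
    \<longlonglongrightarrow> W \<sigma> - W 0 + w \<sigma> / (c - \<sigma>)"
proof -
  define h where "h s = 1 / (c - s)" for s
  define R where "R n k = (\<Sum>j<k. (w (S * real (Suc j) / 2 ^ n) - w (S * real j / 2 ^ n)) / (c - S * real j / 2 ^ n))" for n k
  \<comment> \<open>Integration by parts for the integral of dw / (c - s): \<open>W\<close> is an
    antiderivative of - w / (c - s)^2, so \<open>L\<close> makes sense for a path \<open>w\<close>
    that is merely continuous.\<close>
  define L where "L s = W s - W 0 + w s / (c - s)" for s
  have grid: "S * real k / 2 ^ n \<in> {0..S}" if "k \<le> 2 ^ n" for k n
    using dyadics_bounds[OF S(1) dyadicsI[OF that]] by auto
  have \<sigma>: "\<sigma> \<in> {0..S}"
    by (rule closed_sequentially[OF closed_atLeastAtMost _ k(2)]) (use grid k in blast)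
  have cL: "continuous_on {0..S} L"
    unfolding L_def using S by (auto intro!: continuous_intros W w)
  have hS: "h s - h 0 \<le> h S" if "s \<in> {0..S}" for s
  proof -
    have "h s \<le> h S" using S that by (simp add: h_def frac_le)
    moreover have "0 \<le> h 0" using S by (simp add: h_def)
    ultimately show ?thesis by linarith
  qed
  have err: "\<bar>R n k - L (S * real k / 2 ^ n)\<bar> \<le> e * (h (S * real k / 2 ^ n) - h 0)"
    if osc: "\<And>u v. u \<in> {0..S} \<Longrightarrow> v \<in> {0..S} \<Longrightarrow> \<bar>u - v\<bar> \<le> S / 2 ^ n \<Longrightarrow> \<bar>w u - w v\<bar> \<le> e"
      and k: "k \<le> 2 ^ n" for n k e
    using k
  proof (induction k)
    case 0
    then show ?case by (simp add: R_def L_def w)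
  next
    case (Suc k)
    let ?u = "S * real k / 2 ^ n" and ?v = "S * real (Suc k) / 2 ^ n"
    have u: "?u \<in> {0..S}" and v: "?v \<in> {0..S}" using Suc.prems by (intro grid; simp)+
    have uv: "?u < ?v" "?v - ?u = S / 2 ^ n" using S by (auto simp: field_simps)
    have "norm ((W ?v + w ?v * h ?v) - (W ?u + w ?v * h ?u)) \<le> e * h ?v - e * h ?u"
    proof (rule differentiable_bound_general[OF uv(1), where f="\<lambda>s. W s + w ?v * h s" and \<phi>="\<lambda>s. e * h s"
          and f'="\<lambda>s. - (w s / (c - s)\<^sup>2) + w ?v * (1 / (c - s)\<^sup>2)" and \<phi>'="\<lambda>s. e * (1 / (c - s)\<^sup>2)"])
      have sub: "{?u..?v} \<subseteq> {0..S}" using u v by auto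
      then have ch: "continuous_on {?u..?v} h"
        unfolding h_def using S by (auto intro!: continuous_intros)
      show "continuous_on {?u..?v} (\<lambda>s. W s + w ?v * h s)" "continuous_on {?u..?v} (\<lambda>s. e * h s)"
        by (intro continuous_intros ch continuous_on_subset[OF W(1) sub])+
      fix s assume s: "?u < s" "s < ?v"
      then have s0: "0 < s" "s < S" "s \<in> {0..S}" using u v by auto
      have dh: "(h has_real_derivative 1 / (c - s)\<^sup>2) (at s)"
        unfolding h_def[abs_def] using s0 S
        by (auto intro!: derivative_eq_intros simp: power2_eq_square)
      show "((\<lambda>s. W s + w ?v * h s) has_vector_derivative - (w s / (c - s)\<^sup>2) + w ?v * (1 / (c - s)\<^sup>2)) (at s)"
        unfolding has_real_derivative_iff_has_vector_derivative[symmetric]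
        by (intro DERIV_add DERIV_cmult W(2) dh s0)
      show "((\<lambda>s. e * h s) has_vector_derivative e * (1 / (c - s)\<^sup>2)) (at s)"
        unfolding has_real_derivative_iff_has_vector_derivative[symmetric]
        by (intro DERIV_cmult dh)
      have "norm (- (w s / (c - s)\<^sup>2) + w ?v * (1 / (c - s)\<^sup>2)) = \<bar>w ?v - w s\<bar> * (1 / (c - s)\<^sup>2)"
        by (simp add: diff_divide_distrib[symmetric])
      also have "\<dots> \<le> e * (1 / (c - s)\<^sup>2)"
        using s uv(2) by (intro mult_right_mono osc v s0) auto
      finally show "norm (- (w s / (c - s)\<^sup>2) + w ?v * (1 / (c - s)\<^sup>2)) \<le> e * (1 / (c - s)\<^sup>2)" .
    qed
    moreover have "R n (Suc k) - L ?v - (R n k - L ?u)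
        = - ((W ?v + w ?v * h ?v) - (W ?u + w ?v * h ?u))"
      by (simp add: R_def L_def h_def diff_divide_distrib)
    ultimately have "\<bar>R n (Suc k) - L ?v - (R n k - L ?u)\<bar> \<le> e * h ?v - e * h ?u"
      by simp
    moreover have "\<bar>R n k - L ?u\<bar> \<le> e * (h ?u - h 0)" using Suc by simp
    ultimately show ?case by (simp add: right_diff_distrib)
  qed
  have "(\<lambda>n. R n (k n) - L (S * real (k n) / 2 ^ n)) \<longlonglongrightarrow> 0"
  proof (rule LIMSEQ_I)
    fix r :: real assume r: "0 < r"
    define e where "e = r / (2 * h S)"
    have hpos: "0 < h S" using S by (simp add: h_def)
    have e: "0 < e" using r hpos by (simp add: e_def)
    have "uniformly_continuous_on {0..S} w"
      by (rule compact_uniformly_continuous[OF w(1)]) simp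
    then obtain d where d: "0 < d" "\<And>u v. u \<in> {0..S} \<Longrightarrow> v \<in> {0..S} \<Longrightarrow> dist v u < d \<Longrightarrow> dist (w v) (w u) < e"
      using e unfolding uniformly_continuous_on_def by metis
    obtain N where N: "\<And>n. N \<le> n \<Longrightarrow> S / 2 ^ n < d"
      using order_tendstoD(2)[OF mesh_tendsto_0 d(1), of S] by (auto simp: eventually_sequentially)
    show "\<exists>N. \<forall>n\<ge>N. norm (R n (k n) - L (S * real (k n) / 2 ^ n) - 0) < r"
    proof (intro exI[of _ N] allI impI)
      fix n assume n: "N \<le> n"
      have "\<bar>R n (k n) - L (S * real (k n) / 2 ^ n)\<bar> \<le> e * (h (S * real (k n) / 2 ^ n) - h 0)"
      proof (rule err[OF _ k(1)])
        fix u v assume "u \<in> {0..S}" "v \<in> {0..S}" "\<bar>u - v\<bar> \<le> S / 2 ^ n"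
        then show "\<bar>w u - w v\<bar> \<le> e" using d(2)[of v u] N[OF n] by (auto simp: dist_real_def)
      qed
      also have "\<dots> \<le> e * h S" using e hS[OF grid[OF k(1)]] by (intro mult_left_mono) auto
      also have "\<dots> < r" using r hpos by (simp add: e_def)
      finally show "norm (R n (k n) - L (S * real (k n) / 2 ^ n) - 0) < r" by simp
    qed
  qed
  moreover have "(\<lambda>n. L (S * real (k n) / 2 ^ n)) \<longlonglongrightarrow> L \<sigma>"
    by (rule continuous_on_tendsto_compose[OF cL k(2) \<sigma>]) (intro always_eventually allI grid k)
  ultimately have "(\<lambda>n. R n (k n) - L (S * real (k n) / 2 ^ n) + L (S * real (k n) / 2 ^ n)) \<longlonglongrightarrow> 0 + L \<sigma>"
    by (rule tendsto_add)
  then show ?thesis by (simp add: R_def L_def)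
qed

text \<open>The sum is the variance accumulated by the Riemann sums of dB / (c - s). Since h v - h u
  = (v - u) h u h v for h = 1 / (c - s), a cell contributes the error (v - u) h u (h v - h u); these
  errors telescope to at most the mesh times a constant.\<close>

lemma bridge_clock_riemann_sum:
  fixes k :: "nat \<Rightarrow> nat"
  assumes S: "0 < S" "S < c"
    and k: "\<And>n. k n \<le> 2 ^ n" "(\<lambda>n. S * real (k n) / 2 ^ n) \<longlonglongrightarrow> \<sigma>"
  defines "T \<equiv> \<lambda>n k. \<Sum>j<k. S / 2 ^ n / (c - S * real j / 2 ^ n)\<^sup>2"
  shows "(\<lambda>n. T n (k n)) \<longlonglongrightarrow> 1 / (c - \<sigma>) - 1 / c"
proof -
  define h where "h s = 1 / (c - s)" for s
  have grid: "S * real k / 2 ^ n \<in> {0..S}" if "k \<le> 2 ^ n" for k n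
    using dyadics_bounds[OF S(1) dyadicsI[OF that]] by auto
  have \<sigma>: "\<sigma> \<in> {0..S}"
    by (rule closed_sequentially[OF closed_atLeastAtMost _ k(2)]) (use grid k in blast)
  have ch: "continuous_on {0..S} h"
    unfolding h_def using S by (auto intro!: continuous_intros)
  have hS: "0 < h s \<and> h s \<le> h S" if "s \<in> {0..S}" for s
    using S that by (auto simp: h_def field_simps)
  have err: "0 \<le> h (S * real k / 2 ^ n) - h 0 - T n k \<and>
      h (S * real k / 2 ^ n) - h 0 - T n k \<le> S / 2 ^ n * h S * (h (S * real k / 2 ^ n) - h 0)"
    if "k \<le> 2 ^ n" for n k
    using that
  proof (induction k)
    case 0
    then show ?case by (simp add: T_def)
  next
    case (Suc k)
    let ?u = "S * real k / 2 ^ n" and ?v = "S * real (Suc k) / 2 ^ n"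
    have u: "?u \<in> {0..S}" and v: "?v \<in> {0..S}" using Suc.prems by (intro grid; simp)+
    have uv: "?v - ?u = S / 2 ^ n" by (simp add: field_simps)
    have hd: "h ?v - h ?u = S / 2 ^ n * (h ?u * h ?v)"
      unfolding uv[symmetric] h_def using u v S by (simp add: diff_frac_eq)
    have le: "h ?u \<le> h ?v" using hd hS[OF u] hS[OF v] S
      by (smt (verit) divide_nonneg_pos mult_nonneg_nonneg zero_less_power)
    have "T n (Suc k) = T n k + S / 2 ^ n * (h ?u * h ?u)"
      by (simp add: T_def h_def power2_eq_square)
    then have step: "h ?v - h 0 - T n (Suc k) = h ?u - h 0 - T n k + S / 2 ^ n * h ?u * (h ?v - h ?u)"
      using hd by (simp add: algebra_simps)
    have "0 \<le> S / 2 ^ n * h ?u * (h ?v - h ?u)"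
      using S hS[OF u] le by simp
    moreover have "S / 2 ^ n * h ?u * (h ?v - h ?u) \<le> S / 2 ^ n * h S * (h ?v - h ?u)"
      using S hS[OF u] le by (intro mult_right_mono mult_left_mono) auto
    ultimately show ?case using Suc step by (simp add: algebra_simps)
  qed
  have lim0: "(\<lambda>n. h (S * real (k n) / 2 ^ n) - h 0 - T n (k n)) \<longlonglongrightarrow> 0"
  proof (rule tendsto_sandwich[where f="\<lambda>_. 0" and h="\<lambda>n. S / 2 ^ n * (h S * h S)"])
    show "(\<lambda>n. S / 2 ^ n * (h S * h S)) \<longlonglongrightarrow> 0"
      using tendsto_mult_right[OF mesh_tendsto_0[of S], of "h S * h S"] by simp
    show "\<forall>\<^sub>F n in sequentially. h (S * real (k n) / 2 ^ n) - h 0 - T n (k n) \<le> S / 2 ^ n * (h S * h S)"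
    proof (intro always_eventually allI)
      fix n
      have "h (S * real (k n) / 2 ^ n) - h 0 \<le> h S"
        using hS[OF grid[OF k(1)[of n]]] hS[of 0] S by simp
      then have "S / 2 ^ n * h S * (h (S * real (k n) / 2 ^ n) - h 0) \<le> S / 2 ^ n * h S * h S"
        using S hS[of S] by (intro mult_left_mono) auto
      then show "h (S * real (k n) / 2 ^ n) - h 0 - T n (k n) \<le> S / 2 ^ n * (h S * h S)"
        using err[OF k(1)[of n]] by (simp add: mult.assoc)
    qed
  qed (use err[OF k(1)] in \<open>auto intro!: always_eventually\<close>)
  have "(\<lambda>n. h (S * real (k n) / 2 ^ n)) \<longlonglongrightarrow> h \<sigma>"
    by (rule continuous_on_tendsto_compose[OF ch k(2) \<sigma>]) (intro always_eventually allI grid k)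
  then have "(\<lambda>n. h (S * real (k n) / 2 ^ n) - h 0 - (h (S * real (k n) / 2 ^ n) - h 0 - T n (k n)))
      \<longlonglongrightarrow> h \<sigma> - h 0 - 0"
    by (intro tendsto_diff lim0 tendsto_const)
  then show ?thesis by (simp add: h_def)
qed

text \<open>A crude bound on the clock, uniform in the level; it controls the second moments of the
  stopped products.\<close>

lemma bridge_clock_sum_le:
  assumes S: "0 < S" "S < c" and "k \<le> 2 ^ n"
  shows "(\<Sum>j<k. S / 2 ^ n / (c - S * real j / 2 ^ n)\<^sup>2) \<le> S / (c - S)\<^sup>2"
proof -
  have "(\<Sum>j<k. S / 2 ^ n / (c - S * real j / 2 ^ n)\<^sup>2) \<le> (\<Sum>j<k. S / 2 ^ n / (c - S)\<^sup>2)"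
  proof (rule sum_mono)
    fix j assume "j \<in> {..<k}"
    then have "S * real j / 2 ^ n \<le> S"
      using dyadics_bounds[OF S(1) dyadicsI[of j n S]] assms by auto
    then show "S / 2 ^ n / (c - S * real j / 2 ^ n)\<^sup>2 \<le> S / 2 ^ n / (c - S)\<^sup>2"
      using S by (intro divide_left_mono power_mono) auto
  qed
  also have "\<dots> = real k * (S / 2 ^ n / (c - S)\<^sup>2)" by simp
  also have "\<dots> \<le> 2 ^ n * (S / 2 ^ n / (c - S)\<^sup>2)"
    using S assms(3) by (intro mult_right_mono) auto
  finally show ?thesis by simp
qed

text \<open>Removing the noise leaves a differentiable path: in the derivative of \<open>W\<close>
  the drift of \<open>Y\<close> cancels and only \<open>w\<close> remains. Pinning is l'Hopital's
  rule with h = 1 / (c - s): W / h tends to - w c, and Y = W / h + w + a.\<close>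

lemma bridge_path:
  fixes Y w :: "real \<Rightarrow> real"
  assumes c: "0 < c" and Y: "continuous_on {0..<c} Y" and w: "continuous_on {0..} w" "w 0 = 0"
    and dyn: "\<And>s. 0 \<le> s \<Longrightarrow> s < c \<Longrightarrow> Y s = x + integral {0..s} (\<lambda>r. (a - Y r) / (c - r)) + w s"
  defines "W \<equiv> \<lambda>s. (Y s - w s - a) / (c - s)"
  shows "continuous_on {0..<c} W" "W 0 = (x - a) / c"
    "\<And>s. 0 < s \<Longrightarrow> s < c \<Longrightarrow> (W has_real_derivative - (w s / (c - s)\<^sup>2)) (at s)"
    "(Y \<longlongrightarrow> a) (at_left c)"
proof -
  show "continuous_on {0..<c} W"
    unfolding W_def using Y w by (auto intro!: continuous_intros intro: continuous_on_subset)
  show "W 0 = (x - a) / c" using dyn[of 0] c w by (simp add: W_def)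
  show dW: "(W has_real_derivative - (w s / (c - s)\<^sup>2)) (at s)" if s: "0 < s" "s < c" for s
  proof -
    obtain d where d: "s < d" "d < c" using s dense by blast
    let ?I = "\<lambda>s. integral {0..s} (\<lambda>r. (a - Y r) / (c - r))"
    have "continuous_on {0..d} (\<lambda>r. (a - Y r) / (c - r))"
      using d by (auto intro!: continuous_intros continuous_on_subset[OF Y])
    then have "(?I has_real_derivative (a - Y s) / (c - s)) (at s within {0..d})"
      using s d by (intro integral_has_real_derivative) auto
    then have dI: "(?I has_real_derivative (a - Y s) / (c - s)) (at s)"
      using s d by (subst (asm) at_within_Icc_at) auto
    have "((\<lambda>s. (x + ?I s - a) / (c - s)) has_real_derivative
        ((a - Y s) / (c - s) * (c - s) + (x + ?I s - a)) / (c - s)\<^sup>2) (at s)"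
      using s by (auto intro!: derivative_eq_intros dI simp: power2_eq_square)
    moreover have "(a - Y s) / (c - s) * (c - s) + (x + ?I s - a) = - w s"
      using s dyn[of s] by simp
    moreover have "\<forall>\<^sub>F u in nhds s. W u = (x + ?I u - a) / (c - u)"
      using eventually_nhds_in_open[of "{0<..<c}" s] s
      by (auto elim!: eventually_mono simp: W_def dyn)
    ultimately show ?thesis by (simp add: DERIV_cong_ev[OF refl _ refl])
  qed
  define h where "h s = 1 / (c - s)" for s
  have ev: "\<forall>\<^sub>F s in at_left c. 0 < s \<and> s < c"
    using eventually_at_left[of 0 c] c by (auto intro!: exI[of _ 0])
  have wl: "(w \<longlongrightarrow> w c) (at_left c)"
  proof -
    have "isCont w c" using continuous_on_interior[OF w(1), of c] c by (simp add: interior_real_atLeast)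
    then show ?thesis by (simp add: isCont_def filterlim_at_split)
  qed
  have "((\<lambda>s. W s / h s) \<longlongrightarrow> - w c) (at_left c)"
  proof (rule lhopital_left_at_top)
    show "LIM s at_left c. h s :> at_top"
      unfolding h_def
      by (rule filterlim_inverse_at_top[where f="\<lambda>s. c - s", simplified inverse_eq_divide])
         (auto intro!: tendsto_eq_intros simp: eventually_at_filter)
    show "\<forall>\<^sub>F s in at_left c. 1 / (c - s)\<^sup>2 \<noteq> 0"
      using ev by eventually_elim auto
    show "\<forall>\<^sub>F s in at_left c. (W has_real_derivative - (w s / (c - s)\<^sup>2)) (at s)"
      using ev by eventually_elim (auto intro: dW)
    show "\<forall>\<^sub>F s in at_left c. (h has_real_derivative 1 / (c - s)\<^sup>2) (at s)"
      using ev unfolding h_def[abs_def]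
      by eventually_elim (auto intro!: derivative_eq_intros simp: power2_eq_square)
    have "\<forall>\<^sub>F s in at_left c. - w s = - (w s / (c - s)\<^sup>2) / (1 / (c - s)\<^sup>2)"
      using ev by eventually_elim simp
    then show "((\<lambda>s. - (w s / (c - s)\<^sup>2) / (1 / (c - s)\<^sup>2)) \<longlongrightarrow> - w c) (at_left c)"
      by (rule Lim_transform_eventually[OF tendsto_minus[OF wl]])
  qed
  then have "((\<lambda>s. W s / h s + w s + a) \<longlongrightarrow> - w c + w c + a) (at_left c)"
    by (intro tendsto_add wl tendsto_const)
  moreover have "\<forall>\<^sub>F s in at_left c. W s / h s + w s + a = Y s"
    using ev by eventually_elim (auto simp: W_def h_def)
  ultimately show "(Y \<longlongrightarrow> a) (at_left c)"
    by (auto intro: Lim_transform_eventually)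
qed

section \<open>Stopped values as functionals of the dyadic path\<close>

lemma countable_dyadics: "countable (dyadics S)"
proof -
  have "dyadics S \<subseteq> (\<lambda>(k, n). S * real k / 2 ^ n) ` (UNIV :: (nat \<times> nat) set)"
    by (auto simp: dyadics_def)
  then show ?thesis by (rule countable_subset) auto
qed

lemma zero_in_dyadics: "0 \<in> dyadics S" and end_in_dyadics: "S \<in> dyadics S"
  using dyadicsI[of 0 0 S] dyadicsI[of 1 0 S] by auto

text \<open>A countable infimum, so it is measurable for arbitrary paths; on continuous paths it is
  \<open>first_nonneg\<close>.\<close>

definition dyadic_hit_time :: "real \<Rightarrow> (real \<Rightarrow> real) \<Rightarrow> real" where
  "dyadic_hit_time S f = (INF q\<in>dyadics S. if dyadic_hit S f q then q else S)"

text \<open>The value of \<open>Y\<close> at the first time it reaches \<open>b\<close> (or at \<open>S\<close>), written so that it depends only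
  on \<open>Y\<close> at dyadic times and is measurable without path regularity.\<close>

definition dyadic_stopped :: "real \<Rightarrow> (real \<Rightarrow> real) \<Rightarrow> (real \<Rightarrow> real) \<Rightarrow> real" where
  "dyadic_stopped S b Y = (if b 0 \<le> Y 0 then Y 0
    else if dyadic_hit S (\<lambda>s. Y s - b s) S then b (dyadic_hit_time S (\<lambda>s. Y s - b s)) else Y S)"

lemma bdd_below_dyadic_hit_time:
  "0 < S \<Longrightarrow> bdd_below ((\<lambda>q. if dyadic_hit S f q then q else S) ` dyadics S)"
  by (rule bdd_belowI[of _ 0]) (auto dest: dyadics_bounds)

lemma dyadic_hit_time_bounds:
  assumes "0 < S"
  shows "0 \<le> dyadic_hit_time S f" "dyadic_hit_time S f \<le> S"
proof -
  show "0 \<le> dyadic_hit_time S f"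
    unfolding dyadic_hit_time_def using zero_in_dyadics assms
    by (intro cINF_greatest) (auto dest: dyadics_bounds)
  show "dyadic_hit_time S f \<le> S"
    unfolding dyadic_hit_time_def using end_in_dyadics assms
    by (intro cINF_lower2[OF bdd_below_dyadic_hit_time[OF assms], of S]) auto
qed

lemma dyadic_above:
  assumes "0 < S" "0 \<le> s" "s < y" "s < S"
  shows "\<exists>q\<in>dyadics S. s \<le> q \<and> q < y"
proof -
  let ?k = "\<lambda>n. nat \<lfloor>s * 2 ^ n / S\<rfloor>"
  note fl = dyadic_floor[OF assms(1,2) less_imp_le[OF assms(4)]]
  \<comment> \<open>The first bound puts the next grid point below \<open>y\<close>; the second
    keeps it inside the grid.\<close>
  obtain n where n: "S / 2 ^ n < y - s" "S / 2 ^ n < S - s"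
    using eventually_conj[OF order_tendstoD(2)[OF mesh_tendsto_0, of "y - s" S]
        order_tendstoD(2)[OF mesh_tendsto_0, of "S - s" S]] assms
    by (auto simp: eventually_sequentially)
  let ?q = "S * real (Suc (?k n)) / 2 ^ n"
  have q: "?q = S * real (?k n) / 2 ^ n + S / 2 ^ n" by (simp add: field_simps)
  have "?q < S" using q n(2) fl(2)[of n] by linarith
  then have "S * real (Suc (?k n)) < S * 2 ^ n" by (simp only: divide_less_eq) simp
  then have "real (Suc (?k n)) < 2 ^ n" using assms(1) by (simp only: mult_less_cancel_left_pos)
  then have "Suc (?k n) \<le> 2 ^ n" by (simp del: of_nat_Suc)
  then have "?q \<in> dyadics S" by (rule dyadicsI)
  moreover have "s \<le> ?q" "?q < y" using q n(1) fl(2,3)[of n] by linarith+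
  ultimately show ?thesis by blast
qed

text \<open>If the first hit comes before \<open>S\<close>, grid points lie arbitrarily close above
  it, and at each of them the hit has been seen.\<close>

lemma first_nonneg_eq_dyadic_hit_time:
  assumes S: "0 < S" and f: "continuous_on {0..S} f"
  shows "first_nonneg S f = dyadic_hit_time S f"
proof (rule antisym)
  have hit: "dyadic_hit S f q \<longleftrightarrow> (\<exists>s\<in>{0..q}. 0 \<le> f s)" if "q \<in> dyadics S" for q
    using exists_nonneg_iff_dyadic_hit[OF S f, of q] dyadics_bounds[OF S that] by simp
  show "first_nonneg S f \<le> dyadic_hit_time S f"
    unfolding dyadic_hit_time_def
  proof (rule cINF_greatest)
    fix q assume q: "q \<in> dyadics S"
    have "first_nonneg S f \<le> q" if "s \<in> {0..q}" "0 \<le> f s" for s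
      using first_nonneg_lower[of s S f] that dyadics_bounds[OF S q] by auto
    then show "first_nonneg S f \<le> (if dyadic_hit S f q then q else S)"
      using hit[OF q] first_nonneg_bounds(2)[of S f] S by auto
  qed (use zero_in_dyadics in auto)
  show "dyadic_hit_time S f \<le> first_nonneg S f"
  proof (rule ccontr)
    assume "\<not> dyadic_hit_time S f \<le> first_nonneg S f"
    then have lt: "first_nonneg S f < dyadic_hit_time S f" by simp
    have lS: "first_nonneg S f < S" using lt dyadic_hit_time_bounds(2)[OF S, of f] by linarith
    then have ex: "\<exists>s\<in>{0..S}. 0 \<le> f s" by (auto simp: first_nonneg_def split: if_splits)
    obtain q where q: "q \<in> dyadics S" "first_nonneg S f \<le> q" "q < dyadic_hit_time S f"
      using dyadic_above[OF S _ lt lS] first_nonneg_bounds(1)[of S f] S by auto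
    have "dyadic_hit S f q"
      using hit[OF q(1)] first_nonneg_attained[OF f ex] first_nonneg_bounds(1)[of S f] S q(2) by force
    then have "dyadic_hit_time S f \<le> q"
      unfolding dyadic_hit_time_def by (intro cINF_lower2[OF bdd_below_dyadic_hit_time[OF S] q(1)]) simp
    then show False using q(3) by simp
  qed
qed

text \<open>A path that starts at or above the boundary stops at its start. A hit from below does
  not overshoot, so the boundary value replaces the path value at a random time. Without a hit the
  terminal value remains.\<close>

lemma stopped_eq_dyadic_stopped:
  assumes S: "0 < S" and Y: "continuous_on {0..S} Y" and b: "continuous_on {0..S} b"
  shows "Y (first_nonneg S (\<lambda>s. Y s - b s)) = dyadic_stopped S b Y"
proof -
  let ?f = "\<lambda>s. Y s - b s"
  have f: "continuous_on {0..S} ?f" by (intro continuous_intros Y b)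
  have hit: "dyadic_hit S ?f S \<longleftrightarrow> (\<exists>s\<in>{0..S}. 0 \<le> ?f s)"
    using exists_nonneg_iff_dyadic_hit[OF S f, of S] S by simp
  consider "b 0 \<le> Y 0" | "Y 0 < b 0" "\<exists>s\<in>{0..S}. 0 \<le> ?f s" | "Y 0 < b 0" "\<not> (\<exists>s\<in>{0..S}. 0 \<le> ?f s)"
    by linarith
  then show ?thesis
  proof cases
    case 1
    then show ?thesis using first_nonneg_zero_start[of S ?f] S by (simp add: dyadic_stopped_def)
  next
    case 2
    then have "?f (first_nonneg S ?f) = 0" by (intro first_nonneg_zero f) auto
    then show ?thesis
      using 2 hit first_nonneg_eq_dyadic_hit_time[OF S f] by (simp add: dyadic_stopped_def)
  next
    case 3
    then show ?thesis using hit by (simp add: dyadic_stopped_def first_nonneg_def)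
  qed
qed

lemma dyadic_hit_cong: "(\<And>r. r \<in> dyadics S \<Longrightarrow> f r = g r) \<Longrightarrow> dyadic_hit S f = dyadic_hit S g"
  by (auto simp: dyadic_hit_def fun_eq_iff)

lemma dyadic_stopped_cong:
  assumes "\<And>r. r \<in> dyadics S \<Longrightarrow> Y r = Z r"
  shows "dyadic_stopped S b Y = dyadic_stopped S b Z"
proof -
  have "dyadic_hit S (\<lambda>s. Y s - b s) = dyadic_hit S (\<lambda>s. Z s - b s)"
    by (rule dyadic_hit_cong) (simp add: assms)
  then show ?thesis
    using assms zero_in_dyadics end_in_dyadics by (simp add: dyadic_stopped_def dyadic_hit_time_def)
qed

lemma dyadic_stopped_bound:
  assumes "0 < S" "\<And>s. 0 \<le> s \<Longrightarrow> s \<le> S \<Longrightarrow> \<bar>b s\<bar> \<le> C"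
  shows "\<bar>dyadic_stopped S b Y\<bar> \<le> \<bar>Y 0\<bar> + \<bar>Y S\<bar> + C"
  using assms(2)[OF dyadic_hit_time_bounds[OF assms(1), of "\<lambda>s. Y s - b s"]]
  unfolding dyadic_stopped_def by auto

text \<open>Only times up to \<open>q\<close> are read. With \<open>N\<close> a sigma-algebra of the
  past this is adaptedness.\<close>

lemma pred_dyadic_hit[measurable]:
  assumes "\<And>r. r \<in> dyadics S \<Longrightarrow> r \<le> q \<Longrightarrow> Y r \<in> borel_measurable N"
  shows "Measurable.pred N (\<lambda>\<omega>. dyadic_hit S (\<lambda>r. Y r \<omega>) q)"
proof -
  have "{\<omega> \<in> space N. \<forall>l. \<exists>r\<in>{r \<in> dyadics S. r \<le> q}. - 1 / real (Suc l) < Y r \<omega>} \<in> sets N"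
  proof (intro sets.sets_Collect_countable_All sets.sets_Collect_countable_Ex')
    show "countable {r \<in> dyadics S. r \<le> q}"
      by (rule countable_subset[OF _ countable_dyadics[of S]]) auto
    fix l r assume "r \<in> {r \<in> dyadics S. r \<le> q}"
    then have [measurable]: "Y r \<in> borel_measurable N" using assms by auto
    show "{\<omega> \<in> space N. - 1 / real (Suc l) < Y r \<omega>} \<in> sets N" by measurable
  qed
  then show ?thesis by (simp add: pred_def dyadic_hit_def Bex_def conj_assoc)
qed

lemma measurable_dyadic_hit_time:
  assumes "0 < S" and Y: "\<And>r. r \<in> dyadics S \<Longrightarrow> Y r \<in> borel_measurable N"
  shows "(\<lambda>\<omega>. dyadic_hit_time S (\<lambda>r. Y r \<omega>)) \<in> borel_measurable N"
  unfolding dyadic_hit_time_def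
proof (rule borel_measurable_cINF_real[OF countable_dyadics])
  fix q
  have [measurable]: "Measurable.pred N (\<lambda>\<omega>. dyadic_hit S (\<lambda>r. Y r \<omega>) q)"
    by (intro pred_dyadic_hit Y)
  show "(\<lambda>\<omega>. if dyadic_hit S (\<lambda>r. Y r \<omega>) q then q else S) \<in> borel_measurable N"
    by measurable
qed

lemma measurable_dyadic_stopped:
  assumes S: "0 < S" and Y: "\<And>r. r \<in> dyadics S \<Longrightarrow> Y r \<in> borel_measurable N"
    and b[measurable]: "b \<in> borel_measurable borel"
  shows "(\<lambda>\<omega>. dyadic_stopped S b (\<lambda>r. Y r \<omega>)) \<in> borel_measurable N"
proof -
  have Yb: "(\<lambda>\<omega>. Y r \<omega> - b r) \<in> borel_measurable N" if "r \<in> dyadics S" for r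
    using Y[OF that] by measurable
  note [measurable] = Y[OF zero_in_dyadics] Y[OF end_in_dyadics]
    measurable_dyadic_hit_time[OF S Yb]
  have [measurable]: "Measurable.pred N (\<lambda>\<omega>. dyadic_hit S (\<lambda>r. Y r \<omega> - b r) S)"
    by (intro pred_dyadic_hit Yb)
  show ?thesis unfolding dyadic_stopped_def by measurable
qed

section \<open>The law of the Brownian path on the dyadic grid\<close>

lemma (in standard_brownian_motion) measurable_path:
  "0 < S \<Longrightarrow> (\<lambda>\<omega>. \<lambda>r\<in>dyadics S. B r \<omega> - B 0 \<omega>) \<in> measurable M (PiM (dyadics S) (\<lambda>_. borel))"
  by (intro measurable_restrict borel_measurable_diff BM_measurable) (auto dest: dyadics_bounds)

lemma (in standard_brownian_motion) increments_law:
  assumes S: "0 < S"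
  shows "distr M (PiM {..<2 ^ n} (\<lambda>_. borel))
      (\<lambda>\<omega>. \<lambda>i\<in>{..<2 ^ n}. B (S * real (Suc i) / 2 ^ n) \<omega> - B (S * real i / 2 ^ n) \<omega>)
    = PiM {..<2 ^ n} (\<lambda>_. density lborel (normal_density 0 (sqrt (S / 2 ^ n))))"
proof -
  let ?D = "\<lambda>i \<omega>. B (S * real (Suc i) / 2 ^ n) \<omega> - B (S * real i / 2 ^ n) \<omega>"
  have ne: "{..<2 ^ n :: nat} \<noteq> {}" by (simp add: lessThan_empty_iff)
  have iv: "indep_vars (\<lambda>_. borel) ?D {..<2 ^ n}"
    using S by (intro BM_indep) (auto intro!: divide_right_mono)
  have rv: "?D i \<in> borel_measurable M" for i
    using S by (intro borel_measurable_diff BM_measurable) auto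
  have "distr M (PiM {..<2 ^ n} (\<lambda>_. borel)) (\<lambda>\<omega>. \<lambda>i\<in>{..<2 ^ n}. ?D i \<omega>)
      = PiM {..<2 ^ n} (\<lambda>i. distr M borel (?D i))"
    using indep_vars_iff_distr_eq_PiM'[OF ne, where M'="\<lambda>_. borel" and X="?D"] rv iv by blast
  also have "\<dots> = PiM {..<2 ^ n} (\<lambda>_. density lborel (normal_density 0 (sqrt (S / 2 ^ n))))"
  proof (rule PiM_cong[OF refl])
    fix i
    have "distr M borel (?D i) = distr M lborel (?D i)" by (rule distr_cong) auto
    then show "distr M borel (?D i) = density lborel (normal_density 0 (sqrt (S / 2 ^ n)))"
      using increment_distributed[OF S, of i n] by (simp add: distributed_def)
  qed
  finally show ?thesis .
qed

lemma finite_dyadics_common_level: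
  assumes "finite J" "J \<subseteq> dyadics S"
  shows "\<exists>n \<kappa>. \<forall>r\<in>J. \<kappa> r \<le> 2 ^ n \<and> r = S * real (\<kappa> r) / 2 ^ n"
proof -
  have "\<exists>n. \<forall>r\<in>J. \<exists>k. k \<le> 2 ^ n \<and> r = S * real k / 2 ^ n"
    using assms
  proof (induction rule: finite_induct)
    case empty
    show ?case by simp
  next
    case (insert r J)
    then obtain n where n: "\<forall>r\<in>J. \<exists>k. k \<le> 2 ^ n \<and> r = S * real k / 2 ^ n" by auto
    from insert obtain k l where kl: "k \<le> 2 ^ l" "r = S * real k / 2 ^ l" by (auto simp: dyadics_def)
    have up: "\<exists>k'. k' \<le> 2 ^ max n l \<and> q = S * real k' / 2 ^ max n l"
      if "k \<le> 2 ^ i" "q = S * real k / 2 ^ i" "i \<le> max n l" for k q i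
    proof (intro exI conjI)
      have "k * 2 ^ (max n l - i) \<le> 2 ^ i * 2 ^ (max n l - i)" using that by simp
      also have "\<dots> = 2 ^ max n l" using that by (simp add: power_add[symmetric])
      finally show "k * 2 ^ (max n l - i) \<le> 2 ^ max n l" .
      show "q = S * real (k * 2 ^ (max n l - i)) / 2 ^ max n l"
        using dyadics_refine[OF that(3)] that(2) by simp
    qed
    show ?case
    proof (rule exI[of _ "max n l"], rule ballI)
      fix q assume "q \<in> insert r J"
      then have "q = r \<or> q \<in> J" by simp
      then show "\<exists>k. k \<le> 2 ^ max n l \<and> q = S * real k / 2 ^ max n l"
      proof
        assume "q = r"
        then show "\<exists>k. k \<le> 2 ^ max n l \<and> q = S * real k / 2 ^ max n l" using up[of k l q] kl by simp
      next
        assume "q \<in> J"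
        then obtain k where "k \<le> 2 ^ n" "q = S * real k / 2 ^ n" using n by blast
        then show "\<exists>k. k \<le> 2 ^ max n l \<and> q = S * real k / 2 ^ max n l" using up[of k n q] by simp
      qed
    qed
  qed
  then show ?thesis by metis
qed

text \<open>The right-hand side mentions neither \<open>M\<close> nor \<open>B\<close>: values at
  finitely many dyadic times are partial sums of increments of one level, whose joint law is known.
  This is what allows two unrelated probability spaces to be compared.\<close>

lemma (in standard_brownian_motion) path_law_cylinder:
  assumes S: "0 < S" and J: "finite J" "J \<subseteq> dyadics S" and A: "\<And>r. r \<in> J \<Longrightarrow> A r \<in> sets borel"
    and \<kappa>: "\<And>r. r \<in> J \<Longrightarrow> \<kappa> r \<le> 2 ^ n \<and> r = S * real (\<kappa> r) / 2 ^ n"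
  shows "emeasure (distr M (PiM (dyadics S) (\<lambda>_. borel)) (\<lambda>\<omega>. \<lambda>r\<in>dyadics S. B r \<omega> - B 0 \<omega>))
        (prod_emb (dyadics S) (\<lambda>_. borel) J (Pi\<^sub>E J A))
      = emeasure (PiM {..<2 ^ n} (\<lambda>_. density lborel (normal_density 0 (sqrt (S / 2 ^ n)))))
        {g \<in> space (PiM {..<2 ^ n :: nat} (\<lambda>_. borel :: real measure)). \<forall>r\<in>J. (\<Sum>i<\<kappa> r. g i) \<in> A r}"
proof -
  let ?E = "prod_emb (dyadics S) (\<lambda>_. borel) J (Pi\<^sub>E J A)"
  let ?I = "\<lambda>\<omega>. \<lambda>i\<in>{..<2 ^ n}. B (S * real (Suc i) / 2 ^ n) \<omega> - B (S * real i / 2 ^ n) \<omega>"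
  let ?P = "\<lambda>\<omega>. \<lambda>r\<in>dyadics S. B r \<omega> - B 0 \<omega>"
  define C where "C = {g \<in> space (PiM {..<2 ^ n :: nat} (\<lambda>_. borel :: real measure)). \<forall>r\<in>J. (\<Sum>i<\<kappa> r. g i) \<in> A r}"
  have meas: "(\<lambda>g. \<Sum>i<\<kappa> r. g i) \<in> borel_measurable (PiM {..<2 ^ n :: nat} (\<lambda>_. borel :: real measure))"
    if "r \<in> J" for r
    using \<kappa>[OF that] by (intro borel_measurable_sum measurable_component_singleton) auto
  have C: "C \<in> sets (PiM {..<2 ^ n :: nat} (\<lambda>_. borel :: real measure))"
    unfolding C_def
  proof (rule sets.sets_Collect_countable_All'[OF _ countable_finite[OF J(1)]])
    fix r assume "r \<in> J"
    from measurable_sets[OF meas[OF this] A[OF this]]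
    show "{g \<in> space (PiM {..<2 ^ n :: nat} (\<lambda>_. borel :: real measure)). (\<Sum>i<\<kappa> r. g i) \<in> A r}
        \<in> sets (PiM {..<2 ^ n :: nat} (\<lambda>_. borel :: real measure))"
      by (simp add: vimage_def Int_def conj_commute)
  qed
  have E: "?E \<in> sets (PiM (dyadics S) (\<lambda>_. borel))"
    using J A by (intro measurable_prod_emb sets_PiM_I_finite) auto
  have Im: "?I \<in> measurable M (PiM {..<2 ^ n} (\<lambda>_. borel))"
    using S by (intro measurable_restrict borel_measurable_diff BM_measurable) auto
  have sum: "(\<Sum>i<\<kappa> r. ?I \<omega> i) = B r \<omega> - B 0 \<omega>" if "r \<in> J" for r \<omega>
  proof -
    have "(\<Sum>i<\<kappa> r. ?I \<omega> i) = (\<Sum>i<\<kappa> r. B (S * real (Suc i) / 2 ^ n) \<omega> - B (S * real i / 2 ^ n) \<omega>)"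
      using \<kappa>[OF that] by (intro sum.cong) auto
    also have "\<dots> = B r \<omega> - B 0 \<omega>"
      using \<kappa>[OF that] by (subst sum_lessThan_telescope) auto
    finally show ?thesis .
  qed
  have "?P \<omega> \<in> ?E \<longleftrightarrow> (\<forall>r\<in>J. B r \<omega> - B 0 \<omega> \<in> A r)" for \<omega>
    using J by (auto simp: prod_emb_def PiE_def Pi_def extensional_def)
  moreover have "?I \<omega> \<in> C \<longleftrightarrow> (\<forall>r\<in>J. B r \<omega> - B 0 \<omega> \<in> A r)" if "\<omega> \<in> space M" for \<omega>
    using measurable_space[OF Im that] sum[of _ \<omega>] unfolding C_def by auto
  ultimately have eq: "?P -` ?E \<inter> space M = ?I -` C \<inter> space M" by blast
  have "emeasure (distr M (PiM (dyadics S) (\<lambda>_. borel)) ?P) ?E = emeasure M (?P -` ?E \<inter> space M)"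
    by (rule emeasure_distr[OF measurable_path[OF S] E])
  also have "\<dots> = emeasure (distr M (PiM {..<2 ^ n} (\<lambda>_. borel)) ?I) C"
    unfolding eq by (rule emeasure_distr[OF Im C, symmetric])
  finally show ?thesis unfolding increments_law[OF S] C_def .
qed

lemma brownian_path_law_unique:
  assumes M: "standard_brownian_motion M B" and N: "standard_brownian_motion N B'" and S: "0 < S"
  shows "distr M (PiM (dyadics S) (\<lambda>_. borel)) (\<lambda>\<omega>. \<lambda>r\<in>dyadics S. B r \<omega> - B 0 \<omega>)
    = distr N (PiM (dyadics S) (\<lambda>_. borel)) (\<lambda>\<omega>. \<lambda>r\<in>dyadics S. B' r \<omega> - B' 0 \<omega>)"
proof (rule measure_eqI_PiM_infinite)
  interpret M: standard_brownian_motion M B by fact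
  interpret P: prob_space "distr M (PiM (dyadics S) (\<lambda>_. borel)) (\<lambda>\<omega>. \<lambda>r\<in>dyadics S. B r \<omega> - B 0 \<omega>)"
    by (intro M.prob_space_distr M.measurable_path S)
  show "finite_measure (distr M (PiM (dyadics S) (\<lambda>_. borel)) (\<lambda>\<omega>. \<lambda>r\<in>dyadics S. B r \<omega> - B 0 \<omega>))"
    by (rule P.finite_measure_axioms)
  fix A :: "real \<Rightarrow> real set" and J assume J: "finite J" "J \<subseteq> dyadics S"
    and A: "\<And>i. i \<in> J \<Longrightarrow> A i \<in> sets borel"
  obtain n \<kappa> where \<kappa>: "\<And>r. r \<in> J \<Longrightarrow> \<kappa> r \<le> 2 ^ n \<and> r = S * real (\<kappa> r) / 2 ^ n"
    using finite_dyadics_common_level[OF J] by blast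
  show "emeasure (distr M (PiM (dyadics S) (\<lambda>_. borel)) (\<lambda>\<omega>. \<lambda>r\<in>dyadics S. B r \<omega> - B 0 \<omega>))
      (prod_emb (dyadics S) (\<lambda>_. borel) J (Pi\<^sub>E J A))
    = emeasure (distr N (PiM (dyadics S) (\<lambda>_. borel)) (\<lambda>\<omega>. \<lambda>r\<in>dyadics S. B' r \<omega> - B' 0 \<omega>))
      (prod_emb (dyadics S) (\<lambda>_. borel) J (Pi\<^sub>E J A))"
    using standard_brownian_motion.path_law_cylinder[OF M S J A \<kappa>]
      standard_brownian_motion.path_law_cylinder[OF N S J A \<kappa>] by simp
qed simp_all

section \<open>The stopped exponential martingale\<close>

text \<open>The second moment comes from the same family: on a cell, the square of the factor for m
  is the factor for 2 m times exp (m^2 * clock increment). The product for 2 m again has mean 1, and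
  the total clock is bounded uniformly in n.\<close>

lemma (in standard_brownian_motion) stopped_exponential:
  fixes A :: "nat \<Rightarrow> 'w set"
  assumes S: "0 < S" "S < c" and A: "\<And>j. j < 2 ^ n \<Longrightarrow> A j \<in> sets (past S (S * real j / 2 ^ n))"
  defines "Q \<equiv> \<lambda>m \<omega>. \<Prod>j<2 ^ n. if \<omega> \<in> A j then
    exp (m / (c - S * real j / 2 ^ n) * (B (S * real (Suc j) / 2 ^ n) \<omega> - B (S * real j / 2 ^ n) \<omega>)
      - (m / (c - S * real j / 2 ^ n))\<^sup>2 * (S / 2 ^ n) / 2) else 1"
  shows "Q m \<in> borel_measurable (past S S)" "integrable M (Q m)" "expectation (Q m) = 1"
    "integrable M (\<lambda>\<omega>. (Q m \<omega>)\<^sup>2)" "expectation (\<lambda>\<omega>. (Q m \<omega>)\<^sup>2) \<le> exp (m\<^sup>2 * (S / (c - S)\<^sup>2))"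
proof -
  define D where "D j \<omega> = B (S * real (Suc j) / 2 ^ n) \<omega> - B (S * real j / 2 ^ n) \<omega>" for j \<omega>
  define h where "h m j = m / (c - S * real j / 2 ^ n)" for m and j :: nat
  define \<xi> where "\<xi> m j \<omega> = exp (h m j * D j \<omega> - (h m j)\<^sup>2 * (S / 2 ^ n) / 2)" for m :: real and j \<omega>
  have Q: "Q m \<omega> = (\<Prod>j<2 ^ n. if \<omega> \<in> A j then \<xi> m j \<omega> else 1)" for m \<omega>
    unfolding Q_def \<xi>_def h_def D_def by (rule refl)
  have d: "0 < S / 2 ^ n" using S by simp
  have main: "Q m \<in> borel_measurable (past S (S * real (2 ^ n) / 2 ^ n)) \<and> integrable M (Q m) \<and> expectation (Q m) = 1" for m
    unfolding Q
  proof (rule expectation_stopped_prod[where F="\<lambda>j. past S (S * real j / 2 ^ n)" and N="2 ^ n"])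
    show "subalgebra M (past S (S * real k / 2 ^ n))" for k by (rule past_subalgebra[OF S(1)])
    show "subalgebra (past S (S * real (Suc k) / 2 ^ n)) (past S (S * real k / 2 ^ n))" for k
      using S by (intro past_mono) (simp add: divide_right_mono)
    fix k :: nat assume k: "k < 2 ^ n"
    show "A k \<in> sets (past S (S * real k / 2 ^ n))" by (rule A[OF k])
    have "(\<lambda>\<omega>. (B (S * real (Suc k) / 2 ^ n) \<omega> - B 0 \<omega>) - (B (S * real k / 2 ^ n) \<omega> - B 0 \<omega>))
        \<in> borel_measurable (past S (S * real (Suc k) / 2 ^ n))"
      using k S by (intro borel_measurable_diff measurable_past dyadicsI) (auto simp: divide_right_mono)
    then have [measurable]: "D k \<in> borel_measurable (past S (S * real (Suc k) / 2 ^ n))"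
      by (simp add: D_def[abs_def])
    show "\<xi> m k \<in> borel_measurable (past S (S * real (Suc k) / 2 ^ n))"
      unfolding \<xi>_def[abs_def] by measurable
    have dist: "distributed M lborel (D k) (normal_density 0 (sqrt (S / 2 ^ n)))"
      unfolding D_def[abs_def] by (rule increment_distributed[OF S(1)])
    show "integrable M (\<xi> m k)" "expectation (\<xi> m k) = 1"
      unfolding \<xi>_def[abs_def] by (rule exponential_moment_normal[OF dist d])+
    fix a and E :: "real set" assume a: "a \<in> sets (past S (S * real k / 2 ^ n))" and E: "E \<in> sets borel"
    let ?\<phi> = "\<lambda>z. exp (h m k * z - (h m k)\<^sup>2 * (S / 2 ^ n) / 2)"
    have "?\<phi> \<in> borel_measurable borel" by measurable
    from measurable_sets[OF this E] have "?\<phi> -` E \<in> sets borel" by simp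
    from past_indep_increment[OF S(1) a this]
    have "prob (a \<inter> (D k -` (?\<phi> -` E) \<inter> space M)) = prob a * prob (D k -` (?\<phi> -` E) \<inter> space M)"
      unfolding D_def .
    moreover have "\<xi> m k -` E = D k -` (?\<phi> -` E)" by (auto simp: \<xi>_def)
    ultimately show "prob (a \<inter> (\<xi> m k -` E \<inter> space M)) = prob a * prob (\<xi> m k -` E \<inter> space M)"
      by simp
  qed simp
  then show Q1: "Q m \<in> borel_measurable (past S S)" "integrable M (Q m)" "expectation (Q m) = 1" for m
    by auto
  have Qm[measurable]: "Q m \<in> borel_measurable M" for m using Q1(2)[of m] by auto
  have bound: "(Q m \<omega>)\<^sup>2 \<le> Q (2 * m) \<omega> * exp (m\<^sup>2 * (S / (c - S)\<^sup>2))" for \<omega>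
  proof -
    have "(Q m \<omega>)\<^sup>2 = (\<Prod>j<2 ^ n. (if \<omega> \<in> A j then \<xi> m j \<omega> else 1)\<^sup>2)"
      unfolding Q by (simp add: prod_power_distrib)
    also have "\<dots> \<le> (\<Prod>j<2 ^ n. (if \<omega> \<in> A j then \<xi> (2 * m) j \<omega> else 1) * exp (m\<^sup>2 * (S / 2 ^ n / (c - S * real j / 2 ^ n)\<^sup>2)))"
    proof (intro prod_mono conjI)
      fix j
      have "(\<xi> m j \<omega>)\<^sup>2 = \<xi> (2 * m) j \<omega> * exp (m\<^sup>2 * (S / 2 ^ n / (c - S * real j / 2 ^ n)\<^sup>2))"
        unfolding \<xi>_def h_def exp_double[symmetric] exp_add[symmetric]
        by (simp add: power_mult_distrib power_divide algebra_simps)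
      then show "(if \<omega> \<in> A j then \<xi> m j \<omega> else 1)\<^sup>2
          \<le> (if \<omega> \<in> A j then \<xi> (2 * m) j \<omega> else 1) * exp (m\<^sup>2 * (S / 2 ^ n / (c - S * real j / 2 ^ n)\<^sup>2))"
        using S by simp
    qed simp
    also have "\<dots> = Q (2 * m) \<omega> * exp (m\<^sup>2 * (\<Sum>j<2 ^ n. S / 2 ^ n / (c - S * real j / 2 ^ n)\<^sup>2))"
      unfolding prod.distrib Q by (simp add: exp_sum sum_distrib_left)
    also have "\<dots> \<le> Q (2 * m) \<omega> * exp (m\<^sup>2 * (S / (c - S)\<^sup>2))"
    proof (intro mult_left_mono iffD2[OF exp_le_cancel_iff])
      show "(\<Sum>j<2 ^ n. S / 2 ^ n / (c - S * real j / 2 ^ n)\<^sup>2) \<le> S / (c - S)\<^sup>2"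
        using bridge_clock_sum_le[OF S order_refl] .
    qed (auto simp: Q \<xi>_def intro!: prod_nonneg)
    finally show ?thesis .
  qed
  have int: "integrable M (\<lambda>\<omega>. Q (2 * m) \<omega> * exp (m\<^sup>2 * (S / (c - S)\<^sup>2)))" using Q1(2) by simp
  show i2: "integrable M (\<lambda>\<omega>. (Q m \<omega>)\<^sup>2)"
    by (rule Bochner_Integration.integrable_bound[OF int])
       (use bound in \<open>auto intro!: AE_I2 intro: order_trans[OF _ abs_ge_self]\<close>)
  have "expectation (\<lambda>\<omega>. (Q m \<omega>)\<^sup>2) \<le> expectation (\<lambda>\<omega>. Q (2 * m) \<omega> * exp (m\<^sup>2 * (S / (c - S)\<^sup>2)))"
    by (intro integral_mono i2 int bound)
  then show "expectation (\<lambda>\<omega>. (Q m \<omega>)\<^sup>2) \<le> exp (m\<^sup>2 * (S / (c - S)\<^sup>2))"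
    using Q1(3)[of "2 * m"] by simp
qed

text \<open>With Z = W + w / (c - s) and the clock 1 / (c - s), the limit is the exponential
  martingale at \<sigma> divided by its value at time 0.\<close>

lemma stopped_exponential_tendsto:
  fixes w W :: "real \<Rightarrow> real"
  assumes S: "0 < S" "S < c" and w: "continuous_on {0..S} w" "w 0 = 0"
    and W: "continuous_on {0..S} W"
      "\<And>s. 0 < s \<Longrightarrow> s < S \<Longrightarrow> (W has_real_derivative - (w s / (c - s)\<^sup>2)) (at s)"
    and \<sigma>: "0 \<le> \<sigma>" "\<sigma> \<le> S"
    and A: "\<And>n j. j < 2 ^ n \<Longrightarrow> A n j \<longleftrightarrow> S * real j / 2 ^ n < \<sigma>"
  shows "(\<lambda>n. \<Prod>j<2 ^ n. if A n j then
      exp (m / (c - S * real j / 2 ^ n) * (w (S * real (Suc j) / 2 ^ n) - w (S * real j / 2 ^ n))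
        - (m / (c - S * real j / 2 ^ n))\<^sup>2 * (S / 2 ^ n) / 2) else 1)
    \<longlonglongrightarrow> exp (m * (W \<sigma> + w \<sigma> / (c - \<sigma>) - W 0) - m\<^sup>2 * (1 / (c - \<sigma>) - 1 / c) / 2)"
proof -
  \<comment> \<open>Stopping is decided at left endpoints, so a cell with \<sigma> in its interior
    still carries its factor. The active cells end at \<sigma> rounded up to the grid, hence the
    ceiling.\<close>
  define \<kappa> where "\<kappa> n = nat \<lceil>\<sigma> * 2 ^ n / S\<rceil>" for n
  have nn: "0 \<le> \<sigma> * 2 ^ n / S" for n using S \<sigma> by simp
  have \<kappa>: "\<sigma> * 2 ^ n / S \<le> real (\<kappa> n)" "real (\<kappa> n) < \<sigma> * 2 ^ n / S + 1" for n
    using nn[of n] unfolding \<kappa>_def by linarith+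
  have \<kappa>_le: "\<kappa> n \<le> 2 ^ n" for n
  proof -
    have "\<sigma> * 2 ^ n / S \<le> 2 ^ n" using S \<sigma> by (simp add: field_simps)
    then have "real (\<kappa> n) < 2 ^ n + 1" using \<kappa>(2)[of n] by linarith
    then have "real (\<kappa> n) < real (2 ^ n + 1)" by simp
    then have "\<kappa> n < 2 ^ n + 1" by (simp only: of_nat_less_iff)
    then show ?thesis by simp
  qed
  have lim: "(\<lambda>n. S * real (\<kappa> n) / 2 ^ n) \<longlonglongrightarrow> \<sigma>"
  proof (rule tendsto_sandwich)
    show "(\<lambda>n. \<sigma>) \<longlonglongrightarrow> \<sigma>" by simp
    show "(\<lambda>n. \<sigma> + S / 2 ^ n) \<longlonglongrightarrow> \<sigma>"
      using tendsto_add[OF tendsto_const mesh_tendsto_0, of \<sigma> S] by simp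
    show "\<forall>\<^sub>F n in sequentially. \<sigma> \<le> S * real (\<kappa> n) / 2 ^ n"
      using \<kappa>(1) S by (auto intro!: always_eventually simp: field_simps)
    show "\<forall>\<^sub>F n in sequentially. S * real (\<kappa> n) / 2 ^ n \<le> \<sigma> + S / 2 ^ n"
      using \<kappa>(2) S by (auto intro!: always_eventually less_imp_le simp: field_simps)
  qed
  have A_iff: "A n j \<longleftrightarrow> j < \<kappa> n" if "j < 2 ^ n" for n j
  proof -
    have "A n j \<longleftrightarrow> real j < \<sigma> * 2 ^ n / S" unfolding A[OF that] using S by (simp add: field_simps)
    also have "\<dots> \<longleftrightarrow> j < \<kappa> n"
      using nn[of n] unfolding \<kappa>_def by linarith
    finally show ?thesis .
  qed
  define R where "R n = (\<Sum>j<\<kappa> n. (w (S * real (Suc j) / 2 ^ n) - w (S * real j / 2 ^ n)) / (c - S * real j / 2 ^ n))" for n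
  define T where "T n = (\<Sum>j<\<kappa> n. S / 2 ^ n / (c - S * real j / 2 ^ n)\<^sup>2)" for n
  have eq: "(\<Prod>j<2 ^ n. if A n j then
      exp (m / (c - S * real j / 2 ^ n) * (w (S * real (Suc j) / 2 ^ n) - w (S * real j / 2 ^ n))
        - (m / (c - S * real j / 2 ^ n))\<^sup>2 * (S / 2 ^ n) / 2) else 1) = exp (m * R n - m\<^sup>2 * T n / 2)" for n
  proof -
    let ?e = "\<lambda>j. m / (c - S * real j / 2 ^ n) * (w (S * real (Suc j) / 2 ^ n) - w (S * real j / 2 ^ n))
        - (m / (c - S * real j / 2 ^ n))\<^sup>2 * (S / 2 ^ n) / 2"
    have "(\<Prod>j<2 ^ n. if A n j then exp (?e j) else 1) = (\<Prod>j\<in>{..<2 ^ n}. if j \<in> {..<\<kappa> n} then exp (?e j) else 1)"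
      by (intro prod.cong) (auto simp: A_iff)
    also have "\<dots> = (\<Prod>j\<in>{..<2 ^ n} \<inter> {..<\<kappa> n}. exp (?e j))"
      by (rule prod.inter_restrict[symmetric]) simp
    also have "{..<2 ^ n} \<inter> {..<\<kappa> n} = {..<\<kappa> n}" using \<kappa>_le[of n] by auto
    also have "(\<Prod>j<\<kappa> n. exp (?e j)) = exp (\<Sum>j<\<kappa> n. ?e j)" by (simp add: exp_sum)
    also have "(\<Sum>j<\<kappa> n. ?e j) = m * R n - m\<^sup>2 * T n / 2"
      unfolding R_def T_def sum_subtractf sum_distrib_left sum_divide_distrib
      by (intro arg_cong2[where f="(-)"] sum.cong) (auto simp: power_divide)
    finally show ?thesis .
  qed
  have "R \<longlonglongrightarrow> W \<sigma> - W 0 + w \<sigma> / (c - \<sigma>)"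
    unfolding R_def by (rule bridge_riemann_sum_tendsto[OF S w W \<kappa>_le lim])
  moreover have "T \<longlonglongrightarrow> 1 / (c - \<sigma>) - 1 / c"
    unfolding T_def by (rule bridge_clock_riemann_sum[OF S \<kappa>_le lim])
  ultimately have "(\<lambda>n. exp (m * R n - m\<^sup>2 * T n / 2))
      \<longlonglongrightarrow> exp (m * (W \<sigma> - W 0 + w \<sigma> / (c - \<sigma>)) - m\<^sup>2 * (1 / (c - \<sigma>) - 1 / c) / 2)"
    by (intro tendsto_intros) auto
  then show ?thesis unfolding eq by (simp add: algebra_simps)
qed

section \<open>Paths of the embedded problem, and events of the Brownian past\<close>

context embedded_problem
begin

lemma good_paths:
  "AE \<omega> in M. \<omega> \<in> space M \<and> continuous_on {0..} (\<lambda>s. B s \<omega>) \<and> B 0 \<omega> = 0 \<and>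
    (\<forall>s. 0 \<le> s \<and> s < 1 - t \<longrightarrow> X (t + s) \<omega> = x + integral {0..s}
        (\<lambda>r. (1 - \<theta> \<omega>) * a + \<theta> \<omega> * ((a - X (t + r) \<omega>) / (1 - t - r))) + B s \<omega>)"
  using BM_continuous BM_start dynamics AE_space by eventually_elim auto

lemma AE_X_start: "t < 1 \<Longrightarrow> AE \<omega> in M. X t \<omega> = x"
  using good_paths by eventually_elim (auto dest: spec[of _ 0])

lemma X_path_continuous:
  assumes "t < 1" "\<omega> \<in> space M"
  shows "continuous_on {0..1 - t} (\<lambda>s. X (t + s) \<omega>)"
proof -
  have "continuous_on {t..1} (\<lambda>u. X u \<omega>)"
    unfolding continuous_on
  proof
    fix u assume u: "u \<in> {t..1}"
    show "((\<lambda>u. X u \<omega>) \<longlongrightarrow> X u \<omega>) (at u within {t..1})"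
    proof (cases "u = 1")
      case True
      then show ?thesis using X_terminal[OF assms(2)] assms(1) by (simp add: at_within_Icc_at_left)
    next
      case False
      then have "at u within {t..1} = at u within {t..<1}"
        using u by (intro at_within_nhd[of _ "{..<1}"]) auto
      then show ?thesis using X_continuous[OF assms(2)] u False by (simp add: continuous_on)
    qed
  qed
  then show ?thesis
    by (rule continuous_on_compose2) (auto intro!: continuous_intros)
qed

lemma X_shifted_measurable: "r \<in> dyadics S \<Longrightarrow> 0 < S \<Longrightarrow> S \<le> 1 - t \<Longrightarrow> X (t + r) \<in> borel_measurable M"
  using dyadics_bounds[of S r] by (intro X_measurable) auto

text \<open>The past of the increments lies in the sigma-algebra of \<open>B\<close>, which is
  independent of \<theta>. So the mean of a Brownian functional over an event of \<theta>
  factorises.\<close>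

lemma theta_indep_past:
  assumes S: "0 < S" and U: "U \<in> borel_measurable (past S s)" "integrable M U"
  shows "integrable M (\<lambda>\<omega>. U \<omega> * indicator {\<omega> \<in> space M. \<theta> \<omega> = v} \<omega>)"
    "expectation (\<lambda>\<omega>. U \<omega> * indicator {\<omega> \<in> space M. \<theta> \<omega> = v} \<omega>)
      = expectation U * prob {\<omega> \<in> space M. \<theta> \<omega> = v}"
proof -
  let ?I = "indicator {\<omega> \<in> space M. \<theta> \<omega> = v} :: 'w \<Rightarrow> real"
  let ?G = "sigma_sets (space M) {B s -` A \<inter> space M | s A. 0 \<le> s \<and> A \<in> sets borel}"
  have [measurable]: "{\<omega> \<in> space M. \<theta> \<omega> = v} \<in> sets M" using theta_measurable by measurable
  have I: "integrable M ?I" by (simp add: integrable_indicator_iff less_top[symmetric])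
  have sub: "sets (past S s) \<subseteq> ?G"
  proof -
    let ?N = "sigma (space M) {B s -` A \<inter> space M | s A. 0 \<le> s \<and> A \<in> sets borel}"
    have N: "sets ?N = ?G" "space ?N = space M"
      by (auto intro!: sets_measure_of space_measure_of)
    have "B r \<in> borel_measurable ?N" if "0 \<le> r" for r
      using that by (intro measurableI) (auto simp: N intro!: sigma_sets.Basic)
    then have "(\<lambda>\<omega>. B r \<omega> - B 0 \<omega>) \<in> borel_measurable ?N" if "r \<in> dyadics S" for r
      using dyadics_bounds[OF S that] by (intro borel_measurable_diff) auto
    from measurable_sets[OF this] have "{(\<lambda>\<omega>. B r \<omega> - B 0 \<omega>) -` A \<inter> space M | r A.
        r \<in> dyadics S \<and> r \<le> s \<and> A \<in> sets borel} \<subseteq> sets ?N"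
      unfolding N(2) by blast
    from sets.sigma_sets_subset[OF this] show ?thesis
      unfolding sets_past N .
  qed
  have ind: "prob (b \<inter> (?I -` E \<inter> space M)) = prob b * prob (?I -` E \<inter> space M)"
    if b: "b \<in> sets (past S s)" and E: "E \<in> sets borel" for b and E :: "real set"
  proof -
    have "?I -` E \<inter> space M = \<theta> -` (indicator {v} -` E :: real set) \<inter> space M"
      by (auto simp: indicator_def)
    moreover have "(indicator {v} -` E :: real set) \<in> sets borel"
      using measurable_sets[OF borel_measurable_indicator[of "{v}" borel] E] by simp
    ultimately have "?I -` E \<inter> space M \<in> sigma_sets (space M) {\<theta> -` A \<inter> space M | A. A \<in> sets borel}"
      by (auto intro!: sigma_sets.Basic)
    then show ?thesis
      using indep_setD[OF theta_indep, of "?I -` E \<inter> space M" b] b sub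
      by (auto simp: Int_commute mult.commute)
  qed
  have eq: "expectation ?I = prob {\<omega> \<in> space M. \<theta> \<omega> = v}" by simp
  show "integrable M (\<lambda>\<omega>. U \<omega> * ?I \<omega>)"
    by (rule integral_mult_indep(1)[OF past_subalgebra[OF S] U I ind])
  show "expectation (\<lambda>\<omega>. U \<omega> * ?I \<omega>) = expectation U * prob {\<omega> \<in> space M. \<theta> \<omega> = v}"
    unfolding eq[symmetric] by (rule integral_mult_indep(2)[OF past_subalgebra[OF S] U I ind])
qed

text \<open>The event that the boundary has not been reached by time \<open>s\<close>, written through dyadic Riemann sums
  of \<open>dB / (1 - t - s)\<close> so that it visibly depends only on increments of \<open>B\<close> before \<open>s\<close>. On
  \<open>\<theta> = 1\<close> these sums converge to \<open>(X - a) / (1 - t - s)\<close>.\<close>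

definition bridge_approx :: "real \<Rightarrow> nat \<Rightarrow> real \<Rightarrow> 'w \<Rightarrow> real" where
  "bridge_approx S n r \<omega> = (x - a) / (1 - t) + (\<Sum>j<nat \<lfloor>r * 2 ^ n / S\<rfloor>.
    (B (S * real (Suc j) / 2 ^ n) \<omega> - B (S * real j / 2 ^ n) \<omega>) / (1 - t - S * real j / 2 ^ n))"

definition not_hit :: "real \<Rightarrow> real \<Rightarrow> 'w set" where
  "not_hit S s = {\<omega> \<in> space M.
    \<not> dyadic_hit S (\<lambda>r. lim (\<lambda>n. bridge_approx S n r \<omega>) - alpha / sqrt (1 - t - r)) s}"

lemma not_hit_past:
  assumes S: "0 < S"
  shows "not_hit S s \<in> sets (past S s)"
proof -
  have "bridge_approx S n r \<in> borel_measurable (past S s)" if r: "r \<in> dyadics S" "r \<le> s" for n r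
    unfolding bridge_approx_def[abs_def]
  proof (intro borel_measurable_add borel_measurable_sum borel_measurable_const borel_measurable_divide)
    fix j assume "j \<in> {..<nat \<lfloor>r * 2 ^ n / S\<rfloor>}"
    then have j: "Suc j \<le> nat \<lfloor>r * 2 ^ n / S\<rfloor>" by simp
    note rS = dyadics_bounds[OF S r(1)]
    note fl = dyadic_floor[OF S, of r, OF rS[THEN conjunct1] rS[THEN conjunct2]]
    \<comment> \<open>The floor in \<open>bridge_approx\<close> makes the last cell end at
      \<open>r\<close> or earlier, so nothing after \<open>s\<close> is read.\<close>
    have le: "S * real (Suc j) / 2 ^ n \<le> r"
      using j S by (intro order_trans[OF _ fl(2)[of n]]) (simp add: divide_right_mono del: of_nat_Suc)
    have le': "S * real j / 2 ^ n \<le> S * real (Suc j) / 2 ^ n" using S by (simp add: divide_right_mono)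
    have "(\<lambda>\<omega>. (B (S * real (Suc j) / 2 ^ n) \<omega> - B 0 \<omega>) - (B (S * real j / 2 ^ n) \<omega> - B 0 \<omega>))
        \<in> borel_measurable (past S s)"
      by (intro borel_measurable_diff[OF measurable_past measurable_past] dyadicsI)
         (use le le' r(2) fl(1)[of n] j in linarith)+
    then show "(\<lambda>\<omega>. B (S * real (Suc j) / 2 ^ n) \<omega> - B (S * real j / 2 ^ n) \<omega>) \<in> borel_measurable (past S s)"
      by simp
  qed
  \<comment> \<open>\<open>lim\<close> is measurable also where the sums diverge, since it takes one
    fixed default value there. On the paths that matter they converge, by
    \<open>not_hit_iff\<close>.\<close>
  then have "Measurable.pred (past S s)
      (\<lambda>\<omega>. dyadic_hit S (\<lambda>r. lim (\<lambda>n. bridge_approx S n r \<omega>) - alpha / sqrt (1 - t - r)) s)"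
    by (intro pred_dyadic_hit borel_measurable_diff borel_measurable_lim_metric borel_measurable_const)
  then have "Measurable.pred (past S s)
      (\<lambda>\<omega>. \<not> dyadic_hit S (\<lambda>r. lim (\<lambda>n. bridge_approx S n r \<omega>) - alpha / sqrt (1 - t - r)) s)"
    by measurable
  then show ?thesis by (simp add: not_hit_def pred_def)
qed

end

section \<open>The pinned case\<close>

lemma above_boundary_iff:
  assumes "t + s < 1"
  shows "0 \<le> y - bridge_boundary a (t + s) \<longleftrightarrow> 0 \<le> (y - a) / (1 - t - s) - alpha / sqrt (1 - t - s)"
    "y \<le> bridge_boundary a (t + s) \<longleftrightarrow> (y - a) / (1 - t - s) \<le> alpha * sqrt (1 / (1 - t - s))"
proof -
  define v where "v = sqrt (1 - t - s)"
  have v: "0 < v" "1 - t - s = v\<^sup>2" using assms by (auto simp: v_def)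
  have b: "bridge_boundary a (t + s) = a + alpha * v" by (simp add: bridge_boundary_def v_def diff_diff_eq)
  have d: "(y - a) / v\<^sup>2 - alpha / v = (y - (a + alpha * v)) / v\<^sup>2"
    using v(1) by (simp add: field_simps power2_eq_square)
  show "0 \<le> y - bridge_boundary a (t + s) \<longleftrightarrow> 0 \<le> (y - a) / (1 - t - s) - alpha / sqrt (1 - t - s)"
    unfolding b v_def[symmetric] unfolding v(2) d using v(1) by (simp add: zero_le_divide_iff)
  have "alpha * sqrt (1 / v\<^sup>2) = alpha / v" using v(1) by (simp add: real_sqrt_divide)
  moreover have "(y - a) / v\<^sup>2 \<le> alpha / v \<longleftrightarrow> (y - (a + alpha * v)) / v\<^sup>2 \<le> 0"
    unfolding d[symmetric] by simp
  ultimately show "y \<le> bridge_boundary a (t + s) \<longleftrightarrow> (y - a) / (1 - t - s) \<le> alpha * sqrt (1 / (1 - t - s))"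
    unfolding b v(2) using v(1) by (simp add: divide_le_0_iff)
qed

lemma bridge_boundary_continuous: "continuous_on A (\<lambda>s. bridge_boundary a (t + s))"
  unfolding bridge_boundary_def by (intro continuous_intros)

lemma bridge_boundary_measurable[measurable]: "(\<lambda>s. bridge_boundary a (t + s)) \<in> borel_measurable borel"
  by (intro borel_measurable_continuous_onI bridge_boundary_continuous)

context embedded_problem
begin

lemma bridge_path_X:
  assumes t: "t < 1" and \<omega>: "\<omega> \<in> space M" "continuous_on {0..} (\<lambda>s. B s \<omega>)" "B 0 \<omega> = 0"
    and dyn: "\<And>s. 0 \<le> s \<Longrightarrow> s < 1 - t \<Longrightarrow> X (t + s) \<omega> = x + integral {0..s}
        (\<lambda>r. (a - X (t + r) \<omega>) / (1 - t - r)) + B s \<omega>"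
  defines "W \<equiv> \<lambda>s. (X (t + s) \<omega> - B s \<omega> - a) / (1 - t - s)"
  shows "continuous_on {0..<1 - t} W" "W 0 = (x - a) / (1 - t)"
    "\<And>s. 0 < s \<Longrightarrow> s < 1 - t \<Longrightarrow> (W has_real_derivative - (B s \<omega> / (1 - t - s)\<^sup>2)) (at s)"
    "X 1 \<omega> = a"
proof -
  have t': "0 < 1 - t" using t by simp
  have Yc: "continuous_on {0..1 - t} (\<lambda>s. X (t + s) \<omega>)" by (rule X_path_continuous[OF t \<omega>(1)])
  have Yc': "continuous_on {0..<1 - t} (\<lambda>s. X (t + s) \<omega>)" by (rule continuous_on_subset[OF Yc]) auto
  note bp = bridge_path[where Y="\<lambda>s. X (t + s) \<omega>" and w="\<lambda>s. B s \<omega>" and x=x and a=a, OF t' Yc' \<omega>(2,3)]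
  show "continuous_on {0..<1 - t} W" unfolding W_def by (rule bp(1), rule dyn)
  show "W 0 = (x - a) / (1 - t)" unfolding W_def by (rule bp(2), rule dyn)
  show "(W has_real_derivative - (B s \<omega> / (1 - t - s)\<^sup>2)) (at s)" if "0 < s" "s < 1 - t" for s
    unfolding W_def by (rule bp(3), rule dyn, assumption+, (rule that)+)
  have "((\<lambda>s. X (t + s) \<omega>) \<longlongrightarrow> a) (at_left (1 - t))" by (rule bp(4), rule dyn)
  moreover have "((\<lambda>s. X (t + s) \<omega>) \<longlongrightarrow> X (t + (1 - t)) \<omega>) (at (1 - t) within {0..1 - t})"
    using t' by (intro Yc[unfolded continuous_on, rule_format]) auto
  then have "((\<lambda>s. X (t + s) \<omega>) \<longlongrightarrow> X 1 \<omega>) (at_left (1 - t))"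
    using t' by (simp add: at_within_Icc_at_left)
  ultimately show "X 1 \<omega> = a" by (intro tendsto_unique[of "at_left (1 - t)"]) auto
qed

text \<open>On a good path with \<theta> = 1 the Riemann sums converge to Z at every dyadic time, so
  an event of the Brownian past coincides with \<open>X\<close> still being below its boundary.
  Where \<theta> is not 1 the two may differ; there the indicator of \<theta> = 1 removes the
  products.\<close>

lemma not_hit_iff:
  assumes S: "0 < S" "S < 1 - t" and s: "0 \<le> s" "s < S"
    and \<omega>: "\<omega> \<in> space M" "\<theta> \<omega> = 1" "continuous_on {0..} (\<lambda>s. B s \<omega>)" "B 0 \<omega> = 0"
    and dyn: "\<And>s. 0 \<le> s \<Longrightarrow> s < 1 - t \<Longrightarrow> X (t + s) \<omega> = x + integral {0..s}
        (\<lambda>r. (a - X (t + r) \<omega>) / (1 - t - r)) + B s \<omega>"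
  shows "\<omega> \<in> not_hit S s \<longleftrightarrow> s < dyadic_hit_time S (\<lambda>s. X (t + s) \<omega> - bridge_boundary a (t + s))"
proof -
  let ?f = "\<lambda>s. X (t + s) \<omega> - bridge_boundary a (t + s)"
  let ?Z = "\<lambda>s. (X (t + s) \<omega> - a) / (1 - t - s)"
  have t: "t < 1" "0 < 1 - t" using S by auto
  have Yc: "continuous_on {0..1 - t} (\<lambda>s. X (t + s) \<omega>)" by (rule X_path_continuous[OF t(1) \<omega>(1)])
  define W where "W s = (X (t + s) \<omega> - B s \<omega> - a) / (1 - t - s)" for s
  note bpX = bridge_path_X[OF t(1) \<omega>(1,3,4)]
  have bp: "continuous_on {0..<1 - t} W" "W 0 = (x - a) / (1 - t)"
    "\<And>s. 0 < s \<Longrightarrow> s < 1 - t \<Longrightarrow> (W has_real_derivative - (B s \<omega> / (1 - t - s)\<^sup>2)) (at s)"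
    subgoal unfolding W_def by (rule bpX(1), rule dyn)
    subgoal unfolding W_def by (rule bpX(2), rule dyn)
    subgoal unfolding W_def by (rule bpX(3), rule dyn)
    done
  have lim: "lim (\<lambda>n. bridge_approx S n r \<omega>) = ?Z r" if r: "r \<in> dyadics S" for r
  proof -
    note rS = dyadics_bounds[OF S(1) r]
    have "(\<lambda>n. bridge_approx S n r \<omega>) \<longlonglongrightarrow> (x - a) / (1 - t) +
        (W r - W 0 + B r \<omega> / (1 - t - r))"
      unfolding bridge_approx_def
    proof (intro tendsto_add tendsto_const bridge_riemann_sum_tendsto[OF S])
      show "continuous_on {0..S} (\<lambda>s. B s \<omega>)" by (rule continuous_on_subset[OF \<omega>(3)]) auto
      show "continuous_on {0..S} W"
        by (rule continuous_on_subset[OF bp(1)]) (use S in auto)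
      show "(W has_real_derivative - (B s \<omega> / (1 - t - s)\<^sup>2)) (at s)"
        if "0 < s" "s < S" for s
        by (rule bp(3)) (use that S in auto)
      show "nat \<lfloor>r * 2 ^ n / S\<rfloor> \<le> 2 ^ n" for n
        using dyadic_floor(1)[OF S(1)] rS by blast
      show "(\<lambda>n. S * real (nat \<lfloor>r * 2 ^ n / S\<rfloor>) / 2 ^ n) \<longlonglongrightarrow> r"
        using dyadic_floor_tendsto[OF S(1)] rS by blast
    qed (rule \<omega>(4))
    moreover have "(x - a) / (1 - t) + (W r - W 0 + B r \<omega> / (1 - t - r)) = ?Z r"
      unfolding bp(2) by (simp add: W_def diff_divide_distrib)
    ultimately show ?thesis by (simp add: limI)
  qed
  have sub: "{0..S} \<subseteq> {0..1 - t}" using S by auto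
  have fc: "continuous_on {0..S} ?f"
    by (intro continuous_on_diff continuous_on_subset[OF Yc sub] bridge_boundary_continuous)
  have Zc: "continuous_on {0..S} (\<lambda>r. ?Z r - alpha / sqrt (1 - t - r))"
    using S by (intro continuous_intros continuous_on_subset[OF Yc sub]) auto
  have "dyadic_hit S (\<lambda>r. lim (\<lambda>n. bridge_approx S n r \<omega>) - alpha / sqrt (1 - t - r))
      = dyadic_hit S (\<lambda>r. ?Z r - alpha / sqrt (1 - t - r))"
    by (rule dyadic_hit_cong) (simp only: lim)
  then have "dyadic_hit S (\<lambda>r. lim (\<lambda>n. bridge_approx S n r \<omega>) - alpha / sqrt (1 - t - r)) s
      \<longleftrightarrow> dyadic_hit S (\<lambda>r. ?Z r - alpha / sqrt (1 - t - r)) s"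
    by (rule fun_cong)
  also have "\<dots> \<longleftrightarrow> (\<exists>u\<in>{0..s}. 0 \<le> ?Z u - alpha / sqrt (1 - t - u))"
    using exists_nonneg_iff_dyadic_hit[OF S(1) Zc, of s] s by simp
  also have "\<dots> \<longleftrightarrow> (\<exists>u\<in>{0..s}. 0 \<le> ?f u)"
    using s S by (intro bex_cong refl above_boundary_iff(1)[symmetric]) auto
  also have "\<dots> \<longleftrightarrow> dyadic_hit_time S ?f \<le> s"
    using first_nonneg_le_iff[OF fc s] first_nonneg_eq_dyadic_hit_time[OF S(1) fc] by simp
  finally show ?thesis using \<omega>(1) by (auto simp: not_hit_def)
qed

text \<open>The stopped products \<open>f n\<close> have mean K * prob \<Theta> at every level, by
  optional stopping and independence of \<theta>. They converge along paths to \<open>g\<close>,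
  their second moments are bounded, and \<open>g\<close> is at most \<open>G\<close> because Z has
  not passed the boundary.\<close>

lemma exponential_bound:
  assumes S: "0 < S" "S < 1 - t" and m: "0 \<le> m" and x: "x < bridge_boundary a t"
  defines "\<sigma> \<equiv> \<lambda>\<omega>. dyadic_hit_time S (\<lambda>s. X (t + s) \<omega> - bridge_boundary a (t + s))"
    and "\<Theta> \<equiv> {\<omega> \<in> space M. \<theta> \<omega> = 1}"
  defines "G \<equiv> \<lambda>\<omega>. exp (m * (alpha * sqrt (1 / (1 - t - \<sigma> \<omega>))) - m\<^sup>2 * (1 / (1 - t - \<sigma> \<omega>)) / 2) * indicator \<Theta> \<omega>"
  shows "integrable M G"
    "exp (m * ((x - a) / (1 - t)) - m\<^sup>2 * (1 / (1 - t)) / 2) * prob \<Theta> \<le> expectation G"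
proof -
  have t: "t < 1" using S by auto
  let ?c = "1 - t"
  let ?b = "\<lambda>s. bridge_boundary a (t + s)"
  have Xm: "X (t + r) \<in> borel_measurable M" if "r \<in> dyadics S" for r
    using X_shifted_measurable[OF that] S by simp
  have \<sigma>m[measurable]: "\<sigma> \<in> borel_measurable M"
    unfolding \<sigma>_def using Xm by (intro measurable_dyadic_hit_time S) auto
  have \<sigma>b: "0 \<le> \<sigma> \<omega>" "\<sigma> \<omega> \<le> S" for \<omega>
    unfolding \<sigma>_def by (rule dyadic_hit_time_bounds[OF S(1)])+
  have [measurable]: "\<Theta> \<in> sets M" unfolding \<Theta>_def using theta_measurable by measurable
  define Z where "Z \<omega> = (dyadic_stopped S ?b (\<lambda>s. X (t + s) \<omega>) - a) / (1 - t - \<sigma> \<omega>)" for \<omega>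
  have [measurable]: "(\<lambda>\<omega>. dyadic_stopped S ?b (\<lambda>s. X (t + s) \<omega>)) \<in> borel_measurable M"
    by (intro measurable_dyadic_stopped S Xm bridge_boundary_measurable)
  have Zm[measurable]: "Z \<in> borel_measurable M" unfolding Z_def by measurable
  define g where "g \<omega> = exp (m * Z \<omega> - m\<^sup>2 * (1 / (1 - t - \<sigma> \<omega>)) / 2) * indicator \<Theta> \<omega>" for \<omega>
  have Gm: "G \<in> borel_measurable M" unfolding G_def by measurable
  have gm: "g \<in> borel_measurable M" unfolding g_def by measurable
  have al: "0 < alpha" by (rule alpha_properties)
  have G0: "0 \<le> G \<omega>" and Gb: "G \<omega> \<le> exp (m * (alpha * sqrt (1 / (1 - t - S))))" for \<omega>
  proof -
    have "1 / (1 - t - \<sigma> \<omega>) \<le> 1 / (1 - t - S)" using \<sigma>b[of \<omega>] S by (intro divide_left_mono) auto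
    then have "m * (alpha * sqrt (1 / (1 - t - \<sigma> \<omega>))) \<le> m * (alpha * sqrt (1 / (1 - t - S)))"
      using m al by (intro mult_left_mono) auto
    moreover have "0 \<le> m\<^sup>2 * (1 / (1 - t - \<sigma> \<omega>)) / 2" using \<sigma>b[of \<omega>] S by simp
    ultimately show "G \<omega> \<le> exp (m * (alpha * sqrt (1 / (1 - t - S))))"
      unfolding G_def by (auto simp: indicator_def)
    show "0 \<le> G \<omega>" unfolding G_def by simp
  qed
  show Gi: "integrable M G"
    by (rule integrable_const_bound[where B="exp (m * (alpha * sqrt (1 / (1 - t - S))))"]) (use G0 Gb Gm in auto)
  have sub: "{0..S} \<subseteq> {0..1 - t}" using S by auto
  have XS: "continuous_on {0..S} (\<lambda>s. X (t + s) \<omega>)" if "\<omega> \<in> space M" for \<omega>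
    by (rule continuous_on_subset[OF X_path_continuous[OF t that] sub])
  have \<sigma>_first: "\<sigma> \<omega> = first_nonneg S (\<lambda>s. X (t + s) \<omega> - ?b s)" if "\<omega> \<in> space M" for \<omega>
    unfolding \<sigma>_def by (intro first_nonneg_eq_dyadic_hit_time[symmetric] S continuous_on_diff
        XS[OF that] bridge_boundary_continuous)
  have Z_eq: "Z \<omega> = (X (t + \<sigma> \<omega>) \<omega> - a) / (1 - t - \<sigma> \<omega>)" if "\<omega> \<in> space M" for \<omega>
    unfolding Z_def
    using stopped_eq_dyadic_stopped[OF S(1) XS[OF that] bridge_boundary_continuous] \<sigma>_first[OF that] by simp
  \<comment> \<open>The start is below the boundary, so the gap is zero at a hit and negative if no
    hit occurs up to \<open>S\<close>. As m >= 0, this gives the bound on the exponent.\<close>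
  have gG: "AE \<omega> in M. g \<omega> \<le> G \<omega>"
    using AE_X_start[OF t] AE_space
  proof eventually_elim
    case (elim \<omega>)
    let ?f = "\<lambda>s. X (t + s) \<omega> - ?b s"
    have fc: "continuous_on {0..S} ?f"
      by (intro continuous_on_diff XS elim bridge_boundary_continuous)
    have "?f (\<sigma> \<omega>) \<le> 0"
    proof (cases "\<exists>s\<in>{0..S}. 0 \<le> ?f s")
      case True
      then show ?thesis
        using first_nonneg_zero[OF fc True] x elim \<sigma>_first by simp
    next
      case False
      then show ?thesis using \<sigma>b[of \<omega>] by force
    qed
    then have "Z \<omega> \<le> alpha * sqrt (1 / (1 - t - \<sigma> \<omega>))"
      using above_boundary_iff(2)[of t "\<sigma> \<omega>" "X (t + \<sigma> \<omega>) \<omega>" a] \<sigma>b[of \<omega>] S Z_eq[OF elim(2)] by simp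
    then have "m * Z \<omega> \<le> m * (alpha * sqrt (1 / (1 - t - \<sigma> \<omega>)))" using m by (rule mult_left_mono)
    then show ?case unfolding g_def G_def by (auto simp: indicator_def)
  qed
  have gi: "integrable M g"
    by (rule Bochner_Integration.integrable_bound[OF Gi gm]) (use gG in eventually_elim, simp add: g_def G_def)
  \<comment> \<open>The exponential at the starting point. The products start from 1, so this factor
    restores the value of the martingale at time 0.\<close>
  define K where "K = exp (m * ((x - a) / ?c) - m\<^sup>2 * (1 / ?c) / 2)"
  define Q where "Q n \<omega> = (\<Prod>j<2 ^ n. if \<omega> \<in> not_hit S (S * real j / 2 ^ n) then
    exp (m / (?c - S * real j / 2 ^ n) * (B (S * real (Suc j) / 2 ^ n) \<omega> - B (S * real j / 2 ^ n) \<omega>)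
      - (m / (?c - S * real j / 2 ^ n))\<^sup>2 * (S / 2 ^ n) / 2) else 1)" for n \<omega>
  note Qs = stopped_exponential[OF S not_hit_past[OF S(1)], where m=m, folded Q_def]
  define f where "f n \<omega> = K * Q n \<omega> * indicator \<Theta> \<omega>" for n \<omega>
  have Qm[measurable]: "Q n \<in> borel_measurable M" for n using Qs(2)[of n] by auto
  have K: "0 < K" by (simp add: K_def)
  have Q0: "0 \<le> Q n \<omega>" for n \<omega> unfolding Q_def by (intro prod_nonneg) auto
  have f2: "(f n \<omega>)\<^sup>2 \<le> K\<^sup>2 * (Q n \<omega>)\<^sup>2" for n \<omega>
    by (auto simp: f_def indicator_def power_mult_distrib)
  have f2i: "integrable M (\<lambda>\<omega>. (f n \<omega>)\<^sup>2)" for n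
    by (rule Bochner_Integration.integrable_bound[OF integrable_mult_right[OF Qs(4)[of n], of "K\<^sup>2"]])
       (use f2 in \<open>auto simp: f_def\<close>)
  have fe: "expectation (f n) = K * prob \<Theta>" for n
  proof -
    have "expectation (f n) = K * expectation (\<lambda>\<omega>. Q n \<omega> * indicator \<Theta> \<omega>)"
      unfolding f_def mult.assoc by simp
    then show ?thesis
      using theta_indep_past(2)[OF S(1) Qs(1,2), of n 1] Qs(3)[of n] unfolding \<Theta>_def by simp
  qed
  have "K * prob \<Theta> \<le> expectation g"
  proof (rule expectation_ge_limit_L2[where f=f and C="K\<^sup>2 * exp (m\<^sup>2 * (S / (?c - S)\<^sup>2))"])
    show "f n \<in> borel_measurable M" for n unfolding f_def by measurable
    show "0 \<le> f n \<omega>" for n \<omega> using K Q0 by (simp add: f_def)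
    show "integrable M (\<lambda>\<omega>. (f n \<omega>)\<^sup>2)" for n by (rule f2i)
    show "expectation (\<lambda>\<omega>. (f n \<omega>)\<^sup>2) \<le> K\<^sup>2 * exp (m\<^sup>2 * (S / (?c - S)\<^sup>2))" for n
    proof -
      have "expectation (\<lambda>\<omega>. (f n \<omega>)\<^sup>2) \<le> expectation (\<lambda>\<omega>. K\<^sup>2 * (Q n \<omega>)\<^sup>2)"
        by (intro integral_mono f2i f2 integrable_mult_right Qs)
      also have "\<dots> \<le> K\<^sup>2 * exp (m\<^sup>2 * (S / (?c - S)\<^sup>2))"
        using Qs(5)[of n] by (simp add: mult_left_mono)
      finally show ?thesis .
    qed
    show "integrable M g" by (rule gi)
    show "K * prob \<Theta> \<le> expectation (f n)" for n by (simp add: fe)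
    show "AE \<omega> in M. (\<lambda>n. f n \<omega>) \<longlonglongrightarrow> g \<omega>"
      using good_paths
    proof eventually_elim
      case (elim \<omega>)
      show ?case
      proof (cases "\<theta> \<omega> = 1")
        case False
        then show ?thesis by (simp add: f_def g_def \<Theta>_def)
      next
        case True
        have el: "\<omega> \<in> space M" "continuous_on {0..} (\<lambda>s. B s \<omega>)" "B 0 \<omega> = 0" using elim by blast+
        have dyn: "X (t + s) \<omega> = x + integral {0..s} (\<lambda>r. (a - X (t + r) \<omega>) / (1 - t - r)) + B s \<omega>"
          if s: "0 \<le> s" "s < 1 - t" for s
        proof -
          have "X (t + s) \<omega> = x + integral {0..s}
              (\<lambda>r. (1 - \<theta> \<omega>) * a + \<theta> \<omega> * ((a - X (t + r) \<omega>) / (1 - t - r))) + B s \<omega>"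
            using elim s by blast
          then show ?thesis unfolding True by simp
        qed
        define W where "W s = (X (t + s) \<omega> - B s \<omega> - a) / (1 - t - s)" for s
        note bpX = bridge_path_X[OF t(1) el]
        have bp: "continuous_on {0..<1 - t} W" "W 0 = (x - a) / (1 - t)"
          "\<And>s. 0 < s \<Longrightarrow> s < 1 - t \<Longrightarrow> (W has_real_derivative - (B s \<omega> / (1 - t - s)\<^sup>2)) (at s)"
          subgoal unfolding W_def by (rule bpX(1), rule dyn)
          subgoal unfolding W_def by (rule bpX(2), rule dyn)
          subgoal unfolding W_def by (rule bpX(3), rule dyn)
          done
        have "(\<lambda>n. Q n \<omega>) \<longlonglongrightarrow> exp (m * (W (\<sigma> \<omega>) + B (\<sigma> \<omega>) \<omega> / (?c - \<sigma> \<omega>) - W 0)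
            - m\<^sup>2 * (1 / (?c - \<sigma> \<omega>) - 1 / ?c) / 2)"
          unfolding Q_def
        proof (rule stopped_exponential_tendsto[OF S])
          show "continuous_on {0..S} (\<lambda>s. B s \<omega>)" by (rule continuous_on_subset[OF el(2)]) auto
          show "continuous_on {0..S} W" by (rule continuous_on_subset[OF bp(1)]) (use S in auto)
          show "B 0 \<omega> = 0" by (rule el)
          show "(W has_real_derivative - (B s \<omega> / (1 - t - s)\<^sup>2)) (at s)" if "0 < s" "s < S" for s
            using bp(3) that S by simp
          show "0 \<le> \<sigma> \<omega>" "\<sigma> \<omega> \<le> S" by (rule \<sigma>b)+
          fix n j :: nat assume j: "j < 2 ^ n"
          have "real j < 2 ^ n" using j by simp
          then have "S * real j / 2 ^ n < S" using S(1) by (simp add: field_simps)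
          then show "\<omega> \<in> not_hit S (S * real j / 2 ^ n) \<longleftrightarrow> S * real j / 2 ^ n < \<sigma> \<omega>"
            unfolding \<sigma>_def using S(1) by (intro not_hit_iff[OF S _ _ el(1) True el(2,3)] dyn) auto
        qed
        then have "(\<lambda>n. K * Q n \<omega> * indicator \<Theta> \<omega>) \<longlonglongrightarrow> K * exp (m * (W (\<sigma> \<omega>) + B (\<sigma> \<omega>) \<omega> / (?c - \<sigma> \<omega>) - W 0)
            - m\<^sup>2 * (1 / (?c - \<sigma> \<omega>) - 1 / ?c) / 2) * indicator \<Theta> \<omega>"
          by (intro tendsto_intros)
        also have "K * exp (m * (W (\<sigma> \<omega>) + B (\<sigma> \<omega>) \<omega> / (?c - \<sigma> \<omega>) - W 0)
            - m\<^sup>2 * (1 / (?c - \<sigma> \<omega>) - 1 / ?c) / 2) = exp (m * Z \<omega> - m\<^sup>2 * (1 / (1 - t - \<sigma> \<omega>)) / 2)"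
        proof -
          have "W (\<sigma> \<omega>) + B (\<sigma> \<omega>) \<omega> / (?c - \<sigma> \<omega>) = Z \<omega>"
            using Z_eq[OF el(1)] by (simp add: W_def diff_divide_distrib)
          then show ?thesis
            unfolding K_def bp(2) exp_add[symmetric] by (intro arg_cong[where f=exp]) (simp add: algebra_simps diff_divide_distrib)
        qed
        finally show ?thesis unfolding f_def g_def .
      qed
    qed
  qed
  also have "expectation g \<le> expectation G"
    by (rule integral_mono_AE[OF gi Gi gG])
  finally show "exp (m * ((x - a) / (1 - t)) - m\<^sup>2 * (1 / (1 - t)) / 2) * prob \<Theta> \<le> expectation G"
    unfolding K_def .
qed

text \<open>\<open>exponential_bound\<close> is integrated over m >= 0 in the nonnegative extended
  reals, so that the integrals may be exchanged before anything is known to be finite.\<close>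

lemma sqrt_remaining_bound:
  assumes S: "0 < S" "S < 1 - t" and x: "x < bridge_boundary a t"
  defines "\<sigma> \<equiv> \<lambda>\<omega>. dyadic_hit_time S (\<lambda>s. X (t + s) \<omega> - bridge_boundary a (t + s))"
    and "\<Theta> \<equiv> {\<omega> \<in> space M. \<theta> \<omega> = 1}"
  shows "prob \<Theta> * (bridge_value a t x - a) \<le> alpha * expectation (\<lambda>\<omega>. sqrt (1 - t - \<sigma> \<omega>) * indicator \<Theta> \<omega>)"
proof -
  have t: "t < 1" using S by auto
  let ?c = "1 - t"
  have Xm: "X (t + r) \<in> borel_measurable M" if "r \<in> dyadics S" for r
    using X_shifted_measurable[OF that] S by simp
  have \<sigma>m[measurable]: "\<sigma> \<in> borel_measurable M"
    unfolding \<sigma>_def using Xm by (intro measurable_dyadic_hit_time S) auto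
  have \<sigma>b: "0 \<le> \<sigma> \<omega>" "\<sigma> \<omega> \<le> S" for \<omega>
    unfolding \<sigma>_def by (rule dyadic_hit_time_bounds[OF S(1)])+
  have \<Theta>[measurable]: "\<Theta> \<in> sets M" unfolding \<Theta>_def using theta_measurable by measurable
  define G where "G m \<omega> = exp (m * (alpha * sqrt (1 / (1 - t - \<sigma> \<omega>))) - m\<^sup>2 * (1 / (1 - t - \<sigma> \<omega>)) / 2)" for m \<omega>
  define k where "k = alpha / (1 - alpha\<^sup>2)"
  define v where "v = sqrt (2 * pi / (1 / ?c)) * exp (((x - a) / ?c)\<^sup>2 / (2 * (1 / ?c))) * std_normal_cdf ((x - a) / ?c / sqrt (1 / ?c))"
  note al = alpha_properties
  have al2: "0 < 1 - alpha\<^sup>2" using al by (simp add: power_less_one_iff)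
  have k0: "0 < k" using al al2 by (simp add: k_def)
  have v0: "0 \<le> v" by (simp add: v_def cdf_def t less_imp_le)
  have Gm[measurable]: "(\<lambda>(\<omega>, m). ennreal (G m \<omega> * indicator \<Theta> \<omega>) * indicator {0..} m) \<in> borel_measurable (M \<Otimes>\<^sub>M lborel)"
    unfolding G_def by measurable
  have Gi: "integrable M (\<lambda>\<omega>. sqrt (1 - t - \<sigma> \<omega>) * indicator \<Theta> \<omega>)"
  proof (rule integrable_const_bound[where B="sqrt (1 - t)"])
    have "0 \<le> sqrt (1 - t - \<sigma> \<omega>) \<and> sqrt (1 - t - \<sigma> \<omega>) \<le> sqrt (1 - t)" for \<omega>
      using \<sigma>b[of \<omega>] S by simp
    then show "AE \<omega> in M. norm (sqrt (1 - t - \<sigma> \<omega>) * indicator \<Theta> \<omega>) \<le> sqrt (1 - t)"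
      using t by (auto simp: indicator_def)
  qed simp
  have nonneg: "0 \<le> sqrt (1 - t - \<sigma> \<omega>) * indicator \<Theta> \<omega>" for \<omega>
    using \<sigma>b(2)[of \<omega>] S by simp
  interpret P: pair_sigma_finite M lborel by unfold_locales
  have "ennreal (prob \<Theta>) * ennreal v
      = ennreal (prob \<Theta>) * (\<integral>\<^sup>+m. ennreal (exp (m * ((x - a) / ?c) - m\<^sup>2 * (1 / ?c) / 2)) * indicator {0..} m \<partial>lborel)"
    unfolding v_def using t by (subst nn_integral_exp_quadratic) auto
  also have "\<dots> = (\<integral>\<^sup>+m. ennreal (exp (m * ((x - a) / ?c) - m\<^sup>2 * (1 / ?c) / 2) * prob \<Theta>) * indicator {0..} m \<partial>lborel)"
    by (subst nn_integral_cmult[symmetric]) (auto simp: ennreal_mult mult_ac)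
  also have "\<dots> \<le> (\<integral>\<^sup>+m. (\<integral>\<^sup>+\<omega>. ennreal (G m \<omega> * indicator \<Theta> \<omega>) * indicator {0..} m \<partial>M) \<partial>lborel)"
  proof (rule nn_integral_mono)
    fix m :: real
    show "ennreal (exp (m * ((x - a) / ?c) - m\<^sup>2 * (1 / ?c) / 2) * prob \<Theta>) * indicator {0..} m
        \<le> (\<integral>\<^sup>+\<omega>. ennreal (G m \<omega> * indicator \<Theta> \<omega>) * indicator {0..} m \<partial>M)"
    proof (cases "0 \<le> m")
      case True
      have eb: "integrable M (\<lambda>\<omega>. G m \<omega> * indicator \<Theta> \<omega>)"
        "exp (m * ((x - a) / ?c) - m\<^sup>2 * (1 / ?c) / 2) * prob \<Theta> \<le> expectation (\<lambda>\<omega>. G m \<omega> * indicator \<Theta> \<omega>)"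
        unfolding G_def \<sigma>_def \<Theta>_def by (rule exponential_bound[OF S True x])+
      have "(\<integral>\<^sup>+\<omega>. ennreal (G m \<omega> * indicator \<Theta> \<omega>) \<partial>M) = ennreal (expectation (\<lambda>\<omega>. G m \<omega> * indicator \<Theta> \<omega>))"
        by (rule nn_integral_eq_integral[OF eb(1)]) (simp add: G_def)
      then show ?thesis using True eb(2) by (simp add: ennreal_leI)
    qed simp
  qed
  also have "\<dots> = (\<integral>\<^sup>+\<omega>. (\<integral>\<^sup>+m. ennreal (G m \<omega> * indicator \<Theta> \<omega>) * indicator {0..} m \<partial>lborel) \<partial>M)"
    by (rule P.Fubini'[OF Gm])
  also have "\<dots> = (\<integral>\<^sup>+\<omega>. ennreal (k * (sqrt (1 - t - \<sigma> \<omega>) * indicator \<Theta> \<omega>)) \<partial>M)"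
  proof (rule nn_integral_cong)
    fix \<omega>
    define T where "T = 1 / (1 - t - \<sigma> \<omega>)"
    have r: "0 < 1 - t - \<sigma> \<omega>" using \<sigma>b[of \<omega>] S by simp
    then have T: "0 < T" by (simp add: T_def)
    have "(\<integral>\<^sup>+m. ennreal (G m \<omega> * indicator \<Theta> \<omega>) * indicator {0..} m \<partial>lborel)
        = (\<integral>\<^sup>+m. indicator \<Theta> \<omega> * (ennreal (exp (m * (alpha * sqrt T) - m\<^sup>2 * T / 2)) * indicator {0..} m) \<partial>lborel)"
      by (intro nn_integral_cong) (auto simp: G_def T_def indicator_def)
    also have "\<dots> = indicator \<Theta> \<omega> * ennreal (sqrt (2 * pi / T) * exp ((alpha * sqrt T)\<^sup>2 / (2 * T)) * std_normal_cdf (alpha * sqrt T / sqrt T))"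
      by (subst nn_integral_cmult) (auto simp: nn_integral_exp_quadratic[OF T])
    \<comment> \<open>On the boundary y = alpha sqrt T, so \<open>T\<close> cancels in the
      exponential and in the cdf. It survives only in the prefactor, as the root of the remaining
      time.\<close>
    also have "sqrt (2 * pi / T) * exp ((alpha * sqrt T)\<^sup>2 / (2 * T)) * std_normal_cdf (alpha * sqrt T / sqrt T)
        = k * sqrt (1 - t - \<sigma> \<omega>)"
    proof -
      \<comment> \<open>The equation for \<open>alpha\<close>, solved for its Gaussian factor; the
        division is allowed because \<open>alpha < 1\<close>.\<close>
      have e1: "sqrt (2 * pi) * exp (alpha\<^sup>2 / 2) * std_normal_cdf alpha = k"
        unfolding k_def eq_divide_eq using al2 al(3) by (simp add: mult_ac)
      have e2: "sqrt (2 * pi / T) = sqrt (2 * pi) * sqrt (1 - t - \<sigma> \<omega>)"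
        by (simp add: T_def real_sqrt_mult)
      have e3: "(alpha * sqrt T)\<^sup>2 / (2 * T) = alpha\<^sup>2 / 2" "alpha * sqrt T / sqrt T = alpha"
        using T by (simp_all add: power_mult_distrib)
      show ?thesis unfolding e2 e3 e1[symmetric] by (simp only: mult_ac)
    qed
    finally show "(\<integral>\<^sup>+m. ennreal (G m \<omega> * indicator \<Theta> \<omega>) * indicator {0..} m \<partial>lborel)
        = ennreal (k * (sqrt (1 - t - \<sigma> \<omega>) * indicator \<Theta> \<omega>))"
      by (auto simp: indicator_def)
  qed
  also have "\<dots> = ennreal (k * expectation (\<lambda>\<omega>. sqrt (1 - t - \<sigma> \<omega>) * indicator \<Theta> \<omega>))"
    using Gi k0 nonneg by (subst nn_integral_eq_integral) auto
  finally have "ennreal (prob \<Theta> * v) \<le> ennreal (k * expectation (\<lambda>\<omega>. sqrt (1 - t - \<sigma> \<omega>) * indicator \<Theta> \<omega>))"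
    using v0 by (simp add: ennreal_mult)
  moreover have "0 \<le> k * expectation (\<lambda>\<omega>. sqrt (1 - t - \<sigma> \<omega>) * indicator \<Theta> \<omega>)"
    using k0 nonneg by (intro mult_nonneg_nonneg integral_nonneg) auto
  ultimately have "prob \<Theta> * v \<le> k * expectation (\<lambda>\<omega>. sqrt (1 - t - \<sigma> \<omega>) * indicator \<Theta> \<omega>)"
    by (subst (asm) ennreal_le_iff)
  \<comment> \<open>The factor 1 - alpha^2 turns \<open>k\<close> into \<open>alpha\<close> and
    \<open>v\<close> into \<open>bridge_value a t x - a\<close>.\<close>
  then have "(1 - alpha\<^sup>2) * (prob \<Theta> * v) \<le> (1 - alpha\<^sup>2) * (k * expectation (\<lambda>\<omega>. sqrt (1 - t - \<sigma> \<omega>) * indicator \<Theta> \<omega>))"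
    using al2 by (intro mult_left_mono) auto
  moreover have "(1 - alpha\<^sup>2) * k = alpha" using al2 by (simp add: k_def)
  moreover have "(1 - alpha\<^sup>2) * v = bridge_value a t x - a"
  proof -
    have sq: "(z / d)\<^sup>2 / (2 * (1 / d)) = z\<^sup>2 / (2 * d)" "z / d / sqrt (1 / d) = z / sqrt d" "2 * pi / (1 / d) = 2 * pi * d"
      if "0 < d" for z d :: real
      using that by (simp_all add: power2_eq_square real_sqrt_divide real_div_sqrt field_simps)
    have "0 < ?c" using t by simp
    note c = sq[OF this]
    show ?thesis using x unfolding v_def bridge_value_def c by (simp add: mult_ac)
  qed
  ultimately show ?thesis by (metis mult.assoc mult.left_commute)
qed

end

section \<open>Combining the two cases\<close>

lemma brownian_stopped_expectation_unique:
  assumes M: "standard_brownian_motion M B" and N: "standard_brownian_motion N B'" and S: "0 < S"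
    and b: "b \<in> borel_measurable borel"
  shows "(\<integral>\<omega>. dyadic_stopped S b (\<lambda>r. x + a * r + (B r \<omega> - B 0 \<omega>)) \<partial>M)
    = (\<integral>\<omega>. dyadic_stopped S b (\<lambda>r. x + a * r + (B' r \<omega> - B' 0 \<omega>)) \<partial>N)"
proof -
  let ?P = "PiM (dyadics S) (\<lambda>_. borel :: real measure)"
  let ?H = "\<lambda>p. dyadic_stopped S b (\<lambda>r. x + a * r + p r)"
  have comp: "(\<lambda>p. x + a * r + p r) \<in> borel_measurable ?P" if "r \<in> dyadics S" for r
    using measurable_component_singleton[OF that, of "\<lambda>_. borel :: real measure"]
    by (intro borel_measurable_add borel_measurable_const) auto
  have H: "?H \<in> borel_measurable ?P"
    using measurable_dyadic_stopped[OF S comp b] by simp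
  have "(\<integral>\<omega>. dyadic_stopped S b (\<lambda>r. x + a * r + (B r \<omega> - B 0 \<omega>)) \<partial>M)
      = (\<integral>p. ?H p \<partial>distr M ?P (\<lambda>\<omega>. \<lambda>r\<in>dyadics S. B r \<omega> - B 0 \<omega>))"
    by (subst integral_distr[OF standard_brownian_motion.measurable_path[OF M S] H])
       (intro Bochner_Integration.integral_cong refl dyadic_stopped_cong, simp)
  also have "\<dots> = (\<integral>p. ?H p \<partial>distr N ?P (\<lambda>\<omega>. \<lambda>r\<in>dyadics S. B' r \<omega> - B' 0 \<omega>))"
    unfolding brownian_path_law_unique[OF M N S] ..
  also have "\<dots> = (\<integral>\<omega>. dyadic_stopped S b (\<lambda>r. x + a * r + (B' r \<omega> - B' 0 \<omega>)) \<partial>N)"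
    by (subst integral_distr[OF standard_brownian_motion.measurable_path[OF N S] H])
       (intro Bochner_Integration.integral_cong refl dyadic_stopped_cong, simp)
  finally show ?thesis .
qed

lemma bridge_boundary_bounded:
  assumes "t < 1" "0 \<le> s" "s \<le> 1 - t"
  shows "\<bar>bridge_boundary a (t + s)\<bar> \<le> \<bar>a\<bar> + alpha * sqrt (1 - t)"
proof -
  have al: "0 < alpha" by (rule alpha_properties)
  have "alpha * sqrt (1 - (t + s)) \<le> alpha * sqrt (1 - t)" using assms al by (intro mult_left_mono) auto
  moreover have "0 \<le> alpha * sqrt (1 - (t + s))" using assms al by simp
  ultimately show ?thesis unfolding bridge_boundary_def by linarith
qed

section \<open>The payoff of the stopping rule, given each value of \<theta>\<close>

context embedded_problem
begin

abbreviation boundary_gap :: "'w \<Rightarrow> real \<Rightarrow> real" where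
  "boundary_gap \<omega> s \<equiv> X (t + s) \<omega> - bridge_boundary a (t + s)"

abbreviation stopped_payoff :: "'w \<Rightarrow> real" where
  "stopped_payoff \<omega> \<equiv> dyadic_stopped (1 - t) (\<lambda>s. bridge_boundary a (t + s)) (\<lambda>s. X (t + s) \<omega>)"

abbreviation theta_is :: "real \<Rightarrow> 'w set" where
  "theta_is v \<equiv> {\<omega> \<in> space M. \<theta> \<omega> = v}"

lemma theta_is_measurable[measurable]: "theta_is v \<in> sets M"
  using theta_measurable by measurable

lemma AE_theta: "AE \<omega> in M. \<omega> \<in> theta_is 0 \<union> theta_is 1"
proof -
  have "prob (theta_is 0 \<union> theta_is 1) = 1"
    by (subst finite_measure_Union) (auto simp: theta_0 theta_1 theta_is_measurable)
  then show ?thesis by (subst (asm) prob_eq_1) auto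
qed

lemma X_shifted_in_borel: "t < 1 \<Longrightarrow> r \<in> dyadics (1 - t) \<Longrightarrow> X (t + r) \<in> borel_measurable M"
  by (rule X_shifted_measurable) auto

lemma stopped_payoff_measurable: "t < 1 \<Longrightarrow> stopped_payoff \<in> borel_measurable M"
  by (intro measurable_dyadic_stopped X_shifted_in_borel bridge_boundary_measurable) auto

lemma gap_continuous: "t < 1 \<Longrightarrow> \<omega> \<in> space M \<Longrightarrow> continuous_on {0..1 - t} (boundary_gap \<omega>)"
  by (intro continuous_on_diff X_path_continuous bridge_boundary_continuous)

lemma X_stopped:
  assumes "t < 1" "\<omega> \<in> space M"
  shows "X (t + dyadic_hit_time (1 - t) (boundary_gap \<omega>)) \<omega> = stopped_payoff \<omega>"
  using stopped_eq_dyadic_stopped[OF _ X_path_continuous[OF assms] bridge_boundary_continuous[where a=a and t=t]]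
    first_nonneg_eq_dyadic_hit_time[OF _ gap_continuous[OF assms]] assms by simp

text \<open>An empty hitting set gives infinity, which the cap turns into time 1; this is the
  default \<open>1 - t\<close> of the dyadic hitting time, shifted by \<open>t\<close>.\<close>

lemma capped_hitting_time:
  assumes t: "t < 1" and \<omega>: "\<omega> \<in> space M"
  shows "real_of_ereal (min (ereal t + boundary_hitting_time a t X \<omega>) 1)
    = t + dyadic_hit_time (1 - t) (boundary_gap \<omega>)"
proof -
  let ?c = "1 - t" and ?f = "boundary_gap \<omega>"
  let ?H = "{s. 0 \<le> s \<and> s \<le> 1 - t \<and> X (t + s) \<omega> \<ge> bridge_boundary a (t + s)}"
  note f = gap_continuous[OF t \<omega>]
  have bnd: "0 \<le> first_nonneg ?c ?f" "first_nonneg ?c ?f \<le> ?c"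
    using first_nonneg_bounds[of ?c ?f] t by auto
  have "real_of_ereal (min (ereal t + boundary_hitting_time a t X \<omega>) 1) = t + first_nonneg ?c ?f"
  proof (cases "\<exists>s\<in>{0..?c}. 0 \<le> ?f s")
    case True
    have "Inf (ereal ` ?H) = ereal (first_nonneg ?c ?f)"
    proof (rule antisym)
      show "Inf (ereal ` ?H) \<le> ereal (first_nonneg ?c ?f)"
        using first_nonneg_attained[OF f True] bnd by (intro Inf_lower imageI) auto
      show "ereal (first_nonneg ?c ?f) \<le> Inf (ereal ` ?H)"
        by (intro Inf_greatest) (auto intro!: first_nonneg_lower)
    qed
    then show ?thesis using bnd by (simp add: boundary_hitting_time_def min_def one_ereal_def)
  next
    case False
    then have "?H = {}" by force
    then have "boundary_hitting_time a t X \<omega> = \<infinity>"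
      unfolding boundary_hitting_time_def by (simp only: image_empty Inf_empty) (simp add: top_ereal_def)
    moreover have "first_nonneg ?c ?f = ?c" using False by (simp add: first_nonneg_def)
    ultimately show ?thesis by simp
  qed
  then show ?thesis using first_nonneg_eq_dyadic_hit_time[OF _ f] t by simp
qed

text \<open>Because the paths are continuous surely, the event of having stopped by time s equals a
  dyadic event on the whole space, so no completion of the filtration is called for. Times s < 0 and
  s >= 1 - t give trivial events.\<close>

lemma hit_time_admissible:
  assumes t: "t < 1"
  shows "(\<lambda>\<omega>. dyadic_hit_time (1 - t) (boundary_gap \<omega>)) \<in> admissible_times M t X"
proof -
  let ?c = "1 - t" and ?\<tau> = "\<lambda>\<omega>. dyadic_hit_time (1 - t) (boundary_gap \<omega>)"
  let ?F = "observed_filtration M t X"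
  have c: "0 < ?c" using t by simp
  have spF: "space (?F s) = space M" for s
    unfolding observed_filtration_def by (rule space_measure_of) auto
  have setsF: "sets (?F s) = sigma_sets (space M)
      {X (t + r) -` A \<inter> space M | r A. 0 \<le> r \<and> r \<le> s \<and> r \<le> 1 - t \<and> A \<in> sets borel}" for s
    unfolding observed_filtration_def by (rule sets_measure_of) auto
  have XF: "X (t + r) \<in> borel_measurable (?F s)" if "r \<in> dyadics ?c" "r \<le> s" for r s
    using dyadics_bounds[OF c that(1)] that(2)
    by (intro measurableI) (auto simp: spF setsF intro!: sigma_sets.Basic)
  have bnd: "0 \<le> ?\<tau> \<omega>" "?\<tau> \<omega> \<le> ?c" for \<omega> by (rule dyadic_hit_time_bounds[OF c])+
  have "Measurable.pred (?F s) (\<lambda>\<omega>. ?\<tau> \<omega> \<le> s)" for s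
  proof -
    consider "s < 0" | "0 \<le> s" "s < ?c" | "?c \<le> s" by linarith
    then show ?thesis
    proof cases
      case 1
      then have "(\<lambda>\<omega>. ?\<tau> \<omega> \<le> s) = (\<lambda>\<omega>. False)" using bnd(1) by (auto simp: fun_eq_iff not_le intro: less_le_trans)
      then show ?thesis by simp
    next
      case 2
      have "Measurable.pred (?F s) (\<lambda>\<omega>. dyadic_hit ?c (boundary_gap \<omega>) s)"
        by (intro pred_dyadic_hit borel_measurable_diff XF borel_measurable_const)
      moreover have "?\<tau> \<omega> \<le> s \<longleftrightarrow> dyadic_hit ?c (boundary_gap \<omega>) s" if "\<omega> \<in> space (?F s)" for \<omega>
      proof -
        have f: "continuous_on {0..?c} (boundary_gap \<omega>)" using that t by (intro gap_continuous) (simp_all add: spF)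
        show ?thesis
          using first_nonneg_le_iff[OF f 2] exists_nonneg_iff_dyadic_hit[OF c f 2(1)] 2
            first_nonneg_eq_dyadic_hit_time[OF c f] by simp
      qed
      ultimately show ?thesis by (simp cong: measurable_cong)
    next
      case 3
      then have "(\<lambda>\<omega>. ?\<tau> \<omega> \<le> s) = (\<lambda>\<omega>. True)" using bnd(2) by (auto simp: fun_eq_iff intro: order_trans)
      then show ?thesis by simp
    qed
  qed
  then show ?thesis using bnd by (simp add: admissible_times_def stopping_time_def)
qed

lemma bridge_dynamics:
  assumes "\<theta> \<omega> = 1" and "\<forall>s. 0 \<le> s \<and> s < 1 - t \<longrightarrow> X (t + s) \<omega> = x + integral {0..s}
        (\<lambda>r. (1 - \<theta> \<omega>) * a + \<theta> \<omega> * ((a - X (t + r) \<omega>) / (1 - t - r))) + B s \<omega>"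
    and "0 \<le> s" "s < 1 - t"
  shows "X (t + s) \<omega> = x + integral {0..s} (\<lambda>r. (a - X (t + r) \<omega>) / (1 - t - r)) + B s \<omega>"
proof -
  have "X (t + s) \<omega> = x + integral {0..s}
      (\<lambda>r. (1 - \<theta> \<omega>) * a + \<theta> \<omega> * ((a - X (t + r) \<omega>) / (1 - t - r))) + B s \<omega>"
    using assms(2-) by blast
  then show ?thesis unfolding assms(1) by simp
qed

text \<open>Given \<theta> = 1 the boundary is always reached, so the payoff is a + alpha * sqrt
  (remaining time). Extending the bound from a cap at S to the full horizon costs at most alpha *
  sqrt (1 - t - S), which tends to 0.\<close>

lemma pinned_part:
  assumes t: "t < 1" and x: "x < bridge_boundary a t"
  shows "integrable M (\<lambda>\<omega>. stopped_payoff \<omega> * indicator (theta_is 1) \<omega>)"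
    "prob (theta_is 1) * bridge_value a t x \<le> expectation (\<lambda>\<omega>. stopped_payoff \<omega> * indicator (theta_is 1) \<omega>)"
proof -
  let ?c = "1 - t"
  have c: "0 < ?c" using t by simp
  define \<tau> where "\<tau> \<omega> = dyadic_hit_time ?c (boundary_gap \<omega>)" for \<omega>
  have \<tau>b: "0 \<le> \<tau> \<omega>" "\<tau> \<omega> \<le> ?c" for \<omega> unfolding \<tau>_def by (rule dyadic_hit_time_bounds[OF c])+
  have [measurable]: "\<tau> \<in> borel_measurable M"
    unfolding \<tau>_def using t
    by (intro measurable_dyadic_hit_time borel_measurable_diff X_shifted_in_borel borel_measurable_const) auto
  note [measurable] = stopped_payoff_measurable[OF t]
  have al: "0 < alpha" by (rule alpha_properties)
  define R where "R \<omega> = sqrt (?c - \<tau> \<omega>) * indicator (theta_is 1) \<omega>" for \<omega>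
  have R: "0 \<le> R \<omega>" "R \<omega> \<le> sqrt ?c" for \<omega> using \<tau>b[of \<omega>] t by (auto simp: R_def indicator_def)
  have Rm[measurable]: "R \<in> borel_measurable M" unfolding R_def by measurable
  have Ri: "integrable M R"
    by (rule integrable_const_bound[where B="sqrt ?c"]) (use R in auto)
  have Ii: "integrable M (indicator (theta_is 1) :: 'w \<Rightarrow> real)"
    by (simp add: integrable_indicator_iff less_top[symmetric])
  have ae: "AE \<omega> in M. stopped_payoff \<omega> * indicator (theta_is 1) \<omega> = a * indicator (theta_is 1) \<omega> + alpha * R \<omega>"
    using good_paths AE_X_start[OF t]
  proof eventually_elim
    case (elim \<omega>)
    show ?case
    proof (cases "\<theta> \<omega> = 1")
      case False
      then show ?thesis by (simp add: R_def)
    next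
      case True
      have el: "\<omega> \<in> space M" "continuous_on {0..} (\<lambda>s. B s \<omega>)" "B 0 \<omega> = 0" using elim(1) by blast+
      have X1: "X 1 \<omega> = a"
        by (rule bridge_path_X(4)[OF t el], rule bridge_dynamics[OF True]) (use elim(1) in blast)+
      note f = gap_continuous[OF t el(1)]
      \<comment> \<open>At time 1 the boundary equals \<open>a\<close>, where the pinned path ends,
        so a hit occurs at the latest then.\<close>
      have ex: "\<exists>s\<in>{0..?c}. 0 \<le> boundary_gap \<omega> s"
        using t X1 by (intro bexI[of _ ?c]) (simp_all add: bridge_boundary_def)
      have "boundary_gap \<omega> 0 < 0" using elim(2) x by simp
      from first_nonneg_zero[OF f ex this]
      have "X (t + \<tau> \<omega>) \<omega> = bridge_boundary a (t + \<tau> \<omega>)"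
        using first_nonneg_eq_dyadic_hit_time[OF c f] by (simp add: \<tau>_def)
      then have "stopped_payoff \<omega> = a + alpha * sqrt (?c - \<tau> \<omega>)"
        using X_stopped[OF t el(1)] by (simp add: \<tau>_def bridge_boundary_def diff_diff_eq)
      then show ?thesis by (simp add: R_def algebra_simps)
    qed
  qed
  have Ui: "integrable M (\<lambda>\<omega>. a * indicator (theta_is 1) \<omega> + alpha * R \<omega>)"
    using Ri Ii by simp
  show "integrable M (\<lambda>\<omega>. stopped_payoff \<omega> * indicator (theta_is 1) \<omega>)"
    by (subst integrable_cong_AE[OF _ _ ae]) (use Ui in auto)
  have E: "expectation (\<lambda>\<omega>. stopped_payoff \<omega> * indicator (theta_is 1) \<omega>) = a * prob (theta_is 1) + alpha * expectation R"
  proof -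
    have "expectation (\<lambda>\<omega>. stopped_payoff \<omega> * indicator (theta_is 1) \<omega>)
        = expectation (\<lambda>\<omega>. a * indicator (theta_is 1) \<omega> + alpha * R \<omega>)"
      by (rule integral_cong_AE[OF _ _ ae]) auto
    then show ?thesis using Ri Ii by simp
  qed
  have approx: "prob (theta_is 1) * (bridge_value a t x - a) \<le> alpha * (expectation R + sqrt (?c - S))"
    if S: "0 < S" "S < ?c" for S
  proof -
    let ?\<sigma> = "\<lambda>\<omega>. dyadic_hit_time S (boundary_gap \<omega>)"
    have \<sigma>b: "0 \<le> ?\<sigma> \<omega>" "?\<sigma> \<omega> \<le> S" for \<omega> by (rule dyadic_hit_time_bounds[OF S(1)])+
    have [measurable]: "?\<sigma> \<in> borel_measurable M"
      using S by (intro measurable_dyadic_hit_time borel_measurable_diff X_shifted_measurable[of _ S] borel_measurable_const) auto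
    have le: "sqrt (?c - ?\<sigma> \<omega>) * indicator (theta_is 1) \<omega> \<le> R \<omega> + sqrt (?c - S)" if \<omega>: "\<omega> \<in> space M" for \<omega>
    proof -
      note f = gap_continuous[OF t \<omega>]
      have fS: "continuous_on {0..S} (boundary_gap \<omega>)" by (rule continuous_on_subset[OF f]) (use S in auto)
      have eq: "?\<sigma> \<omega> = first_nonneg S (boundary_gap \<omega>)" "\<tau> \<omega> = first_nonneg ?c (boundary_gap \<omega>)"
        unfolding \<tau>_def using first_nonneg_eq_dyadic_hit_time[OF S(1) fS] first_nonneg_eq_dyadic_hit_time[OF c f] by simp_all
      \<comment> \<open>After a hit by time \<open>S\<close>, the uncapped time is no later than the
        capped one. Otherwise the capped time is \<open>S\<close>, and the extra term alone covers
        the left side.\<close>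
      have "sqrt (?c - ?\<sigma> \<omega>) \<le> sqrt (?c - \<tau> \<omega>) + sqrt (?c - S)"
      proof (cases "\<exists>s\<in>{0..S}. 0 \<le> boundary_gap \<omega> s")
        case True
        then have "\<tau> \<omega> \<le> ?\<sigma> \<omega>"
          unfolding eq using first_nonneg_attained[OF fS True] \<sigma>b[of \<omega>] S
          by (intro first_nonneg_lower) (auto simp: eq)
        then have "sqrt (?c - ?\<sigma> \<omega>) \<le> sqrt (?c - \<tau> \<omega>)" by simp
        moreover have "0 \<le> sqrt (?c - S)" using S by simp
        ultimately show ?thesis by linarith
      next
        case False
        then have "?\<sigma> \<omega> = S" unfolding eq by (simp add: first_nonneg_def)
        then show ?thesis using \<tau>b[of \<omega>] by simp
      qed
      moreover have "0 \<le> sqrt (?c - S)" using S by simp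
      ultimately show ?thesis using R(1)[of \<omega>] by (auto simp: R_def indicator_def)
    qed
    have i: "integrable M (\<lambda>\<omega>. sqrt (?c - ?\<sigma> \<omega>) * indicator (theta_is 1) \<omega>)"
    proof (rule integrable_const_bound[where B="sqrt ?c"])
      have "0 \<le> sqrt (?c - ?\<sigma> \<omega>) \<and> sqrt (?c - ?\<sigma> \<omega>) \<le> sqrt ?c" for \<omega> using \<sigma>b[of \<omega>] S by simp
      then show "AE \<omega> in M. norm (sqrt (?c - ?\<sigma> \<omega>) * indicator (theta_is 1) \<omega>) \<le> sqrt ?c"
        using t by (auto simp: indicator_def)
    qed measurable
    have "expectation (\<lambda>\<omega>. sqrt (?c - ?\<sigma> \<omega>) * indicator (theta_is 1) \<omega>) \<le> expectation (\<lambda>\<omega>. R \<omega> + sqrt (?c - S))"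
      by (intro integral_mono i le) (use Ri in auto)
    also have "\<dots> = expectation R + sqrt (?c - S)" using Ri by (simp add: prob_space)
    finally have "alpha * expectation (\<lambda>\<omega>. sqrt (?c - ?\<sigma> \<omega>) * indicator (theta_is 1) \<omega>) \<le> alpha * (expectation R + sqrt (?c - S))"
      using al by (intro mult_left_mono) auto
    then show ?thesis using sqrt_remaining_bound[OF S x] by (rule order_trans[rotated])
  qed
  \<comment> \<open>The caps are S = ?c - ?c / 2 ^ Suc n; the successor keeps S positive already for
    n = 0.\<close>
  have lim: "(\<lambda>n. alpha * (expectation R + sqrt (?c / 2 ^ Suc n))) \<longlonglongrightarrow> alpha * (expectation R + sqrt 0)"
    by (intro tendsto_intros tendsto_real_sqrt LIMSEQ_Suc[OF mesh_tendsto_0])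
  have "prob (theta_is 1) * (bridge_value a t x - a) \<le> alpha * (expectation R + sqrt 0)"
  proof (rule LIMSEQ_le_const[OF lim], intro exI[of _ 0] allI impI)
    fix n :: nat
    have "(1::real) < 2 ^ Suc n" by (rule one_less_power) auto
    then have "?c / 2 ^ Suc n < ?c" using c by (simp add: divide_less_eq del: power_Suc)
    moreover have "0 < ?c / 2 ^ Suc n" using c by simp
    ultimately show "prob (theta_is 1) * (bridge_value a t x - a) \<le> alpha * (expectation R + sqrt (?c / 2 ^ Suc n))"
      using approx[of "?c - ?c / 2 ^ Suc n"] by simp
  qed
  then show "prob (theta_is 1) * bridge_value a t x \<le> expectation (\<lambda>\<omega>. stopped_payoff \<omega> * indicator (theta_is 1) \<omega>)"
    unfolding E by (simp add: algebra_simps)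
qed

text \<open>Given \<theta> = 0 the payoff is the functional \<open>\<Psi>\<close> of the increments
  of \<open>B\<close> alone. It is therefore independent of \<theta>, and its mean factors
  out.\<close>

lemma free_part:
  assumes t: "t < 1"
  defines "\<Psi> \<equiv> \<lambda>\<omega>. dyadic_stopped (1 - t) (\<lambda>s. bridge_boundary a (t + s)) (\<lambda>r. x + a * r + (B r \<omega> - B 0 \<omega>))"
  shows "integrable M (\<lambda>\<omega>. stopped_payoff \<omega> * indicator (theta_is 0) \<omega>)"
    "expectation (\<lambda>\<omega>. stopped_payoff \<omega> * indicator (theta_is 0) \<omega>) = prob (theta_is 0) * expectation \<Psi>"
proof -
  let ?c = "1 - t" and ?b = "\<lambda>s. bridge_boundary a (t + s)"
  have c: "0 < ?c" using t by simp
  have \<Psi>p: "\<Psi> \<in> borel_measurable (past ?c ?c)"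
    unfolding \<Psi>_def
    by (intro measurable_dyadic_stopped[OF c] borel_measurable_add borel_measurable_const measurable_past
        bridge_boundary_measurable) (auto dest: dyadics_bounds[OF c])
  have \<Psi>m[measurable]: "\<Psi> \<in> borel_measurable M"
    by (rule measurable_from_subalg[OF past_subalgebra[OF c] \<Psi>p])
  have D: "distributed M lborel (\<lambda>\<omega>. B ?c \<omega> - B 0 \<omega>) (normal_density 0 (sqrt (?c - 0)))"
    using c by (intro BM_normal) auto
  have Bi: "integrable M (\<lambda>\<omega>. B ?c \<omega> - B 0 \<omega>)"
    using c by (subst distributed_integrable[OF D, of "\<lambda>z. z", symmetric]) (auto simp: integrable_normal_moment_nz_1)
  have \<Psi>i: "integrable M \<Psi>"
  proof (rule Bochner_Integration.integrable_bound)
    show "integrable M (\<lambda>\<omega>. \<bar>x\<bar> + \<bar>x + a * ?c + (B ?c \<omega> - B 0 \<omega>)\<bar> + (\<bar>a\<bar> + alpha * sqrt (1 - t)))"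
      using Bi by (intro Bochner_Integration.integrable_add integrable_abs) auto
    have "\<bar>\<Psi> \<omega>\<bar> \<le> \<bar>x\<bar> + \<bar>x + a * ?c + (B ?c \<omega> - B 0 \<omega>)\<bar> + (\<bar>a\<bar> + alpha * sqrt (1 - t))" for \<omega>
      using dyadic_stopped_bound[where b="?b" and Y="\<lambda>r. x + a * r + (B r \<omega> - B 0 \<omega>)",
          OF c bridge_boundary_bounded[OF t, of _ a]]
      unfolding \<Psi>_def by simp
    then show "AE \<omega> in M. norm (\<Psi> \<omega>)
        \<le> norm (\<bar>x\<bar> + \<bar>x + a * ?c + (B ?c \<omega> - B 0 \<omega>)\<bar> + (\<bar>a\<bar> + alpha * sqrt (1 - t)))"
      by (auto intro: order_trans[OF _ abs_ge_self])
  qed measurable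
  have ae: "AE \<omega> in M. stopped_payoff \<omega> * indicator (theta_is 0) \<omega> = \<Psi> \<omega> * indicator (theta_is 0) \<omega>"
    using good_paths
  proof eventually_elim
    case (elim \<omega>)
    show ?case
    proof (cases "\<theta> \<omega> = 0")
      case False
      then show ?thesis by simp
    next
      case True
      have el: "\<omega> \<in> space M" "continuous_on {0..} (\<lambda>s. B s \<omega>)" "B 0 \<omega> = 0" using elim by blast+
      have pre: "X (t + s) \<omega> = x + a * s + B s \<omega>" if s: "0 \<le> s" "s < ?c" for s
      proof -
        have "X (t + s) \<omega> = x + integral {0..s}
            (\<lambda>r. (1 - \<theta> \<omega>) * a + \<theta> \<omega> * ((a - X (t + r) \<omega>) / (1 - t - r))) + B s \<omega>"
          using elim s by blast
        then show ?thesis unfolding True using s by (simp add: mult.commute)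
      qed
      have at: "at ?c within {0..?c} = at_left ?c" using c by (intro at_within_Icc_at_left)
      have "((\<lambda>s. X (t + s) \<omega>) \<longlongrightarrow> X (t + ?c) \<omega>) (at ?c within {0..?c})"
        using c by (intro X_path_continuous[OF t el(1), unfolded continuous_on, rule_format]) auto
      moreover have "continuous_on {0..?c} (\<lambda>s. x + a * s + B s \<omega>)"
        by (intro continuous_intros continuous_on_subset[OF el(2)]) auto
      then have "((\<lambda>s. x + a * s + B s \<omega>) \<longlongrightarrow> x + a * ?c + B ?c \<omega>) (at ?c within {0..?c})"
        unfolding continuous_on using c by auto
      then have "((\<lambda>s. X (t + s) \<omega>) \<longlongrightarrow> x + a * ?c + B ?c \<omega>) (at ?c within {0..?c})"
        unfolding at
      proof (rule Lim_transform_eventually)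
        have "\<forall>\<^sub>F s in at_left ?c. s \<in> {0<..<?c}"
          using eventually_at_left[of 0 ?c] c by (auto intro!: exI[of _ 0])
        then show "\<forall>\<^sub>F s in at_left ?c. x + a * s + B s \<omega> = X (t + s) \<omega>"
          by eventually_elim (simp add: pre)
      qed
      \<comment> \<open>The dynamics stop short of the terminal time, so the value there is
        recovered as a limit from the left.\<close>
      ultimately have Xc: "X (t + ?c) \<omega> = x + a * ?c + B ?c \<omega>"
        unfolding at by (intro tendsto_unique[of "at_left ?c"]) auto
      have "stopped_payoff \<omega> = \<Psi> \<omega>"
        unfolding \<Psi>_def
      proof (rule dyadic_stopped_cong)
        fix r assume "r \<in> dyadics ?c"
        then have "0 \<le> r" "r \<le> ?c" using dyadics_bounds[OF c] by auto
        then show "X (t + r) \<omega> = x + a * r + (B r \<omega> - B 0 \<omega>)"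
          using pre[of r] Xc el(3) by (cases "r = ?c") auto
      qed
      then show ?thesis by simp
    qed
  qed
  note [measurable] = stopped_payoff_measurable[OF t]
  note ti = theta_indep_past[OF c \<Psi>p \<Psi>i, of 0]
  show "integrable M (\<lambda>\<omega>. stopped_payoff \<omega> * indicator (theta_is 0) \<omega>)"
    by (subst integrable_cong_AE[OF _ _ ae]) (use ti(1) in auto)
  have "expectation (\<lambda>\<omega>. stopped_payoff \<omega> * indicator (theta_is 0) \<omega>) = expectation (\<lambda>\<omega>. \<Psi> \<omega> * indicator (theta_is 0) \<omega>)"
    by (rule integral_cong_AE[OF _ _ ae]) auto
  then show "expectation (\<lambda>\<omega>. stopped_payoff \<omega> * indicator (theta_is 0) \<omega>) = prob (theta_is 0) * expectation \<Psi>"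
    using ti(2) by simp
qed

lemma stopped_payoff_above:
  assumes t: "t < 1" and x: "bridge_boundary a t \<le> x"
  shows "expectation stopped_payoff = x"
proof -
  have "AE \<omega> in M. stopped_payoff \<omega> = x"
    using AE_X_start[OF t] by eventually_elim (simp add: dyadic_stopped_def x)
  then have "expectation stopped_payoff = expectation (\<lambda>_. x)"
    using stopped_payoff_measurable[OF t] by (intro integral_cong_AE) auto
  then show ?thesis by (simp add: prob_space)
qed

lemma expectation_stopped_payoff_split:
  assumes t: "t < 1" and "integrable M (\<lambda>\<omega>. stopped_payoff \<omega> * indicator (theta_is 1) \<omega>)"
  shows "expectation stopped_payoff = expectation (\<lambda>\<omega>. stopped_payoff \<omega> * indicator (theta_is 0) \<omega>)
    + expectation (\<lambda>\<omega>. stopped_payoff \<omega> * indicator (theta_is 1) \<omega>)"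
proof -
  note [measurable] = stopped_payoff_measurable[OF t]
  have "AE \<omega> in M. stopped_payoff \<omega>
      = stopped_payoff \<omega> * indicator (theta_is 0) \<omega> + stopped_payoff \<omega> * indicator (theta_is 1) \<omega>"
    using AE_theta by eventually_elim (auto simp: indicator_def)
  then have "expectation stopped_payoff = expectation (\<lambda>\<omega>. stopped_payoff \<omega> * indicator (theta_is 0) \<omega>
      + stopped_payoff \<omega> * indicator (theta_is 1) \<omega>)"
    by (intro integral_cong_AE) measurable
  then show ?thesis using free_part(1)[OF t] assms(2) by simp
qed

end

theorem proposition4p2:
  fixes M :: "'w measure" and M\<^sub>0 :: "'v measure"
    and a t x p :: real
    and \<theta> :: "'w \<Rightarrow> real" and B X :: "real \<Rightarrow> 'w \<Rightarrow> real"
    and \<theta>\<^sub>0 :: "'v \<Rightarrow> real" and B\<^sub>0 X\<^sub>0 :: "real \<Rightarrow> 'v \<Rightarrow> real"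
  assumes "0 \<le> t" and "t < 1"
    and "0 \<le> p" and "p \<le> 1"
    and "embedded_problem M a t x p \<theta> B X"
    and "embedded_problem M\<^sub>0 a t x 0 \<theta>\<^sub>0 B\<^sub>0 X\<^sub>0"
  shows "stopping_value M t X \<ge> ereal
    ((1 - belief a t x p) *
        (\<integral>\<omega>. X\<^sub>0 (real_of_ereal (min (ereal t + boundary_hitting_time a t X\<^sub>0 \<omega>) 1)) \<omega> \<partial>M\<^sub>0)
      + belief a t x p * bridge_value a t x)"
proof -
  interpret E: embedded_problem M a t x p \<theta> B X by fact
  interpret Z: embedded_problem M\<^sub>0 a t x 0 \<theta>\<^sub>0 B\<^sub>0 X\<^sub>0 by fact
  note t = \<open>t < 1\<close>
  let ?b = "\<lambda>s. bridge_boundary a (t + s)"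
  have payoff0: "(\<integral>\<omega>. X\<^sub>0 (real_of_ereal (min (ereal t + boundary_hitting_time a t X\<^sub>0 \<omega>) 1)) \<omega> \<partial>M\<^sub>0)
      = Z.expectation Z.stopped_payoff"
    by (intro Bochner_Integration.integral_cong refl) (simp only: Z.capped_hitting_time[OF t] Z.X_stopped[OF t])
  have "ereal (\<integral>\<omega>. X (t + dyadic_hit_time (1 - t) (E.boundary_gap \<omega>)) \<omega> \<partial>M) \<le> stopping_value M t X"
    unfolding stopping_value_def by (rule SUP_upper[OF E.hit_time_admissible[OF t]])
  also have "(\<integral>\<omega>. X (t + dyadic_hit_time (1 - t) (E.boundary_gap \<omega>)) \<omega> \<partial>M) = E.expectation E.stopped_payoff"
    by (intro Bochner_Integration.integral_cong refl E.X_stopped[OF t])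
  finally have le: "ereal (E.expectation E.stopped_payoff) \<le> stopping_value M t X" .
  have "(1 - belief a t x p) * Z.expectation Z.stopped_payoff + belief a t x p * bridge_value a t x
      \<le> E.expectation E.stopped_payoff"
  proof (cases "x < bridge_boundary a t")
    \<comment> \<open>From the boundary upwards stopping is immediate in both problems and
      \<open>bridge_value\<close> is \<open>x\<close>, so both sides equal \<open>x\<close>.\<close>
    case False
    then show ?thesis
      using E.stopped_payoff_above[OF t] Z.stopped_payoff_above[OF t] by (simp add: bridge_value_def algebra_simps)
  next
    case True
    \<comment> \<open>With prior 0 the belief is 0, so \<open>\<theta>\<^sub>0\<close> vanishes
      almost surely and the indicator can be inserted at no cost.\<close>
    have q0: "Z.prob (Z.theta_is 0) = 1" using Z.theta_0 by (simp add: belief_def)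
    then have ae: "AE \<omega> in M\<^sub>0. \<omega> \<in> Z.theta_is 0"
      by (subst (asm) Z.prob_eq_1) auto
    have "Z.expectation Z.stopped_payoff = Z.expectation (\<lambda>\<omega>. Z.stopped_payoff \<omega> * indicator (Z.theta_is 0) \<omega>)"
      using ae Z.stopped_payoff_measurable[OF t] by (intro integral_cong_AE) auto
    also have "\<dots> = Z.expectation (\<lambda>\<omega>. dyadic_stopped (1 - t) ?b (\<lambda>r. x + a * r + (B\<^sub>0 r \<omega> - B\<^sub>0 0 \<omega>)))"
      using Z.free_part(2)[OF t] q0 by simp
    \<comment> \<open>The two spaces share only the law of their driving motions; the drifted path
      functional has the same mean on both.\<close>
    also have "\<dots> = E.expectation (\<lambda>\<omega>. dyadic_stopped (1 - t) ?b (\<lambda>r. x + a * r + (B r \<omega> - B 0 \<omega>)))"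
      using t by (intro brownian_stopped_expectation_unique Z.standard_brownian_motion_axioms
          E.standard_brownian_motion_axioms bridge_boundary_measurable) simp
    finally have "(1 - belief a t x p) * Z.expectation Z.stopped_payoff
        = E.expectation (\<lambda>\<omega>. E.stopped_payoff \<omega> * indicator (E.theta_is 0) \<omega>)"
      using E.free_part(2)[OF t] E.theta_0 by simp
    then show ?thesis
      using E.expectation_stopped_payoff_split[OF t E.pinned_part(1)[OF t True]]
        E.pinned_part(2)[OF t True] E.theta_1 by simp
  qed
  then have "ereal ((1 - belief a t x p) * Z.expectation Z.stopped_payoff + belief a t x p * bridge_value a t x)
      \<le> ereal (E.expectation E.stopped_payoff)" by simp
  also note le
  finally show ?thesis unfolding payoff0 .
qed

end
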